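(* Let $p, r \in \mathbb{N}$ and consider, for each sample size $T$, the path $(X_t)_{1 \le t \le T}$ generated by $$\Theta(L) X_t = \left(\alpha_0 + \alpha_1 \tfrac{t}{T} + \dots + \alpha_r \left(\tfrac{t}{T}\right)^r\right) \mathbb{I}_{\{\kappa \neq 0\}} + S_t^{\eta} + \varepsilon_t, \qquad 1 \le t \le T,$$ where $\Theta(z) = 1 - \theta_1 z - \dots - \theta_p z^p$ has all its zeroes outside the unit circle, $S_t^\eta = \rho S_{t-1}^\eta + \eta_t$ with $S_0^\eta = 0$ and $|\rho| = 1$, and $(\varepsilon_t)$, $(\eta_t)$ are uncorrelated (strong) white noises of variances $\sigma_\varepsilon^2 > 0$ and $\sigma_\eta^2 \ge 0$. Let $\widehat{K}_T$ be the test statistic defined in the context. Assume that $\sigma_\eta^2 = 0$. Then, as $T \to \infty$, for $\kappa \neq 0$ we have the weak convergence $$\widehat{K}_T \overset{\mathcal{D}}{\longrightarrow} \int_0^1 B_r^2(s)\, \mathrm{d}s,$$ where $(B_r(t), t \in [0,1])$ is the generalized Brownian bridge of order $r$. In addition, for $\kappa = 0$, we have the weak convergence $$\widehat{K}_T \overset{\mathcal{D}}{\longrightarrow} \int_0^1 W^2(s)\, \mathrm{d}s,$$ where $(W(t), t \in [0,1])$ is the standard Wiener process.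
   Context: Model conventions. $L$ is the lag operator ($L^0 = I$), $\mathbb{I}$ is the indicator function, and $\rho \in \{-1, 1\}$. White noises are understood in the strong sense: sequences of independent and identically distributed random variables, centered with finite variance. The coefficients $\theta_i$ and $\alpha_j$ are real. The initial values are $X_{-p+1} = \dots = X_{-1} = X_0 = 0$. The parameter $\kappa$ is a switch: $\kappa \ne 0$ means that a polynomial trend of order $r$ is present in the model and is fitted; $\kappa = 0$ means that no trend is present and none is fitted. Test statistic. Let $\check{\theta}_T = (\check\theta_1, \dots, \check\theta_p)$ be a consistent estimator of $\theta = (\theta_1, \dots, \theta_p)$ (i.e. $\check\theta_T \to \theta$ in probability as $T \to \infty$), and set $\check{X}_t = X_t - \check\theta_1 X_{t-1} - \dots - \check\theta_p X_{t-p}$ for $1 \le t \le T$. If $\kappa \neq 0$, let $\widehat\alpha_T = (\widehat\alpha_0, \dots, \widehat\alpha_r)$ be the ordinary least squares estimator in the regression of $\check X_t$ on $(1, t/T, \dots, (t/T)^r)$, $1 \le t \le T$. Define the residuals $$\widehat\varepsilon_t = \check X_t - \left(\widehat\alpha_0 + \widehat\alpha_1 \tfrac{t}{T} + \dots + \widehat\alpha_r \left(\tfrac{t}{T}\right)^r\right)\mathbb{I}_{\{\kappa \ne 0\}},$$ the partial sums $S_t = \sum_{k=1}^t \widehat\varepsilon_k$ and $Q_t = \sum_{k=1}^t \widehat\varepsilon_k^{\,2}$, and $$\widehat K_T = \frac{1}{T Q_T} \sum_{t=1}^T S_t^2.$$ Generalized Brownian bridge of order $r$. Let $\Lambda(t)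 = (1, t, \dots, t^r)'$ and let $M$ be the $(r+1)\times(r+1)$ matrix with $M_{ij} = 1/(i+j-1)$. For $f \in C([0,1])$ with $f(0) = 0$, let $$h_r(f)(t) = f(t) - \left(\int_0^t \Lambda(s)\,\mathrm{d}s\right)' M^{-1} \left( \Lambda(1) f(1) - \int_0^1 \Lambda'(u) f(u)\, \mathrm{d}u \right),$$ where $\Lambda'(u) = (0, 1, 2u, \dots, r u^{r-1})'$ is the derivative of $\Lambda$. Then $B_r(t) = h_r(W)(t)$, where $W$ is a standard Wiener process on $[0,1]$. For instance $B_0(t) = W(t) - tW(1)$ and $B_1(t) = W(t) + t(2-3t)W(1) - 6t(1-t)\int_0^1 W(s)\,\mathrm{d}s$. *)

theory Defs
  imports
    "HOL-Probability.Probability"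
    "HOL-Computational_Algebra.Polynomial"
    "Jordan_Normal_Form.Gauss_Jordan_Elimination"
    "Jordan_Normal_Form.Determinant"
begin

section \<open>The model\<close>

text \<open>
  A strong white noise \<open>(e\<^sub>t)\<close>, \<open>t \<ge> 1\<close>, of variance \<open>v\<close>. The value of a noise at time 0 is never
  used (\<open>t \<ge> 1\<close> in the model), so nothing is required of it.
\<close>
definition (in prob_space) strong_white_noise :: "(nat \<Rightarrow> 'a \<Rightarrow> real) \<Rightarrow> real \<Rightarrow> bool" where
  "strong_white_noise e v \<longleftrightarrow>
     indep_vars (\<lambda>_. borel) e {1..} \<and>
     (\<forall>t\<ge>1. distr M borel (e t) = distr M borel (e 1)) \<and>
     (\<forall>t\<ge>1. integrable M (\<lambda>\<omega>. (e t \<omega>)\<^sup>2) \<and> expectation (e t) = 0 \<and> variance (e t) = v)"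

definition (in prob_space) uncorrelated_noises ::
    "(nat \<Rightarrow> 'a \<Rightarrow> real) \<Rightarrow> (nat \<Rightarrow> 'a \<Rightarrow> real) \<Rightarrow> bool" where
  "uncorrelated_noises e h \<longleftrightarrow>
     (\<forall>s\<ge>1. \<forall>t\<ge>1.
        expectation (\<lambda>\<omega>. (e s \<omega> - expectation (e s)) * (h t \<omega> - expectation (h t))) = 0)"

text \<open>The process \<open>S\<^sup>\<eta>\<close>: an integrated noise, with unit root at \<open>\<rho> = 1\<close> or \<open>\<rho> = -1\<close>.\<close>
primrec integrated_noise :: "real \<Rightarrow> (nat \<Rightarrow> 'a \<Rightarrow> real) \<Rightarrow> nat \<Rightarrow> 'a \<Rightarrow> real" where
  "integrated_noise \<rho> h 0 \<omega> = 0"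
| "integrated_noise \<rho> h (Suc t) \<omega> = \<rho> * integrated_noise \<rho> h t \<omega> + h (Suc t) \<omega>"

text \<open>
  Paths are indexed by \<^typ>\<open>int\<close>, because the initial values have times \<open>-p+1, \<dots>, 0\<close>.
\<close>
definition lag :: "(int \<Rightarrow> real) \<Rightarrow> int \<Rightarrow> real" where
  "lag x t = x (t - 1)"

definition lag_poly :: "real poly \<Rightarrow> (int \<Rightarrow> real) \<Rightarrow> int \<Rightarrow> real" where
  "lag_poly P x t = (\<Sum>i\<le>degree P. coeff P i * (lag ^^ i) x t)"

definition ar_poly :: "nat \<Rightarrow> (nat \<Rightarrow> real) \<Rightarrow> real poly" where
  "ar_poly p \<theta> = 1 - (\<Sum>i=1..p. monom (\<theta> i) i)"

definition zeros_outside_unit_circle :: "real poly \<Rightarrow> bool" where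
  "zeros_outside_unit_circle P \<longleftrightarrow>
     (\<forall>z::complex. poly (map_poly of_real P) z = 0 \<longrightarrow> norm z > 1)"

definition trend :: "nat \<Rightarrow> (nat \<Rightarrow> real) \<Rightarrow> real \<Rightarrow> real" where
  "trend r a u = (\<Sum>i\<le>r. a i * u ^ i)"


section \<open>The test statistic\<close>

definition (in prob_space) tendsto_in_prob :: "(nat \<Rightarrow> 'a \<Rightarrow> real) \<Rightarrow> real \<Rightarrow> bool" where
  "tendsto_in_prob Y c \<longleftrightarrow> (\<forall>\<delta>>0. (\<lambda>n. prob {\<omega> \<in> space M. \<bar>Y n \<omega> - c\<bar> > \<delta>}) \<longlonglongrightarrow> 0)"

text \<open>
  Only the components \<open>1, \<dots>, p\<close> matter. The convergence of a random vector in \<open>\<real>\<^sup>p\<close> in probability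
  is the convergence of each of its components.
\<close>
definition (in prob_space) consistent_estimator ::
    "nat \<Rightarrow> (nat \<Rightarrow> nat \<Rightarrow> 'a \<Rightarrow> real) \<Rightarrow> (nat \<Rightarrow> real) \<Rightarrow> bool" where
  "consistent_estimator p \<theta>c \<theta> \<longleftrightarrow>
     (\<forall>i\<in>{1..p}. (\<forall>T. random_variable borel (\<theta>c T i)) \<and> tendsto_in_prob (\<lambda>T. \<theta>c T i) (\<theta> i))"

definition ar_filter :: "nat \<Rightarrow> (nat \<Rightarrow> real) \<Rightarrow> (int \<Rightarrow> real) \<Rightarrow> nat \<Rightarrow> real" where
  "ar_filter p \<theta>c x t = x (int t) - (\<Sum>i=1..p. \<theta>c i * x (int t - int i))"

text \<open>
  Least squares fit of \<open>y\<^sub>t\<close> on \<open>(1, t/T, \<dots>, (t/T)\<^sup>r)\<close>, \<open>1 \<le> t \<le> T\<close>. Only \<open>a 0, \<dots>, a r\<close> matter;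
  they are unique if \<open>T \<ge> r + 1\<close>, and the fitted values are unique for every \<open>T\<close>.
\<close>
definition ols_trend_fit :: "nat \<Rightarrow> nat \<Rightarrow> (nat \<Rightarrow> real) \<Rightarrow> (nat \<Rightarrow> real) \<Rightarrow> bool" where
  "ols_trend_fit r T y a \<longleftrightarrow>
     is_arg_min (\<lambda>a. \<Sum>t=1..T. (y t - trend r a (real t / real T))\<^sup>2) (\<lambda>_. True) a"

definition residual ::
    "real \<Rightarrow> nat \<Rightarrow> nat \<Rightarrow> (nat \<Rightarrow> real) \<Rightarrow> (nat \<Rightarrow> real) \<Rightarrow> nat \<Rightarrow> real" where
  "residual \<kappa> r T y a t = y t - trend r a (real t / real T) * indicator {k. k \<noteq> 0} \<kappa>"

definition kpss_stat :: "nat \<Rightarrow> (nat \<Rightarrow> real) \<Rightarrow> real" where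
  "kpss_stat T e =
     (let S = (\<lambda>t. \<Sum>k=1..t. e k); Q = (\<lambda>t. \<Sum>k=1..t. (e k)\<^sup>2)
      in 1 / (real T * Q T) * (\<Sum>t=1..T. (S t)\<^sup>2))"


section \<open>The limit processes\<close>

text \<open>Every path of the process is continuous and starts at 0, so that it lies in \<open>C([0,1])\<close>.\<close>
definition (in prob_space) standard_Wiener :: "(real \<Rightarrow> 'a \<Rightarrow> real) \<Rightarrow> bool" where
  "standard_Wiener W \<longleftrightarrow>
     (\<forall>t\<in>{0..1}. random_variable borel (W t)) \<and>
     (\<forall>\<omega>\<in>space M. W 0 \<omega> = 0 \<and> continuous_on {0..1} (\<lambda>t. W t \<omega>)) \<and>
     (\<forall>s t. 0 \<le> s \<and> s < t \<and> t \<le> 1 \<longrightarrow>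
        distributed M lborel (\<lambda>\<omega>. W t \<omega> - W s \<omega>) (normal_density 0 (sqrt (t - s)))) \<and>
     (\<forall>n (\<tau> :: nat \<Rightarrow> real). 0 \<le> \<tau> 0 \<and> (\<forall>i<n. \<tau> i < \<tau> (Suc i)) \<and> \<tau> n \<le> 1 \<longrightarrow>
        indep_vars (\<lambda>_. borel) (\<lambda>i \<omega>. W (\<tau> (Suc i)) \<omega> - W (\<tau> i) \<omega>) {..<n})"

text \<open>
  Rows and columns are numbered from 0, so the entry \<open>1/(i + j - 1)\<close> of the matrix \<open>M\<close> with
  indices from 1 becomes \<open>1/(i + j + 1)\<close>. This Hilbert matrix is invertible.
\<close>
definition hilbert_mat :: "nat \<Rightarrow> real mat" where
  "hilbert_mat r = Matrix.mat (r + 1) (r + 1) (\<lambda>(i, j). 1 / (real i + real j + 1))"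

definition Lam :: "nat \<Rightarrow> real \<Rightarrow> real Matrix.vec" where
  "Lam r t = Matrix.vec (r + 1) (\<lambda>i. t ^ i)"

definition Lam_deriv :: "nat \<Rightarrow> real \<Rightarrow> real Matrix.vec" where
  "Lam_deriv r u = Matrix.vec (r + 1) (\<lambda>i. real i * u ^ (i - 1))"

text \<open>The integral of a vector-valued function over \<open>[a,b]\<close>, by components.\<close>
definition vec_integral :: "nat \<Rightarrow> real \<Rightarrow> real \<Rightarrow> (real \<Rightarrow> real Matrix.vec) \<Rightarrow> real Matrix.vec" where
  "vec_integral n a b g = Matrix.vec n (\<lambda>i. integral {a..b} (\<lambda>u. vec_index (g u) i))"

definition bridge :: "nat \<Rightarrow> (real \<Rightarrow> real) \<Rightarrow> real \<Rightarrow> real" where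
  "bridge r f t =
     f t - scalar_prod (vec_integral (r + 1) 0 t (Lam r))
             (the (mat_inverse (hilbert_mat r)) *\<^sub>v
               (f 1 \<cdot>\<^sub>v Lam r 1 -
                vec_integral (r + 1) 0 1 (\<lambda>u. f u \<cdot>\<^sub>v Lam_deriv r u)))"

lemma the_mat_inverse_eqI:
  fixes A B :: "real mat"
  assumes A: "A \<in> carrier_mat n n" and B: "B \<in> carrier_mat n n" and AB: "A * B = 1\<^sub>m n"
  shows "the (mat_inverse A) = B"
proof -
  have BA: "B * A = 1\<^sub>m n" using mat_mult_left_right_inverse[OF A B AB] .
  then have "A \<in> Units (ring_mat TYPE(real) n ())"
    using A B AB unfolding Units_def ring_mat_def by auto
  then obtain C where C: "mat_inverse A = Some C" using mat_inverse(1)[OF A, of "()"] by fastforce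
  from mat_inverse(2)[OF A C] have CA: "C * A = 1\<^sub>m n" and C': "C \<in> carrier_mat n n"
    by auto
  have "C = C * (A * B)"
    using AB C' by simp
  also have "\<dots> = C * A * B"
    using assoc_mult_mat[OF C' A B] by simp
  also have "\<dots> = B"
    using CA B by simp
  finally have "C = B" .
  with C show ?thesis by simp
qed

lemma bridge_0: "t \<ge> 0 \<Longrightarrow> bridge 0 f t = f t - t * f 1"
proof -
  assume t: "t \<ge> 0"
  have i: "the (mat_inverse (hilbert_mat 0)) = 1\<^sub>m 1"
    by (rule the_mat_inverse_eqI[where n=1]) (auto simp: hilbert_mat_def)
  show ?thesis using t unfolding bridge_def i
    by (simp add: scalar_prod_def Lam_def Lam_deriv_def vec_integral_def)
qed

lemma bridge_1:
  assumes t: "t \<ge> 0"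
  shows "bridge 1 f t = f t + t * (2 - 3 * t) * f 1 - 6 * t * (1 - t) * integral {0..1} f"
proof -
  define A :: "real mat" where
    "A = Matrix.mat 2 2 (\<lambda>(i, j). if i = 0 then (if j = 0 then 4 else -6)
                                 else (if j = 0 then -6 else 12))"
  have sum2: "sum g {0..<2} = g 0 + g 1" for g :: "nat \<Rightarrow> real"
    by (simp add: numeral_2_eq_2)
  have H: "hilbert_mat 1 \<in> carrier_mat 2 2" and A: "A \<in> carrier_mat 2 2"
    by (auto simp: A_def hilbert_mat_def)
  have "hilbert_mat 1 * A = 1\<^sub>m 2"
  proof (rule eq_matI)
    fix i j assume "i < dim_row (1\<^sub>m 2 :: real mat)" "j < dim_col (1\<^sub>m 2 :: real mat)"
    then have "i = 0 \<or> i = 1" "j = 0 \<or> j = 1" by auto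
    then show "(hilbert_mat 1 * A) $$ (i, j) = 1\<^sub>m 2 $$ (i, j)"
      by (elim disjE) (simp_all add: A_def hilbert_mat_def scalar_prod_def sum2)
  qed (simp_all add: A_def hilbert_mat_def)
  then have inv: "the (mat_inverse (hilbert_mat 1)) = A"
    by (rule the_mat_inverse_eqI[OF H A])
  have I: "integral {0..t} (\<lambda>u. u) = t\<^sup>2 / 2"
    using ident_has_integral[of 0 t] t by (auto simp: has_integral_iff)
  show ?thesis
    using t unfolding bridge_def inv A_def
    apply (simp add: scalar_prod_def Lam_def Lam_deriv_def vec_integral_def mult_mat_vec_def I
        numeral_2_eq_2)
    apply (simp add: field_simps power2_eq_square)
    done
qed

end

theory Submission
  imports Defs "HOL-Complex_Analysis.Cauchy_Integral_Formula"
begin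

text \<open>If \<open>\<sigma>\<^sub>\<eta>\<^sup>2 = 0\<close>, then \<open>S\<^sup>\<eta>\<close> vanishes almost surely and \<open>\<Theta>(L) X\<^sub>t\<close> is a trend plus \<open>\<epsilon>\<^sub>t\<close>. By a
  Beveridge-Nelson argument the partial sums of the estimated innovations are \<open>1 + o(1)\<close> times those
  of trend plus noise, up to \<open>o(\<surd>T)\<close>; the least squares residuals annihilate the trend exactly. So the
  statistic differs by a term that vanishes in probability from a quadratic form
  \<open>F\<^sub>T = T\<inverse> \<Sum>\<^sub>t (\<Sum>\<^sub>k c\<^sub>t\<^sub>k x\<^sub>k)\<^sup>2\<close> in \<open>x\<^sub>k = \<epsilon>\<^sub>k / (\<sigma> \<surd>T)\<close> with bounded coefficients.

  No functional central limit theorem is needed: in the Laplace transform of \<open>F\<^sub>T\<close> the \<open>x\<^sub>k\<close> are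
  exchanged one by one for the increments of the Wiener process over a grid of mesh \<open>1/T\<close>
  (Lindeberg's method). As a function of one coordinate, \<open>exp(-s F\<^sub>T)\<close> is the exponential of a
  nonpositive quadratic polynomial, whose derivatives are bounded uniformly in the other coordinates;
  two moments are therefore enough. For the increments of a continuous path, \<open>F\<^sub>T\<close> converges to the
  integral of the squared bridge, and Laplace transforms determine weak convergence by the Weierstrass
  approximation theorem in the variable \<open>exp(-x)\<close>.\<close>

text \<open>The estimator \<open>\<theta>c\<close> is merely consistent: it has no rate and may
  depend on the noise in any way. Whatever involves it is therefore a pathwise inequality for fixed
  \<open>n\<close> in which the estimation error is a factor. Crude estimates suffice for the other
  factor. A single value of the path is at most a constant times the trend bound plus the Euclidean
  norm of the noise, which is of order sqrt n; the small factor then makes the boundary term of the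
  Beveridge-Nelson decomposition o(sqrt n), and no maximal inequality enters.

  In the exchange, the Taylor remainder is the minimum of y^2 and |y|^3. At y = Y / sqrt n its mean
  is o(1/n), so \<open>n\<close> exchanges cost o(1) in total. The obstacle is the linear
  coefficient in one coordinate, which depends on all the others and is unbounded. It is harmless
  because a nonnegative quadratic with a steep slope is itself large, and the exponential damps it.

  Noise and Wiener process live on unrelated spaces, so they are compared only through laws. The
  cases with and without trend are one: without trend the inverse Gram matrix is replaced by the
  zero matrix.\<close>

section \<open>Convergence in probability\<close>

text \<open>Convergence of a sequence of random variables in probability is convergence of a function of
  \<open>(n, \<omega>)\<close> along this filter, so that the calculus of limits applies to it. The exceptional sets
  need not be measurable: they are only contained in events of small probability.\<close>
definition in_prob :: "'a measure \<Rightarrow> (nat \<times> 'a) filter" where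
  "in_prob M = Abs_filter (\<lambda>P. \<forall>e>0. \<forall>\<^sub>F n in sequentially.
     \<exists>E\<in>sets M. measure M E < e \<and> {\<omega> \<in> space M. \<not> P (n, \<omega>)} \<subseteq> E)"

lemma (in prob_space) eventually_in_prob:
  "eventually P (in_prob M) \<longleftrightarrow> (\<forall>e>0. \<forall>\<^sub>F n in sequentially.
     \<exists>E\<in>events. prob E < e \<and> {\<omega> \<in> space M. \<not> P (n, \<omega>)} \<subseteq> E)"
  unfolding in_prob_def
proof (rule eventually_Abs_filter, rule is_filter.intro)
  show "\<forall>e>0. \<forall>\<^sub>F n in sequentially. \<exists>E\<in>events. prob E < e \<and> {\<omega> \<in> space M. \<not> True} \<subseteq> E"
    by (auto intro!: always_eventually bexI[of _ "{}"])
next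
  fix P Q :: "nat \<times> 'a \<Rightarrow> bool"
  assume P: "\<forall>e>0. \<forall>\<^sub>F n in sequentially. \<exists>E\<in>events. prob E < e \<and> {\<omega> \<in> space M. \<not> P (n, \<omega>)} \<subseteq> E"
    and Q: "\<forall>e>0. \<forall>\<^sub>F n in sequentially. \<exists>E\<in>events. prob E < e \<and> {\<omega> \<in> space M. \<not> Q (n, \<omega>)} \<subseteq> E"
  show "\<forall>e>0. \<forall>\<^sub>F n in sequentially. \<exists>E\<in>events. prob E < e \<and>
          {\<omega> \<in> space M. \<not> (P (n, \<omega>) \<and> Q (n, \<omega>))} \<subseteq> E"
  proof (intro allI impI)
    fix e :: real assume "e > 0"
    \<comment> \<open>Union bound: each of the two exceptional events gets half of the
      probability.\<close>
    then have "e / 2 > 0" by simp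
    with P Q have "\<forall>\<^sub>F n in sequentially. \<exists>E\<in>events. prob E < e / 2 \<and> {\<omega> \<in> space M. \<not> P (n, \<omega>)} \<subseteq> E"
      "\<forall>\<^sub>F n in sequentially. \<exists>E\<in>events. prob E < e / 2 \<and> {\<omega> \<in> space M. \<not> Q (n, \<omega>)} \<subseteq> E" by blast+
    then show "\<forall>\<^sub>F n in sequentially. \<exists>E\<in>events. prob E < e \<and>
          {\<omega> \<in> space M. \<not> (P (n, \<omega>) \<and> Q (n, \<omega>))} \<subseteq> E"
    proof eventually_elim
      case (elim n)
      then obtain E E' where E: "E \<in> events" "prob E < e / 2" "{\<omega> \<in> space M. \<not> P (n, \<omega>)} \<subseteq> E"
        "E' \<in> events" "prob E' < e / 2" "{\<omega> \<in> space M. \<not> Q (n, \<omega>)} \<subseteq> E'" by blast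
      have "prob (E \<union> E') \<le> prob E + prob E'" using E by (intro measure_Un_le) auto
      with E show ?case by (intro bexI[of _ "E \<union> E'"]) auto
    qed
  qed
next
  fix P Q :: "nat \<times> 'a \<Rightarrow> bool"
  assume PQ: "\<forall>x. P x \<longrightarrow> Q x"
    and P: "\<forall>e>0. \<forall>\<^sub>F n in sequentially. \<exists>E\<in>events. prob E < e \<and> {\<omega> \<in> space M. \<not> P (n, \<omega>)} \<subseteq> E"
  show "\<forall>e>0. \<forall>\<^sub>F n in sequentially. \<exists>E\<in>events. prob E < e \<and> {\<omega> \<in> space M. \<not> Q (n, \<omega>)} \<subseteq> E"
  proof (intro allI impI)
    fix e :: real assume "e > 0"
    with P have "\<forall>\<^sub>F n in sequentially. \<exists>E\<in>events. prob E < e \<and> {\<omega> \<in> space M. \<not> P (n, \<omega>)} \<subseteq> E"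
      by blast
    then show "\<forall>\<^sub>F n in sequentially. \<exists>E\<in>events. prob E < e \<and> {\<omega> \<in> space M. \<not> Q (n, \<omega>)} \<subseteq> E"
      by eventually_elim (use PQ in blast)
  qed
qed

lemma (in prob_space) eventually_in_prob_AE:
  assumes "\<forall>\<^sub>F n in sequentially. AE \<omega> in M. P (n, \<omega>)"
  shows "eventually P (in_prob M)"
  unfolding eventually_in_prob
proof (intro allI impI)
  fix e :: real assume e: "e > 0"
  show "\<forall>\<^sub>F n in sequentially. \<exists>E\<in>events. prob E < e \<and> {\<omega> \<in> space M. \<not> P (n, \<omega>)} \<subseteq> E"
    using assms
  proof eventually_elim
    case (elim n)
    from AE_E[OF this] obtain E where "{\<omega> \<in> space M. \<not> P (n, \<omega>)} \<subseteq> E" "emeasure M E = 0" "E \<in> events" .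
    then show ?case using e by (intro bexI[of _ E]) (auto simp: measure_def)
  qed
qed

lemma (in prob_space) eventually_in_prob_space:
  assumes "\<forall>\<^sub>F n in sequentially. \<forall>\<omega>\<in>space M. P (n, \<omega>)"
  shows "eventually P (in_prob M)"
  by (rule eventually_in_prob_AE, rule eventually_mono[OF assms]) (simp add: AE_I2)

lemma (in prob_space) tendsto_in_probI:
  fixes Y :: "nat \<Rightarrow> 'a \<Rightarrow> real"
  assumes [measurable]: "\<And>n. Y n \<in> borel_measurable M"
    and "tendsto_in_prob Y c"
  shows "((\<lambda>(n, \<omega>). Y n \<omega>) \<longlongrightarrow> c) (in_prob M)"
proof (rule tendstoI)
  fix d :: real assume d: "d > 0"
  \<comment> \<open>Half of \<open>d\<close>, because the definition controls strict exceedances,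
    whereas the exceptional set below also contains equality.\<close>
  then have "(\<lambda>n. prob {\<omega> \<in> space M. \<bar>Y n \<omega> - c\<bar> > d / 2}) \<longlonglongrightarrow> 0"
    using assms(2) unfolding tendsto_in_prob_def by (meson half_gt_zero)
  show "\<forall>\<^sub>F x in in_prob M. dist (case x of (n, \<omega>) \<Rightarrow> Y n \<omega>) c < d"
    unfolding eventually_in_prob
  proof (intro allI impI)
    fix e :: real assume "e > 0"
    with \<open>_ \<longlonglongrightarrow> 0\<close> have "\<forall>\<^sub>F n in sequentially. prob {\<omega> \<in> space M. \<bar>Y n \<omega> - c\<bar> > d / 2} < e"
      by (rule order_tendstoD)
    then show "\<forall>\<^sub>F n in sequentially. \<exists>E\<in>events. prob E < e \<and>
       {\<omega> \<in> space M. \<not> dist (case (n, \<omega>) of (n, \<omega>) \<Rightarrow> Y n \<omega>) c < d} \<subseteq> E"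
    proof eventually_elim
      case (elim n)
      then show ?case using d
        by (intro bexI[of _ "{\<omega> \<in> space M. \<bar>Y n \<omega> - c\<bar> > d / 2}"]) (auto simp: dist_real_def)
    qed
  qed
qed

text \<open>By Markov's inequality; this is how moment bounds enter the calculus of limits in
  probability.\<close>

lemma (in prob_space) tendsto_in_prob_expectation:
  fixes Y :: "nat \<Rightarrow> 'a \<Rightarrow> real"
  assumes int: "\<forall>\<^sub>F n in sequentially. integrable M (Y n)"
    and lim: "(\<lambda>n. expectation (\<lambda>\<omega>. \<bar>Y n \<omega>\<bar>)) \<longlonglongrightarrow> 0"
  shows "((\<lambda>(n, \<omega>). Y n \<omega>) \<longlongrightarrow> 0) (in_prob M)"
proof (rule tendstoI)
  fix d :: real assume d: "d > 0"
  show "\<forall>\<^sub>F x in in_prob M. dist (case x of (n, \<omega>) \<Rightarrow> Y n \<omega>) 0 < d"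
    unfolding eventually_in_prob
  proof (intro allI impI)
    fix e :: real assume e: "e > 0"
    with d have "e * d > 0" by simp
    with lim have "\<forall>\<^sub>F n in sequentially. expectation (\<lambda>\<omega>. \<bar>Y n \<omega>\<bar>) < e * d"
      by (rule order_tendstoD)
    with int show "\<forall>\<^sub>F n in sequentially. \<exists>E\<in>events. prob E < e \<and>
       {\<omega> \<in> space M. \<not> dist (case (n, \<omega>) of (n, \<omega>) \<Rightarrow> Y n \<omega>) 0 < d} \<subseteq> E"
    proof eventually_elim
      case (elim n)
      note [measurable] = borel_measurable_integrable[OF elim(1)]
      have "prob {\<omega> \<in> space M. \<bar>Y n \<omega>\<bar> \<ge> d} \<le> expectation (\<lambda>\<omega>. \<bar>Y n \<omega>\<bar>) / d"
        using elim d by (intro integral_Markov_inequality_measure[where A="{}"]) auto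
      also have "\<dots> < e" using elim d by (simp add: divide_simps)
      finally show ?case using d
        by (intro bexI[of _ "{\<omega> \<in> space M. \<bar>Y n \<omega>\<bar> \<ge> d}"]) auto
    qed
  qed
qed

text \<open>The rule o(1) times O(1) = o(1) in probability. Boundedness in mean stands in for
  tightness, which it implies by Markov's inequality.\<close>

lemma (in prob_space) tendsto_in_prob_mult_bounded_expectation:
  fixes Y Z :: "nat \<Rightarrow> 'a \<Rightarrow> real"
  assumes Z: "((\<lambda>(n, \<omega>). Z n \<omega>) \<longlongrightarrow> 0) (in_prob M)"
    and Y: "\<forall>\<^sub>F n in sequentially. integrable M (Y n) \<and> expectation (\<lambda>\<omega>. \<bar>Y n \<omega>\<bar>) \<le> C"
  shows "((\<lambda>(n, \<omega>). Z n \<omega> * Y n \<omega>) \<longlongrightarrow> 0) (in_prob M)"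
proof (rule tendstoI)
  fix d :: real assume d: "d > 0"
  show "\<forall>\<^sub>F x in in_prob M. dist (case x of (n, \<omega>) \<Rightarrow> Z n \<omega> * Y n \<omega>) 0 < d"
    unfolding eventually_in_prob
  proof (intro allI impI)
    fix e :: real assume e: "e > 0"
    \<comment> \<open>Leaves probability at most \<open>e / 2\<close> for a large
      \<open>Y n\<close>; the \<open>+ 1\<close> keeps \<open>B\<close> positive when
      \<open>C\<close> is 0.\<close>
    define B where "B = 2 * (\<bar>C\<bar> + 1) / e"
    have B: "B > 0" using e by (simp add: B_def)
    then have "d / B > 0" using d by simp
    with Z have "\<forall>\<^sub>F x in in_prob M. dist (case x of (n, \<omega>) \<Rightarrow> Z n \<omega>) 0 < d / B"
      by (rule tendstoD)
    then have "\<forall>\<^sub>F n in sequentially. \<exists>E\<in>events. prob E < e / 2 \<and>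
       {\<omega> \<in> space M. \<not> dist (case (n, \<omega>) of (n, \<omega>) \<Rightarrow> Z n \<omega>) 0 < d / B} \<subseteq> E"
      unfolding eventually_in_prob using half_gt_zero[OF e] by blast
    with Y show "\<forall>\<^sub>F n in sequentially. \<exists>E\<in>events. prob E < e \<and>
       {\<omega> \<in> space M. \<not> dist (case (n, \<omega>) of (n, \<omega>) \<Rightarrow> Z n \<omega> * Y n \<omega>) 0 < d} \<subseteq> E"
    proof eventually_elim
      case (elim n)
      then obtain E where E: "E \<in> events" "prob E < e / 2"
        "{\<omega> \<in> space M. \<not> \<bar>Z n \<omega>\<bar> < d / B} \<subseteq> E" by auto
      note [measurable] = borel_measurable_integrable[OF conjunct1[OF elim(1)]]
      let ?E = "{\<omega> \<in> space M. \<bar>Y n \<omega>\<bar> \<ge> B}"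
      have "prob ?E \<le> expectation (\<lambda>\<omega>. \<bar>Y n \<omega>\<bar>) / B"
        using elim B by (intro integral_Markov_inequality_measure[where A="{}"]) auto
      also have "\<dots> \<le> C / B" using elim B by (simp add: divide_right_mono)
      also have "\<dots> \<le> \<bar>C\<bar> / B" using B by (simp add: divide_right_mono)
      also have "\<dots> = (\<bar>C\<bar> / (\<bar>C\<bar> + 1)) * (e / 2)" using e by (simp add: B_def field_simps)
      also have "\<dots> \<le> 1 * (e / 2)" using e by (intro mult_right_mono) auto
      finally have "prob ?E \<le> e / 2" by simp
      moreover have "prob (E \<union> ?E) \<le> prob E + prob ?E"
        using E by (intro measure_Un_le) auto
      ultimately have lt: "prob (E \<union> ?E) < e" using E by simp
      have "\<bar>Z n \<omega> * Y n \<omega>\<bar> < d" if "\<bar>Z n \<omega>\<bar> < d / B" "\<bar>Y n \<omega>\<bar> < B" for \<omega>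
      proof -
        have "\<bar>Z n \<omega> * Y n \<omega>\<bar> = \<bar>Z n \<omega>\<bar> * \<bar>Y n \<omega>\<bar>" by (rule abs_mult)
        also have "\<dots> < d / B * B" using that by (intro mult_strict_mono) (auto simp: d B)
        finally show ?thesis using B by simp
      qed
      then have "{\<omega> \<in> space M. \<not> \<bar>Z n \<omega> * Y n \<omega>\<bar> < d} \<subseteq> E \<union> ?E"
        using E(3) by (auto simp: subset_iff not_less) (meson not_less)
      with lt show ?case using E(1)
        by (intro bexI[of _ "E \<union> ?E"]) auto
    qed
  qed
qed

text \<open>Slutsky's argument for one test function: uniform continuity handles the outcomes where
  the two variables are close, boundedness the rare event where they are not. No limit law of either
  sequence is presupposed.\<close>

lemma (in prob_space) expectation_diff_tendsto_0:
  fixes f :: "real \<Rightarrow> real" and Y Z :: "nat \<Rightarrow> 'a \<Rightarrow> real"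
  assumes f: "uniformly_continuous_on UNIV f" and bdd: "\<And>x. \<bar>f x\<bar> \<le> B"
    and YZ: "((\<lambda>(n, \<omega>). Y n \<omega> - Z n \<omega>) \<longlongrightarrow> 0) (in_prob M)"
    and meas: "\<forall>\<^sub>F n in sequentially. Y n \<in> borel_measurable M \<and> Z n \<in> borel_measurable M"
  shows "(\<lambda>n. expectation (\<lambda>\<omega>. f (Y n \<omega>)) - expectation (\<lambda>\<omega>. f (Z n \<omega>))) \<longlonglongrightarrow> 0"
proof (rule tendstoI)
  fix e :: real assume e: "e > 0"
  have B: "B \<ge> 0" using bdd[of 0] by linarith
  have [measurable]: "f \<in> borel_measurable borel"
    using f by (intro borel_measurable_continuous_onI uniformly_continuous_imp_continuous)
  obtain d where d: "d > 0" "\<And>x y. dist x y < d \<Longrightarrow> dist (f x) (f y) < e / 2"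
    using f e unfolding uniformly_continuous_on_def by (metis UNIV_I half_gt_zero)
  have "\<forall>\<^sub>F x in in_prob M. dist (case x of (n, \<omega>) \<Rightarrow> Y n \<omega> - Z n \<omega>) 0 < d"
    using YZ d(1) by (rule tendstoD)
  \<comment> \<open>On the exceptional event the difference is at most \<open>2 * B\<close>, so an
    event of this probability contributes less than \<open>e / 2\<close>; \<open>B\<close> may be
    0.\<close>
  moreover have "e / (4 * (B + 1)) > 0" using e B by simp
  ultimately have "\<forall>\<^sub>F n in sequentially. \<exists>E\<in>events. prob E < e / (4 * (B + 1)) \<and>
       {\<omega> \<in> space M. \<not> dist (case (n, \<omega>) of (n, \<omega>) \<Rightarrow> Y n \<omega> - Z n \<omega>) 0 < d} \<subseteq> E"
    unfolding eventually_in_prob by blast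
  with meas show "\<forall>\<^sub>F n in sequentially.
      dist (expectation (\<lambda>\<omega>. f (Y n \<omega>)) - expectation (\<lambda>\<omega>. f (Z n \<omega>))) 0 < e"
  proof eventually_elim
    case (elim n)
    then obtain E where E[measurable]: "E \<in> events" and E': "prob E < e / (4 * (B + 1))"
        "{\<omega> \<in> space M. \<not> \<bar>Y n \<omega> - Z n \<omega>\<bar> < d} \<subseteq> E" by auto
    from elim have [measurable]: "Y n \<in> borel_measurable M" "Z n \<in> borel_measurable M" by auto
    have i: "integrable M (\<lambda>\<omega>. f (Y n \<omega>))" "integrable M (\<lambda>\<omega>. f (Z n \<omega>))"
      using bdd by (auto intro!: integrable_const_bound[where B=B])
    have iE: "integrable M (\<lambda>\<omega>. 2 * B * indicator E \<omega>)"
      by (auto intro!: integrable_mult_right integrable_real_indicator simp: less_top[symmetric])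
    have "\<bar>expectation (\<lambda>\<omega>. f (Y n \<omega>)) - expectation (\<lambda>\<omega>. f (Z n \<omega>))\<bar>
        = \<bar>expectation (\<lambda>\<omega>. f (Y n \<omega>) - f (Z n \<omega>))\<bar>" using i by simp
    also have "\<dots> \<le> expectation (\<lambda>\<omega>. \<bar>f (Y n \<omega>) - f (Z n \<omega>)\<bar>)" by (rule integral_abs_bound)
    also have "\<dots> \<le> expectation (\<lambda>\<omega>. e / 2 + 2 * B * indicator E \<omega>)"
    proof (rule integral_mono)
      fix \<omega> assume w: "\<omega> \<in> space M"
      show "\<bar>f (Y n \<omega>) - f (Z n \<omega>)\<bar> \<le> e / 2 + 2 * B * indicator E \<omega>"
      proof (cases "\<omega> \<in> E")
        case True
        then show ?thesis using bdd[of "Y n \<omega>"] bdd[of "Z n \<omega>"] e by simp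
      next
        case False
        then have "dist (Y n \<omega>) (Z n \<omega>) < d" using E' w by (auto simp: dist_real_def)
        from d(2)[OF this] False show ?thesis by (simp add: dist_real_def)
      qed
    qed (use i iE in auto)
    also have "\<dots> = e / 2 + 2 * B * prob E"
      using iE by (simp add: prob_space)
    also have "2 * B * prob E \<le> 2 * B * (e / (4 * (B + 1)))"
      using E' B by (intro mult_left_mono) auto
    also have "\<dots> = (B / (B + 1)) * (e / 2)" using B by (simp add: divide_simps)
    also have "\<dots> < 1 * (e / 2)" using B e by (intro mult_strict_right_mono) auto
    finally show ?case by simp
  qed
qed

section \<open>Weak convergence from Laplace transforms\<close>

text \<open>With z = exp (- x) a polynomial in z is a combination of functions exp (- i x), so
  integer arguments of the transform are enough. The test function must extend continuously to z =
  0, that is, to x at infinity; it does so by vanishing beyond \<open>b\<close>.\<close>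

lemma laplace_conv_imp_expectation_conv:
  fixes F :: "nat \<Rightarrow> 'a \<Rightarrow> real" and G :: "'b \<Rightarrow> real"
  assumes M: "prob_space M" and N: "prob_space N"
    and F: "\<forall>\<^sub>F n in sequentially. F n \<in> borel_measurable M" "\<And>n \<omega>. \<omega> \<in> space M \<Longrightarrow> F n \<omega> \<ge> 0"
    and G: "G \<in> borel_measurable N" "\<And>\<omega>. \<omega> \<in> space N \<Longrightarrow> G \<omega> \<ge> 0"
    and laplace: "\<And>s::nat. (\<lambda>n. \<integral>\<omega>. exp (- real s * F n \<omega>) \<partial>M) \<longlonglongrightarrow> (\<integral>\<omega>. exp (- real s * G \<omega>) \<partial>N)"
    and f: "continuous_on UNIV f" "\<And>x. x > b \<Longrightarrow> f x = 0"
  shows "(\<lambda>n. \<integral>\<omega>. f (F n \<omega>) \<partial>M) \<longlonglongrightarrow> (\<integral>\<omega>. f (G \<omega>) \<partial>N :: real)"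
proof (rule tendstoI)
  fix e :: real assume e: "e > 0"
  interpret M: prob_space M by fact
  interpret N: prob_space N by fact
  have [measurable]: "f \<in> borel_measurable borel"
    by (rule borel_measurable_continuous_onI[OF f(1)])
  \<comment> \<open>\<open>f\<close> composed with minus the logarithm. The cut at exp (- b - 1)
    keeps the logarithm away from 0; below it the value is constantly \<open>f (b + 1)\<close>,
    which is 0.\<close>
  define g where "g z = f (- ln (max z (exp (- b - 1))))" for z :: real
  have g_exp: "g (exp (- x)) = f x" for x
  proof (cases "x \<le> b + 1")
    case True
    then have "max (exp (- x)) (exp (- b - 1)) = exp (- x)" by (simp add: max_def)
    then show ?thesis by (simp add: g_def)
  next
    case False
    then have "max (exp (- x)) (exp (- b - 1)) = exp (- (b + 1))" by (simp add: max_def)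
    then show ?thesis using False f(2)[of x] f(2)[of "1 + b"] by (simp add: g_def)
  qed
  have max_pos: "max z (exp (- b - 1)) > 0" for z
    by (rule less_le_trans[OF exp_gt_zero max.cobounded2])
  have "continuous_on {0..1} g"
    unfolding g_def
    by (rule continuous_on_compose2[OF f(1)])
      (use max_pos in \<open>auto intro!: continuous_intros simp: less_le\<close>)
  then obtain p where p: "real_polynomial_function p" "\<And>z. z \<in> {0..1} \<Longrightarrow> \<bar>g z - p z\<bar> < e / 3"
    using Stone_Weierstrass_real_polynomial_function[of "{0..1}" g "e / 3"] e by auto
  then obtain a d where p_eq: "p = (\<lambda>z. \<Sum>i\<le>d. a i * z ^ i)"
    unfolding real_polynomial_function_iff_sum by blast
  define q where "q x = (\<Sum>i\<le>d. a i * exp (- real i * x))" for x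
  have fq: "\<bar>f x - q x\<bar> \<le> e / 3" if "x \<ge> 0" for x
    using p(2)[of "exp (- x)"] that
    by (simp add: g_exp p_eq q_def exp_of_nat_mult[symmetric] less_imp_le)
  \<comment> \<open>Stated for an arbitrary space, since it serves \<open>F n\<close> on
    \<open>M\<close> and \<open>G\<close> on \<open>N\<close>. Together with the difference of the
    two polynomial sums this makes three errors of \<open>e / 3\<close>.\<close>
  have approx: "\<bar>(\<integral>\<omega>. f (Z \<omega>) \<partial>Q) - (\<Sum>i\<le>d. a i * (\<integral>\<omega>. exp (- real i * Z \<omega>) \<partial>Q))\<bar> \<le> e / 3"
    if Q: "prob_space Q" and Z[measurable]: "Z \<in> borel_measurable Q" and Z0: "\<And>\<omega>. \<omega> \<in> space Q \<Longrightarrow> Z \<omega> \<ge> 0"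
    for Q :: "'c measure" and Z
  proof -
    interpret Q: prob_space Q by fact
    have i: "integrable Q (\<lambda>\<omega>. exp (- real i * Z \<omega>))" for i
      using Z0 by (intro Q.integrable_const_bound[where B=1] AE_I2) auto
    have iq: "integrable Q (\<lambda>\<omega>. q (Z \<omega>))"
      unfolding q_def by (intro Bochner_Integration.integrable_sum integrable_mult_right i)
    have ifq: "integrable Q (\<lambda>\<omega>. f (Z \<omega>) - q (Z \<omega>))"
      using fq Z0 by (intro Q.integrable_const_bound[where B="e / 3"] AE_I2) (auto simp: q_def)
    have "integrable Q (\<lambda>\<omega>. f (Z \<omega>))"
      using Bochner_Integration.integrable_add[OF ifq iq] by simp
    then have "(\<integral>\<omega>. f (Z \<omega>) \<partial>Q) - (\<integral>\<omega>. q (Z \<omega>) \<partial>Q) = (\<integral>\<omega>. f (Z \<omega>) - q (Z \<omega>) \<partial>Q)"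
      using iq by simp
    also have "\<bar>\<dots>\<bar> \<le> (\<integral>\<omega>. \<bar>f (Z \<omega>) - q (Z \<omega>)\<bar> \<partial>Q)" by (rule integral_abs_bound)
    also have "\<dots> \<le> (\<integral>\<omega>. e / 3 \<partial>Q)" using fq Z0 ifq by (intro integral_mono) auto
    finally have "\<bar>(\<integral>\<omega>. f (Z \<omega>) \<partial>Q) - (\<integral>\<omega>. q (Z \<omega>) \<partial>Q)\<bar> \<le> e / 3" by (simp add: Q.prob_space)
    moreover have "(\<integral>\<omega>. q (Z \<omega>) \<partial>Q) = (\<Sum>i\<le>d. a i * (\<integral>\<omega>. exp (- real i * Z \<omega>) \<partial>Q))"
      unfolding q_def using i by (subst Bochner_Integration.integral_sum) auto
    ultimately show ?thesis by simp
  qed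
  have "(\<lambda>n. \<Sum>i\<le>d. a i * (\<integral>\<omega>. exp (- real i * F n \<omega>) \<partial>M))
      \<longlonglongrightarrow> (\<Sum>i\<le>d. a i * (\<integral>\<omega>. exp (- real i * G \<omega>) \<partial>N))"
    by (intro tendsto_intros laplace)
  moreover have "e / 3 > 0" using e by simp
  ultimately have "\<forall>\<^sub>F n in sequentially. dist (\<Sum>i\<le>d. a i * (\<integral>\<omega>. exp (- real i * F n \<omega>) \<partial>M))
      (\<Sum>i\<le>d. a i * (\<integral>\<omega>. exp (- real i * G \<omega>) \<partial>N)) < e / 3"
    by (rule tendstoD)
  with F(1) show "\<forall>\<^sub>F n in sequentially. dist (\<integral>\<omega>. f (F n \<omega>) \<partial>M) (\<integral>\<omega>. f (G \<omega>) \<partial>N) < e"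
  proof eventually_elim
    case (elim n)
    show ?case using approx[OF M elim(1) F(2)] approx[OF N G] elim(2)
      unfolding dist_real_def by linarith
  qed
qed

text \<open>Only the tail of the sequence has to consist of random variables; the \<open>distr\<close> of a
  function that is not measurable is a junk value.\<close>
lemma weak_conv_m_distrI:
  fixes F :: "nat \<Rightarrow> 'a \<Rightarrow> real" and G :: "'b \<Rightarrow> real"
  assumes M: "prob_space M" and N: "prob_space N"
    and F: "\<forall>\<^sub>F n in sequentially. F n \<in> borel_measurable M"
    and G: "G \<in> borel_measurable N"
    and conv: "\<And>x y. x < y \<Longrightarrow>
      (\<lambda>n. \<integral>\<omega>. cts_step x y (F n \<omega>) \<partial>M) \<longlonglongrightarrow> (\<integral>\<omega>. cts_step x y (G \<omega>) \<partial>N)"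
  shows "weak_conv_m (\<lambda>n. distr M borel (F n)) (distr N borel G)"
proof -
  interpret M: prob_space M by fact
  interpret N: prob_space N by fact
  from F obtain n0 where n0: "\<And>n. n \<ge> n0 \<Longrightarrow> F n \<in> borel_measurable M"
    unfolding eventually_sequentially by blast
  have cm[measurable]: "cts_step x y \<in> borel_measurable borel" if "x < y" for x y
    using cts_step_uniformly_continuous[OF that]
    by (intro borel_measurable_continuous_onI uniformly_continuous_imp_continuous)
  have "weak_conv_m (\<lambda>n. distr M borel (F (n + n0))) (distr N borel G)"
  proof (rule integral_cts_step_conv_imp_weak_conv)
    show "real_distribution (distr M borel (F (n + n0)))" for n
      using n0 by (intro M.real_distribution_distr) simp
    show "real_distribution (distr N borel G)" using G by (rule N.real_distribution_distr)
    fix x y :: real assume xy: "x < y"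
    have "(\<lambda>n. \<integral>\<omega>. cts_step x y (F (n + n0) \<omega>) \<partial>M) \<longlonglongrightarrow> (\<integral>\<omega>. cts_step x y (G \<omega>) \<partial>N)"
      using conv[OF xy] by (rule LIMSEQ_ignore_initial_segment)
    then show "(\<lambda>n. integral\<^sup>L (distr M borel (F (n + n0))) (cts_step x y))
        \<longlonglongrightarrow> integral\<^sup>L (distr N borel G) (cts_step x y)"
      using n0 G cm[OF xy] by (simp add: integral_distr)
  qed
  then show ?thesis
    unfolding weak_conv_m_def weak_conv_def
    by (auto intro: LIMSEQ_offset[where k=n0])
qed

section \<open>Exchange of the innovations in a quadratic form\<close>

text \<open>Lindeberg's exchange of one coordinate at a time.\<close>
lemma PiM_integral_swap:
  fixes f :: "('i \<Rightarrow> real) \<Rightarrow> real" and e :: real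
  assumes "finite I" and mu: "real_distribution \<mu>" and nu: "real_distribution \<nu>"
    and "f \<in> borel_measurable (PiM I (\<lambda>_. borel))" and "\<And>x. \<bar>f x\<bar> \<le> B"
    and "\<And>i x. i \<in> I \<Longrightarrow> x \<in> space (PiM I (\<lambda>_. borel)) \<Longrightarrow>
           \<bar>(\<integral>y. f (x(i := y)) \<partial>\<mu>) - (\<integral>y. f (x(i := y)) \<partial>\<nu>)\<bar> \<le> e"
  shows "\<bar>integral\<^sup>L (PiM I (\<lambda>_. \<mu>)) f - integral\<^sup>L (PiM I (\<lambda>_. \<nu>)) f\<bar> \<le> card I * e"
  using assms(1,4-)
proof (induction I arbitrary: f rule: finite_induct)
  case empty
  interpret m: product_prob_space "\<lambda>_. \<mu>" UNIV
    by (intro product_prob_spaceI) (use mu in \<open>simp add: real_distribution_def\<close>)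
  interpret n: product_prob_space "\<lambda>_. \<nu>" UNIV
    by (intro product_prob_spaceI) (use nu in \<open>simp add: real_distribution_def\<close>)
  show ?case by (simp add: PiM_empty lebesgue_integral_count_space_finite)
next
  case (insert i I)
  interpret mu: real_distribution \<mu> by (rule mu)
  interpret nu: real_distribution \<nu> by (rule nu)
  interpret m: product_prob_space "\<lambda>_. \<mu>" UNIV
    by (intro product_prob_spaceI mu.prob_space_axioms)
  interpret n: product_prob_space "\<lambda>_. \<nu>" UNIV
    by (intro product_prob_spaceI nu.prob_space_axioms)
  have sets_mu: "sets (PiM J (\<lambda>_. \<mu>)) = sets (PiM J (\<lambda>_. borel))"
    and sets_nu: "sets (PiM J (\<lambda>_. \<nu>)) = sets (PiM J (\<lambda>_. borel))" for J :: "'i set"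
    by (intro sets_PiM_cong; simp)+
  note [measurable_cong] = sets_mu sets_nu
  note [measurable] = insert.prems(1)
  have p: "prob_space (PiM J (\<lambda>_. \<mu>))" "prob_space (PiM J (\<lambda>_. \<nu>))" for J :: "'i set"
    by (intro prob_space_PiM mu.prob_space_axioms nu.prob_space_axioms)+
  \<comment> \<open>Integrating out coordinate \<open>i\<close> leaves a function of the remaining
    ones, fit for the induction hypothesis.\<close>
  define G where "G Q x = (\<integral>y. f (x(i := y)) \<partial>Q)" for Q x
  have bdd_int: "integrable Q h" if "prob_space Q" "h \<in> borel_measurable Q" "\<And>x. \<bar>h x\<bar> \<le> B"
    for Q :: "'c measure" and h :: "'c \<Rightarrow> real"
  proof -
    interpret prob_space Q by fact
    show ?thesis using that by (auto intro!: integrable_const_bound[where B=B])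
  qed
  have bdd_le: "\<bar>integral\<^sup>L Q h\<bar> \<le> b" if "prob_space Q" "integrable Q h" "\<And>x. x \<in> space Q \<Longrightarrow> \<bar>h x\<bar> \<le> b"
    for Q :: "'c measure" and h :: "'c \<Rightarrow> real" and b
  proof -
    interpret prob_space Q by fact
    have "\<bar>integral\<^sup>L Q h\<bar> \<le> (\<integral>x. \<bar>h x\<bar> \<partial>Q)" by (rule integral_abs_bound)
    also have "\<dots> \<le> (\<integral>x. b \<partial>Q)" using that by (intro integral_mono) auto
    finally show ?thesis by (simp add: prob_space)
  qed
  have upd[measurable]: "(\<lambda>(x, y). f (x(i := y))) \<in> borel_measurable (PiM I (\<lambda>_. borel) \<Otimes>\<^sub>M borel)"
    using measurable_comp[OF measurable_add_dim[of i I "\<lambda>_. borel"] insert.prems(1)]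
    by (simp add: comp_def case_prod_beta')
  have Gm[measurable]: "G Q \<in> borel_measurable (PiM I (\<lambda>_. borel))" if "real_distribution Q" for Q
  proof -
    interpret Q: real_distribution Q by fact
    have "(\<lambda>(x, y). f (x(i := y))) \<in> borel_measurable (PiM I (\<lambda>_. borel) \<Otimes>\<^sub>M Q)"
      by measurable
    then show ?thesis unfolding G_def
      by (intro Q.borel_measurable_lebesgue_integral) simp
  qed
  have Gb: "\<bar>G Q x\<bar> \<le> B" if "real_distribution Q" for Q x
  proof (cases "integrable Q (\<lambda>y. f (x(i := y)))")
    case True
    interpret Q: real_distribution Q by fact
    show ?thesis unfolding G_def using True insert.prems(2) Q.prob_space_axioms by (intro bdd_le)
  next
    case False
    then show ?thesis using insert.prems(2)[of x] by (simp add: G_def not_integrable_integral_eq)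
  qed
  note Gmu = Gm[OF mu] Gb[OF mu] and Gnu = Gm[OF nu] Gb[OF nu]
  have split_mu: "integral\<^sup>L (PiM (insert i I) (\<lambda>_. \<mu>)) f = integral\<^sup>L (PiM I (\<lambda>_. \<mu>)) (G \<mu>)"
    unfolding G_def using insert by (intro m.product_integral_insert bdd_int p) simp_all
  have split_nu: "integral\<^sup>L (PiM (insert i I) (\<lambda>_. \<nu>)) f = integral\<^sup>L (PiM I (\<lambda>_. \<nu>)) (G \<nu>)"
    unfolding G_def using insert by (intro n.product_integral_insert bdd_int p) simp_all
  \<comment> \<open>Coordinate \<open>i\<close> already carries the law \<nu> here. The bound for
    one exchange passes from \<open>f\<close> to \<open>G \<nu>\<close> by Fubini's theorem, as an
    average over the value at \<open>i\<close>.\<close>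
  have "\<bar>integral\<^sup>L (PiM I (\<lambda>_. \<mu>)) (G \<nu>) - integral\<^sup>L (PiM I (\<lambda>_. \<nu>)) (G \<nu>)\<bar> \<le> card I * e"
  proof (rule insert.IH)
    fix j x assume j: "j \<in> I" and x: "x \<in> space (PiM I (\<lambda>_. borel :: real measure))"
    have ij: "i \<noteq> j" using j insert by auto
    have "(\<lambda>(z, y). (x(j := z), y)) \<in> borel \<Otimes>\<^sub>M borel \<rightarrow>\<^sub>M PiM I (\<lambda>_. borel) \<Otimes>\<^sub>M borel"
      unfolding case_prod_beta' using x j
      by (intro measurable_Pair measurable_fun_upd[where J=I]) auto
    from measurable_comp[OF this upd] have joint: "(\<lambda>(z, y). f (x(i := y, j := z)))
        \<in> borel_measurable (borel \<Otimes>\<^sub>M borel)"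
      using ij by (simp add: comp_def case_prod_beta' fun_upd_twist)
    have swap: "(\<integral>z. G \<nu> (x(j := z)) \<partial>Q) = (\<integral>y. (\<integral>z. f (x(i := y, j := z)) \<partial>Q) \<partial>\<nu>)"
      and int: "integrable \<nu> (\<lambda>y. \<integral>z. f (x(i := y, j := z)) \<partial>Q)"
      if "real_distribution Q" for Q
    proof -
      interpret Q: real_distribution Q by fact
      interpret pair_sigma_finite \<nu> Q ..
      interpret QN: pair_prob_space \<nu> Q ..
      have "integrable (\<nu> \<Otimes>\<^sub>M Q) (\<lambda>(y, z). f (x(i := y, j := z)))"
      proof (rule bdd_int[OF QN.prob_space_axioms])
        show "(\<lambda>(y, z). f (x(i := y, j := z))) \<in> borel_measurable (\<nu> \<Otimes>\<^sub>M Q)"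
          using measurable_compose[OF measurable_pair_swap' joint]
          by (simp add: case_prod_beta' cong: measurable_cong_sets)
      qed (use insert.prems(2) in auto)
      note I = this
      show "(\<integral>z. G \<nu> (x(j := z)) \<partial>Q) = (\<integral>y. (\<integral>z. f (x(i := y, j := z)) \<partial>Q) \<partial>\<nu>)"
        unfolding G_def using Fubini_integral[OF I] ij by (simp add: fun_upd_twist)
      show "integrable \<nu> (\<lambda>y. \<integral>z. f (x(i := y, j := z)) \<partial>Q)"
        using integrable_fst[OF I] by simp
    qed
    have "(\<integral>z. G \<nu> (x(j := z)) \<partial>\<mu>) - (\<integral>z. G \<nu> (x(j := z)) \<partial>\<nu>)
      = (\<integral>y. (\<integral>z. f (x(i := y, j := z)) \<partial>\<mu>) - (\<integral>z. f (x(i := y, j := z)) \<partial>\<nu>) \<partial>\<nu>)"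
      unfolding swap[OF mu] swap[OF nu] using int[OF mu] int[OF nu] by simp
    also have "\<bar>\<dots>\<bar> \<le> e"
    proof (rule bdd_le[OF nu.prob_space_axioms])
      fix y
      have "x(i := y) \<in> space (PiM (insert i I) (\<lambda>_. borel :: real measure))"
        using x by (auto simp: space_PiM PiE_def extensional_def)
      then show "\<bar>(\<integral>z. f (x(i := y, j := z)) \<partial>\<mu>) - (\<integral>z. f (x(i := y, j := z)) \<partial>\<nu>)\<bar> \<le> e"
        by (rule insert.prems(3)[OF insertI2[OF j]])
    qed (use int[OF mu] int[OF nu] in simp)
    finally show "\<bar>(\<integral>y. G \<nu> (x(j := y)) \<partial>\<mu>) - (\<integral>y. G \<nu> (x(j := y)) \<partial>\<nu>)\<bar> \<le> e" .
  qed (use Gnu in auto)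
  moreover have "\<bar>integral\<^sup>L (PiM I (\<lambda>_. \<mu>)) (G \<mu>) - integral\<^sup>L (PiM I (\<lambda>_. \<mu>)) (G \<nu>)\<bar> \<le> e"
  proof -
    have i: "integrable (PiM I (\<lambda>_. \<mu>)) (G \<mu>)" "integrable (PiM I (\<lambda>_. \<mu>)) (G \<nu>)"
      using Gmu Gnu by (auto intro!: bdd_int p)
    then have "integral\<^sup>L (PiM I (\<lambda>_. \<mu>)) (G \<mu>) - integral\<^sup>L (PiM I (\<lambda>_. \<mu>)) (G \<nu>)
        = (\<integral>x. G \<mu> x - G \<nu> x \<partial>PiM I (\<lambda>_. \<mu>))" by simp
    also have "\<bar>\<dots>\<bar> \<le> e"
    proof (rule bdd_le[OF p(1)])
      fix x assume x: "x \<in> space (PiM I (\<lambda>_. \<mu>))"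
      \<comment> \<open>A point of the product over \<open>I\<close> is undefined at
        \<open>i\<close>; it is completed to a point over \<open>insert i I\<close>, and the value 0
        is overwritten at once.\<close>
      define x' where "x' = x(i := 0)"
      have "x' \<in> space (PiM (insert i I) (\<lambda>_. borel :: real measure))"
        using x by (auto simp: x'_def space_PiM PiE_def extensional_def)
      from insert.prems(3)[OF insertI1 this] show "\<bar>G \<mu> x - G \<nu> x\<bar> \<le> e"
        unfolding G_def x'_def fun_upd_upd .
    qed (use i in simp)
    finally show ?thesis .
  qed
  ultimately have "\<bar>integral\<^sup>L (PiM I (\<lambda>_. \<mu>)) (G \<mu>) - integral\<^sup>L (PiM I (\<lambda>_. \<nu>)) (G \<nu>)\<bar> \<le> e + card I * e"
    by linarith
  then show ?case using insert.hyps by (simp add: split_mu split_nu algebra_simps)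
qed

text \<open>Let q be the quadratic and u = q'/2. Nonnegativity of q forces u^2 <= c q, so powers of
  u times exp (- q) are bounded in terms of \<open>C\<close> alone, however large \<open>b\<close>
  is; hence so are the second and third derivatives of exp (- q). The minimum combines the Taylor
  remainders of orders 2 and 3, the former for large and the latter for small
  \<open>y\<close>.\<close>

lemma nonneg_quadratic_exp_taylor:
  fixes a b c C y :: real
  assumes q: "\<And>y. 0 \<le> a + 2 * b * y + c * y\<^sup>2" and c: "0 \<le> c" "c \<le> C"
  shows "\<bar>exp (- (a + 2 * b * y + c * y\<^sup>2)) - exp (- a)
            - (- 2 * b * exp (- a)) * y - (4 * b\<^sup>2 - 2 * c) * exp (- a) / 2 * y\<^sup>2\<bar>
    \<le> (8 + 18 * C + 28 * C\<^sup>2) * min (y\<^sup>2) (\<bar>y\<bar> ^ 3)"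
proof -
  let ?q = "\<lambda>y. a + 2 * b * y + c * y\<^sup>2"
  let ?u = "\<lambda>y. b + c * y"
  \<comment> \<open>The exponential and its first three derivatives, as a list indexed by the
    order.\<close>
  define D where "D = (\<lambda>m::nat. [\<lambda>y. exp (- ?q y), \<lambda>y. - 2 * ?u y * exp (- ?q y),
     \<lambda>y. (4 * (?u y)\<^sup>2 - 2 * c) * exp (- ?q y),
     \<lambda>y. (- 8 * (?u y) ^ 3 + 12 * c * ?u y) * exp (- ?q y)] ! m)"
  have C: "C \<ge> 0" using c by simp
  have der: "(D m has_real_derivative D (Suc m) t) (at t)" if "m < 3" for m t
  proof -
    from that consider "m = 0" | "m = 1" | "m = 2" by linarith
    then show ?thesis
      by cases (auto simp: D_def power2_eq_square power3_eq_cube algebra_simps numeral_2_eq_2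
          intro!: derivative_eq_intros)
  qed
  \<comment> \<open>The discriminant: c q - u^2 is the constant a c - b^2, which is nonnegative. For
    \<open>c = 0\<close> the function is affine and nonnegative, hence constant.\<close>
  have u2: "(?u y)\<^sup>2 \<le> c * ?q y" for y
  proof (cases "c = 0")
    case True
    have "b = 0"
    proof (rule ccontr)
      assume "b \<noteq> 0"
      with q[of "- (a + 1) / (2 * b)"] True show False by simp
    qed
    with True show ?thesis by simp
  next
    case False
    with c have cp: "c > 0" by simp
    have "0 \<le> ?q (- b / c)" by (rule q)
    also have "?q (- b / c) = a - b\<^sup>2 / c" using False by (simp add: field_simps power2_eq_square)
    finally have "b\<^sup>2 \<le> a * c" using cp by (simp add: field_simps)
    moreover have "c * ?q y - (?u y)\<^sup>2 = a * c - b\<^sup>2" by (simp add: algebra_simps power2_eq_square)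
    ultimately show ?thesis by linarith
  qed
  have qe: "x * exp (- x) \<le> 1" "x\<^sup>2 * exp (- x) \<le> 2" if "x \<ge> 0" for x :: real
  proof -
    have "1 + x \<le> exp x" by (rule exp_ge_add_one_self)
    then have "x \<le> exp x" by linarith
    then show "x * exp (- x) \<le> 1" by (simp add: exp_minus divide_simps)
    have "1 + x + x\<^sup>2 / 2 \<le> exp x" using exp_lower_Taylor_quadratic[OF that] .
    then show "x\<^sup>2 * exp (- x) \<le> 2" using that by (simp add: exp_minus divide_simps)
  qed
  have e1: "exp (- ?q y) \<le> 1" for y using q[of y] by simp
  have u2C: "(?u y)\<^sup>2 * exp (- ?q y) \<le> C" for y
  proof -
    have "(?u y)\<^sup>2 * exp (- ?q y) \<le> (c * ?q y) * exp (- ?q y)"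
      using u2[of y] by (intro mult_right_mono) auto
    also have "\<dots> = c * (?q y * exp (- ?q y))" by simp
    also have "\<dots> \<le> c * 1" using c qe(1)[OF q[of y]] by (intro mult_left_mono) auto
    finally show ?thesis using c by simp
  qed
  have u4C: "(?u y) ^ 4 * exp (- ?q y) \<le> 2 * C\<^sup>2" for y
  proof -
    have "(?u y) ^ 4 = ((?u y)\<^sup>2)\<^sup>2" by simp
    also have "\<dots> \<le> (c * ?q y)\<^sup>2" using u2[of y] by (intro power_mono) auto
    finally have "(?u y) ^ 4 * exp (- ?q y) \<le> (c * ?q y)\<^sup>2 * exp (- ?q y)"
      by (intro mult_right_mono) auto
    also have "\<dots> = c\<^sup>2 * ((?q y)\<^sup>2 * exp (- ?q y))" by (simp add: power_mult_distrib)
    also have "\<dots> \<le> C\<^sup>2 * 2" using c qe(2)[OF q[of y]]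
      by (intro mult_mono power_mono) (auto intro!: mult_nonneg_nonneg)
    finally show ?thesis by simp
  qed
  have D2: "\<bar>D 2 y\<bar> \<le> 6 * C" for y
  proof -
    have "\<bar>D 2 y\<bar> = \<bar>4 * (?u y)\<^sup>2 - 2 * c\<bar> * exp (- ?q y)" by (simp add: D_def abs_mult)
    also have "\<dots> \<le> (4 * (?u y)\<^sup>2 + 2 * c) * exp (- ?q y)"
      using c by (intro mult_right_mono) (auto simp: abs_le_iff)
    also have "\<dots> = 4 * ((?u y)\<^sup>2 * exp (- ?q y)) + 2 * (c * exp (- ?q y))" by (simp add: algebra_simps)
    also have "\<dots> \<le> 4 * C + 2 * (c * 1)"
      using u2C[of y] c e1[of y] by (intro add_mono mult_left_mono) auto
    finally show ?thesis using c by simp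
  qed
  have D3: "\<bar>D 3 y\<bar> \<le> 8 + 28 * C\<^sup>2 + 12 * C" for y
  proof -
    \<comment> \<open>Only even powers of u are controlled by powers of q, so the odd ones are
      dominated by the next even power.\<close>
    have x3: "\<bar>x\<bar> ^ 3 \<le> 1 + x ^ 4" and x1: "\<bar>x\<bar> \<le> 1 + x\<^sup>2" for x :: real
    proof -
      have "0 \<le> (\<bar>x\<bar> - 1)\<^sup>2 * (\<bar>x\<bar>\<^sup>2 + \<bar>x\<bar> + 1)" by (intro mult_nonneg_nonneg) auto
      also have "\<dots> = \<bar>x\<bar> ^ 4 - \<bar>x\<bar> ^ 3 - \<bar>x\<bar> + 1" by (simp add: algebra_simps power2_eq_square eval_nat_numeral)
      finally show "\<bar>x\<bar> ^ 3 \<le> 1 + x ^ 4" by (simp add: power_even_abs)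
      have "0 \<le> (\<bar>x\<bar> - 1)\<^sup>2" by simp
      then show "\<bar>x\<bar> \<le> 1 + x\<^sup>2" by (simp add: power2_eq_square algebra_simps)
    qed
    have "\<bar>D 3 y\<bar> = \<bar>- 8 * (?u y) ^ 3 + 12 * c * ?u y\<bar> * exp (- ?q y)"
      by (simp add: D_def abs_mult)
    also have "\<bar>- 8 * (?u y) ^ 3 + 12 * c * ?u y\<bar> \<le> 8 * \<bar>?u y\<bar> ^ 3 + 12 * c * \<bar>?u y\<bar>"
      using c by (intro order_trans[OF abs_triangle_ineq]) (simp add: abs_mult power_abs)
    also have "\<dots> \<le> 8 * (1 + (?u y) ^ 4) + 12 * c * (1 + (?u y)\<^sup>2)"
      using c x3[of "?u y"] x1[of "?u y"] by (intro add_mono mult_left_mono) auto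
    finally have "\<bar>D 3 y\<bar> \<le> (8 * (1 + (?u y) ^ 4) + 12 * c * (1 + (?u y)\<^sup>2)) * exp (- ?q y)"
      by (simp add: mult_right_mono)
    also have "\<dots> = 8 * exp (- ?q y) + 8 * ((?u y) ^ 4 * exp (- ?q y)) + 12 * c * exp (- ?q y)
        + 12 * c * ((?u y)\<^sup>2 * exp (- ?q y))" by (simp add: algebra_simps)
    also have "12 * c * exp (- ?q y) \<le> 12 * C * 1"
      using c C e1[of y] by (intro mult_mono) auto
    also have "12 * c * ((?u y)\<^sup>2 * exp (- ?q y)) \<le> 12 * C * C"
      using c C u2C[of y] by (intro mult_mono) auto
    also have "8 * exp (- ?q y) + 8 * ((?u y) ^ 4 * exp (- ?q y)) \<le> 8 * 1 + 8 * (2 * C\<^sup>2)"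
      using e1[of y] u4C[of y] by linarith
    finally show ?thesis by (simp add: power2_eq_square)
  qed
  have "D 0 = (\<lambda>y. exp (- ?q y))" by (simp add: D_def)
  note tay = Maclaurin_bi_le[of D, OF this]
  \<comment> \<open>At order 2 the quadratic term is itself counted as an error, so \<open>y\<close>
    need not be small. The final constant dominates both \<open>6 * C\<close> and a sixth of the
    bound for \<open>D 3\<close>.\<close>
  obtain t where t: "exp (- ?q y) = (\<Sum>m<2. D m 0 / fact m * y ^ m) + D 2 t / fact 2 * y ^ 2"
    using tay[of 2 y] der by auto
  obtain t' where t': "exp (- ?q y) = (\<Sum>m<3. D m 0 / fact m * y ^ m) + D 3 t' / fact 3 * y ^ 3"
    using tay[of 3 y] der by auto
  let ?R = "exp (- ?q y) - exp (- a) - (- 2 * b * exp (- a)) * y - (4 * b\<^sup>2 - 2 * c) * exp (- a) / 2 * y\<^sup>2"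
  have "?R = D 2 t / 2 * y\<^sup>2 - D 2 0 / 2 * y\<^sup>2"
    unfolding t by (simp add: D_def numeral_2_eq_2)
  also have "\<bar>\<dots>\<bar> \<le> \<bar>D 2 t\<bar> / 2 * y\<^sup>2 + \<bar>D 2 0\<bar> / 2 * y\<^sup>2"
    by (intro order_trans[OF abs_triangle_ineq4]) (simp add: abs_mult)
  also have "\<dots> \<le> 6 * C / 2 * y\<^sup>2 + 6 * C / 2 * y\<^sup>2"
    using D2 by (intro add_mono mult_right_mono divide_right_mono) auto
  also have "\<dots> \<le> (8 + 18 * C + 28 * C\<^sup>2) * y\<^sup>2"
    using C by (simp add: algebra_simps)
  finally have R2: "\<bar>?R\<bar> \<le> (8 + 18 * C + 28 * C\<^sup>2) * y\<^sup>2" .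
  have "?R = D 3 t' / 6 * y ^ 3"
    unfolding t' by (simp add: D_def numeral_2_eq_2 numeral_3_eq_3 fact_numeral)
  also have "\<bar>\<dots>\<bar> = \<bar>D 3 t'\<bar> / 6 * \<bar>y\<bar> ^ 3" by (simp add: abs_mult power_abs)
  also have "\<dots> \<le> (8 + 28 * C\<^sup>2 + 12 * C) / 6 * \<bar>y\<bar> ^ 3"
    using D3 by (intro mult_right_mono divide_right_mono) auto
  also have "\<dots> \<le> (8 + 18 * C + 28 * C\<^sup>2) * \<bar>y\<bar> ^ 3"
    using C by (intro mult_right_mono) auto
  finally show ?thesis using R2 by (simp add: min_def)
qed

text \<open>Stands in for a third moment: the integrand tends to 0 pointwise and is dominated by the
  square of \<open>Y\<close>. It plays the part of the Lindeberg condition.\<close>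

lemma (in prob_space) truncated_moment_tendsto_0:
  fixes Y :: "'a \<Rightarrow> real"
  assumes [measurable]: "Y \<in> borel_measurable M" and int: "integrable M (\<lambda>\<omega>. (Y \<omega>)\<^sup>2)"
  shows "(\<lambda>n. expectation (\<lambda>\<omega>. min ((Y \<omega>)\<^sup>2) (\<bar>Y \<omega>\<bar> ^ 3 / sqrt (real n)))) \<longlonglongrightarrow> 0"
proof -
  have "(\<lambda>n. expectation (\<lambda>\<omega>. min ((Y \<omega>)\<^sup>2) (\<bar>Y \<omega>\<bar> ^ 3 / sqrt (real n)))) \<longlonglongrightarrow> expectation (\<lambda>\<omega>. 0)"
  proof (rule integral_dominated_convergence[where w="\<lambda>\<omega>. (Y \<omega>)\<^sup>2"])
    show "AE \<omega> in M. (\<lambda>n. min ((Y \<omega>)\<^sup>2) (\<bar>Y \<omega>\<bar> ^ 3 / sqrt (real n))) \<longlonglongrightarrow> 0"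
    proof (intro AE_I2)
      fix \<omega>
      have "filterlim (\<lambda>n. sqrt (real n)) at_top sequentially"
        by (rule filterlim_compose[OF sqrt_at_top filterlim_real_sequentially])
      then have "(\<lambda>n. \<bar>Y \<omega>\<bar> ^ 3 / sqrt (real n)) \<longlonglongrightarrow> 0"
        by (intro tendsto_divide_0[OF tendsto_const] filterlim_at_top_imp_at_infinity)
      from tendsto_min[OF tendsto_const[of "(Y \<omega>)\<^sup>2"] this]
      show "(\<lambda>n. min ((Y \<omega>)\<^sup>2) (\<bar>Y \<omega>\<bar> ^ 3 / sqrt (real n))) \<longlonglongrightarrow> 0" by simp
    qed
  qed (use int in auto)
  then show ?thesis by simp
qed

text \<open>The contribution of one coordinate, up to an error that is independent of the law of \<open>Y\<close>:
  after exponentiation a nonnegative quadratic polynomial has bounded derivatives of all orders, so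
  no moment of the linear coefficient \<open>b\<close> enters the error bound.\<close>
lemma (in prob_space) expectation_exp_quadratic:
  fixes Y :: "'a \<Rightarrow> real" and n :: nat
  assumes [measurable]: "Y \<in> borel_measurable M" and int: "integrable M (\<lambda>\<omega>. (Y \<omega>)\<^sup>2)"
    and mean: "expectation Y = 0" and var: "expectation (\<lambda>\<omega>. (Y \<omega>)\<^sup>2) = 1" and n: "n > 0"
    and q: "\<And>y. 0 \<le> a + 2 * b * y + c * y\<^sup>2" and c: "0 \<le> c" "c \<le> C"
  shows "\<bar>expectation (\<lambda>\<omega>. exp (- (a + 2 * b * (Y \<omega> / sqrt n) + c * (Y \<omega> / sqrt n)\<^sup>2)))
            - (exp (- a) + (4 * b\<^sup>2 - 2 * c) * exp (- a) / (2 * n))\<bar>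
    \<le> (8 + 18 * C + 28 * C\<^sup>2) / n * expectation (\<lambda>\<omega>. min ((Y \<omega>)\<^sup>2) (\<bar>Y \<omega>\<bar> ^ 3 / sqrt (real n)))"
proof -
  let ?K = "8 + 18 * C + 28 * C\<^sup>2"
  let ?h = "\<lambda>\<omega>. exp (- (a + 2 * b * (Y \<omega> / sqrt n) + c * (Y \<omega> / sqrt n)\<^sup>2))"
  let ?m = "\<lambda>\<omega>. min ((Y \<omega>)\<^sup>2) (\<bar>Y \<omega>\<bar> ^ 3 / sqrt (real n))"
  \<comment> \<open>The quadratic Taylor polynomial at Y / sqrt n; its expectation depends on the
    law of \<open>Y\<close> only through the first two moments.\<close>
  let ?p = "\<lambda>\<omega>. exp (- a) - 2 * b * exp (- a) / sqrt n * Y \<omega> + (4 * b\<^sup>2 - 2 * c) * exp (- a) / (2 * n) * (Y \<omega>)\<^sup>2"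
  have iY: "integrable M Y" by (rule square_integrable_imp_integrable) (use int in auto)
  have qY: "0 \<le> a + 2 * b * (Y \<omega> / sqrt n) + c * (Y \<omega> / sqrt n)\<^sup>2" for \<omega> by (rule q)
  have ih: "integrable M ?h"
  proof (rule integrable_const_bound[where B=1])
    show "AE \<omega> in M. norm (?h \<omega>) \<le> 1"
      using qY by (intro AE_I2) (simp only: real_norm_def abs_exp_cancel exp_le_one_iff neg_le_0_iff_le)
  qed simp
  have im: "integrable M ?m"
    by (rule Bochner_Integration.integrable_bound[OF int]) auto
  have ip: "integrable M ?p" using iY int by auto
  have "expectation ?p = exp (- a) + (4 * b\<^sup>2 - 2 * c) * exp (- a) / (2 * n)"
    using iY int mean var by (simp add: prob_space)
  then have "\<bar>expectation ?h - (exp (- a) + (4 * b\<^sup>2 - 2 * c) * exp (- a) / (2 * n))\<bar>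
      = \<bar>expectation (\<lambda>\<omega>. ?h \<omega> - ?p \<omega>)\<bar>" using ih ip by simp
  also have "\<dots> \<le> expectation (\<lambda>\<omega>. \<bar>?h \<omega> - ?p \<omega>\<bar>)" by (rule integral_abs_bound)
  also have "\<dots> \<le> expectation (\<lambda>\<omega>. ?K / n * ?m \<omega>)"
  proof (rule integral_mono)
    fix \<omega>
    have sq: "sqrt (real n) ^ 2 = n" "sqrt (real n) ^ 3 = n * sqrt n"
      using n by (simp_all add: power3_eq_cube power2_eq_square)
    have p: "E - ?p \<omega> = E - exp (- a) - (- 2 * b * exp (- a)) * (Y \<omega> / sqrt n)
        - (4 * b\<^sup>2 - 2 * c) * exp (- a) / 2 * (Y \<omega> / sqrt n)\<^sup>2" for E
      by (simp add: power_divide)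
    have "\<bar>?h \<omega> - ?p \<omega>\<bar> \<le> ?K * min ((Y \<omega> / sqrt n)\<^sup>2) (\<bar>Y \<omega> / sqrt n\<bar> ^ 3)"
      unfolding p by (rule nonneg_quadratic_exp_taylor[OF q c])
    \<comment> \<open>Both arguments of the minimum release a factor \<open>1 / n\<close>, the
      source of this factor in the error.\<close>
    also have "min ((Y \<omega> / sqrt n)\<^sup>2) (\<bar>Y \<omega> / sqrt n\<bar> ^ 3) = ?m \<omega> / n"
      using n sq by (simp add: power_divide min_divide_distrib_right mult.commute)
    finally show "\<bar>?h \<omega> - ?p \<omega>\<bar> \<le> ?K / n * ?m \<omega>" by simp
  qed (use ih ip im in auto)
  finally show ?thesis by simp
qed

text \<open>For bounded \<open>c\<close> and independent centered \<open>x k\<close> of order 1 /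
  sqrt n the inner sums are of order 1; the mean over \<open>t\<close> then imitates an integral
  over the unit interval.\<close>

definition mean_square_form :: "(nat \<Rightarrow> nat \<Rightarrow> real) \<Rightarrow> nat \<Rightarrow> (nat \<Rightarrow> real) \<Rightarrow> real" where
  "mean_square_form c n x = (\<Sum>t=1..n. (\<Sum>k=1..n. c t k * x k)\<^sup>2) / n"

lemma mean_square_form_nonneg: "mean_square_form c n x \<ge> 0"
  by (auto simp: mean_square_form_def intro!: divide_nonneg_nonneg sum_nonneg)

text \<open>Only the leading coefficient is made explicit: it is free of \<open>x\<close>, whereas
  \<open>a\<close> and \<open>b\<close> involve the other coordinates and are never bounded.\<close>

lemma mean_square_form_upd:
  assumes i: "i \<in> {1..n}"
  obtains a b d where "\<And>y. s * mean_square_form c n (x(i := y)) = a + 2 * b * y + d * y\<^sup>2"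
    "d = s * ((\<Sum>t=1..n. (c t i)\<^sup>2) / n)"
proof -
  define A where "A t = (\<Sum>k\<in>{1..n}-{i}. c t k * x k)" for t
  have split: "(\<Sum>k=1..n. c t k * (x(i := y)) k) = A t + c t i * y" for t y
    using i by (subst sum.remove[of _ i]) (auto simp: A_def)
  have "s * mean_square_form c n (x(i := y)) = s * ((\<Sum>t=1..n. (A t)\<^sup>2) / n)
     + 2 * (s * ((\<Sum>t=1..n. A t * c t i) / n)) * y + s * ((\<Sum>t=1..n. (c t i)\<^sup>2) / n) * y\<^sup>2" for y
  proof -
    have sq: "(A t + c t i * y)\<^sup>2 = (A t)\<^sup>2 + A t * c t i * (2 * y) + (c t i)\<^sup>2 * y\<^sup>2" for t
      by (simp add: power2_eq_square algebra_simps)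
    show ?thesis
      unfolding mean_square_form_def split sq sum.distrib sum_distrib_right[symmetric]
      by (simp add: add_divide_distrib distrib_left mult_ac)
  qed
  then show ?thesis using that by blast
qed

text \<open>Each of the \<open>n\<close> exchanges costs \<open>1 / n\<close> times a truncated
  moment. The two families may live on different spaces: by independence only products of
  one-dimensional laws matter.\<close>

lemma mean_square_form_swap:
  fixes c :: "nat \<Rightarrow> nat \<Rightarrow> real"
  assumes M: "prob_space M" and N: "prob_space N" and n: "n > 0" and s: "s \<ge> 0"
    and c: "\<And>t k. t \<in> {1..n} \<Longrightarrow> k \<in> {1..n} \<Longrightarrow> \<bar>c t k\<bar> \<le> C"
    and X: "prob_space.indep_vars M (\<lambda>_. borel) X {1..n}"
      "\<And>k. k \<in> {1..n} \<Longrightarrow> distr M borel (X k) = distr M borel (\<lambda>\<omega>. Y \<omega> / sqrt n)"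
    and Y: "Y \<in> borel_measurable M" "integrable M (\<lambda>\<omega>. (Y \<omega>)\<^sup>2)"
      "integral\<^sup>L M Y = 0" "integral\<^sup>L M (\<lambda>\<omega>. (Y \<omega>)\<^sup>2) = 1"
    and X': "prob_space.indep_vars N (\<lambda>_. borel) X' {1..n}"
      "\<And>k. k \<in> {1..n} \<Longrightarrow> distr N borel (X' k) = distr N borel (\<lambda>\<omega>. Y' \<omega> / sqrt n)"
    and Y': "Y' \<in> borel_measurable N" "integrable N (\<lambda>\<omega>. (Y' \<omega>)\<^sup>2)"
      "integral\<^sup>L N Y' = 0" "integral\<^sup>L N (\<lambda>\<omega>. (Y' \<omega>)\<^sup>2) = 1"
  shows "\<bar>(\<integral>\<omega>. exp (- s * mean_square_form c n (\<lambda>k. X k \<omega>)) \<partial>M)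
            - (\<integral>\<omega>. exp (- s * mean_square_form c n (\<lambda>k. X' k \<omega>)) \<partial>N)\<bar>
    \<le> (8 + 18 * (s * C\<^sup>2) + 28 * (s * C\<^sup>2)\<^sup>2) *
       ((\<integral>\<omega>. min ((Y \<omega>)\<^sup>2) (\<bar>Y \<omega>\<bar> ^ 3 / sqrt n) \<partial>M)
        + (\<integral>\<omega>. min ((Y' \<omega>)\<^sup>2) (\<bar>Y' \<omega>\<bar> ^ 3 / sqrt n) \<partial>N))"
proof -
  interpret M: prob_space M by fact
  interpret N: prob_space N by fact
  note [measurable] = Y(1) Y'(1)
  define \<mu> where "\<mu> = distr M borel (\<lambda>\<omega>. Y \<omega> / sqrt n)"
  define \<nu> where "\<nu> = distr N borel (\<lambda>\<omega>. Y' \<omega> / sqrt n)"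
  let ?f = "\<lambda>x. exp (- s * mean_square_form c n x)"
  let ?K = "8 + 18 * (s * C\<^sup>2) + 28 * (s * C\<^sup>2)\<^sup>2"
  let ?e = "\<integral>\<omega>. min ((Y \<omega>)\<^sup>2) (\<bar>Y \<omega>\<bar> ^ 3 / sqrt n) \<partial>M"
  let ?e' = "\<integral>\<omega>. min ((Y' \<omega>)\<^sup>2) (\<bar>Y' \<omega>\<bar> ^ 3 / sqrt n) \<partial>N"
  have f[measurable]: "?f \<in> borel_measurable (PiM {1..n} (\<lambda>_. borel))"
    unfolding mean_square_form_def by measurable
  \<comment> \<open>Points of the product space are functions restricted to the index set; the form
    reads no other index.\<close>
  have restr: "?f (restrict x {1..n}) = ?f x" for x
    by (simp add: mean_square_form_def)
  have law: "(\<integral>\<omega>. ?f (\<lambda>k. Z k \<omega>) \<partial>P) = integral\<^sup>L (PiM {1..n} (\<lambda>_. \<xi>)) ?f"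
    if P: "prob_space P" and Z: "prob_space.indep_vars P (\<lambda>_. borel) Z {1..n}"
      and d: "\<And>k. k \<in> {1..n} \<Longrightarrow> distr P borel (Z k) = \<xi>" for P :: "'z measure" and Z \<xi>
  proof -
    interpret P: prob_space P by fact
    have [measurable]: "Z k \<in> borel_measurable P" if "k \<in> {1..n}" for k
      using Z that unfolding P.indep_vars_def2 by simp
    have "PiM {1..n} (\<lambda>_. \<xi>) = PiM {1..n} (\<lambda>k. distr P borel (Z k))"
      by (rule PiM_cong) (simp_all add: d)
    also have "\<dots> = distr P (PiM {1..n} (\<lambda>_. borel)) (\<lambda>\<omega>. \<lambda>k\<in>{1..n}. Z k \<omega>)"
      using P.indep_vars_iff_distr_eq_PiM'[where I="{1..n}" and M'="\<lambda>_. borel" and X=Z] Z n by simp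
    finally have PiM_eq: "PiM {1..n} (\<lambda>_. \<xi>) = distr P (PiM {1..n} (\<lambda>_. borel)) (\<lambda>\<omega>. \<lambda>k\<in>{1..n}. Z k \<omega>)" .
    have "(\<lambda>\<omega>. \<lambda>k\<in>{1..n}. Z k \<omega>) \<in> P \<rightarrow>\<^sub>M PiM {1..n} (\<lambda>_. borel)"
      by (intro measurable_restrict) simp
    then show ?thesis by (simp only: PiM_eq integral_distr[OF _ f] restr)
  qed
  have rd: "real_distribution \<mu>" "real_distribution \<nu>"
    unfolding \<mu>_def \<nu>_def by (auto intro!: M.real_distribution_distr N.real_distribution_distr)
  have "\<bar>integral\<^sup>L (PiM {1..n} (\<lambda>_. \<mu>)) ?f - integral\<^sup>L (PiM {1..n} (\<lambda>_. \<nu>)) ?f\<bar>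
      \<le> card {1..n} * (?K / n * ?e + ?K / n * ?e')"
  proof (rule PiM_integral_swap[OF _ rd f, where B=1])
    fix i x assume i: "i \<in> {1..n}"
    obtain a b d where abd: "\<And>y. s * mean_square_form c n (x(i := y)) = a + 2 * b * y + d * y\<^sup>2"
      and d: "d = s * ((\<Sum>t=1..n. (c t i)\<^sup>2) / n)"
      using mean_square_form_upd[OF i] by blast
    have q: "0 \<le> a + 2 * b * y + d * y\<^sup>2" for y
      unfolding abd[symmetric] using s mean_square_form_nonneg by simp
    \<comment> \<open>Averaging over \<open>t\<close> bounds the leading coefficient uniformly in
      \<open>n\<close>, \<open>i\<close> and \<open>x\<close>.\<close>
    have "(\<Sum>t=1..n. (c t i)\<^sup>2) \<le> (\<Sum>t=1..n. C\<^sup>2)"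
      using c i by (intro sum_mono) (metis abs_ge_zero power2_abs power_mono)
    then have "(\<Sum>t=1..n. (c t i)\<^sup>2) / n \<le> C\<^sup>2" using n by (simp add: divide_simps mult.commute)
    then have dC: "0 \<le> d" "d \<le> s * C\<^sup>2"
      using s unfolding d
      by (intro mult_nonneg_nonneg divide_nonneg_nonneg sum_nonneg mult_left_mono; simp)+
    have feq: "?f (x(i := y)) = exp (- (a + 2 * b * y + d * y\<^sup>2))" for y
      by (simp add: abd)
    have "(\<integral>y. ?f (x(i := y)) \<partial>\<mu>) = (\<integral>\<omega>. exp (- (a + 2 * b * (Y \<omega> / sqrt n) + d * (Y \<omega> / sqrt n)\<^sup>2)) \<partial>M)"
      unfolding feq \<mu>_def by (subst integral_distr) auto
    moreover have "(\<integral>y. ?f (x(i := y)) \<partial>\<nu>) = (\<integral>\<omega>. exp (- (a + 2 * b * (Y' \<omega> / sqrt n) + d * (Y' \<omega> / sqrt n)\<^sup>2)) \<partial>N)"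
      unfolding feq \<nu>_def by (subst integral_distr) auto
    \<comment> \<open>Both expectations are close to the same function of \<open>a\<close>,
      \<open>b\<close>, \<open>d\<close> and \<open>n\<close>, which cancels.\<close>
    ultimately show "\<bar>(\<integral>y. ?f (x(i := y)) \<partial>\<mu>) - (\<integral>y. ?f (x(i := y)) \<partial>\<nu>)\<bar> \<le> ?K / n * ?e + ?K / n * ?e'"
      using M.expectation_exp_quadratic[OF Y n q dC] N.expectation_exp_quadratic[OF Y' n q dC] by linarith
  qed (use s mean_square_form_nonneg in auto)
  also have "\<dots> = ?K * (?e + ?e')" using n by (simp add: distrib_left)
  finally show ?thesis
    using law[OF M X(1), of \<mu>] law[OF N X'(1), of \<nu>] X(2) X'(2) by (simp add: \<mu>_def \<nu>_def)
qed

section \<open>The quadratic form of the increments of a path\<close>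

lemma integral_grid_split:
  fixes h :: "real \<Rightarrow> real"
  assumes "h integrable_on {0..1}" and n: "n > 0"
  shows "integral {0..1} h = (\<Sum>k<n. integral {k / n..Suc k / n} h)"
proof -
  have "integral {0..real m / n} h = (\<Sum>k<m. integral {k / n..Suc k / n} h)" if "m \<le> n" for m
    using that
  proof (induction m)
    case (Suc m)
    have le: "real m / n \<le> real (Suc m) / n" "real (Suc m) / n \<le> 1"
      using Suc.prems n by (auto simp: divide_simps)
    have "h integrable_on {0..real (Suc m) / n}"
      by (rule integrable_on_subinterval[OF assms(1)]) (use le in auto)
    then have "integral {0..real m / n} h + integral {real m / n..real (Suc m) / n} h
        = integral {0..real (Suc m) / n} h"
      using le by (intro Henstock_Kurzweil_Integration.integral_combine) auto
    then show ?case using Suc by simp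
  qed simp
  from this[of n] n show ?thesis by simp
qed

text \<open>On each cell the increment of \<phi> is the integral of its derivative, so the error is
  the integral of that derivative times an oscillation of \<open>f\<close>. Free tags \<xi> permit
  right end points for plain Riemann sums and left ones after summation by parts.\<close>

lemma riemann_stieltjes_tendsto:
  fixes f \<phi> \<phi>' :: "real \<Rightarrow> real"
  assumes f: "continuous_on {0..1} f"
    and \<phi>: "\<And>u. u \<in> {0..1} \<Longrightarrow> (\<phi> has_real_derivative \<phi>' u) (at u within {0..1})"
    and \<phi>': "continuous_on {0..1} \<phi>'"
    and tag: "\<And>n k. k < n \<Longrightarrow> \<xi> n k \<in> {k / n..Suc k / n}"
  shows "(\<lambda>n. \<Sum>k<n. (\<phi> (Suc k / n) - \<phi> (k / n)) * f (\<xi> n k)) \<longlonglongrightarrow> integral {0..1} (\<lambda>u. \<phi>' u * f u)"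
proof (rule tendstoI)
  fix e :: real assume e: "e > 0"
  obtain B where B: "B > 0" "\<And>u. u \<in> {0..1} \<Longrightarrow> \<bar>\<phi>' u\<bar> \<le> B"
    using compact_imp_bounded[OF compact_continuous_image[OF \<phi>' compact_Icc]]
    by (auto simp: bounded_pos)
  \<comment> \<open>The oscillation of \<open>f\<close> times the bound \<open>B\<close> of the
    derivative stays below \<open>e / 2\<close>, and the cell lengths add up to 1.\<close>
  have "e / (2 * B) > 0" using e B by simp
  then have "\<exists>d>0. \<forall>v\<in>{0..1}. \<forall>u\<in>{0..1}. dist u v < d \<longrightarrow> dist (f u) (f v) < e / (2 * B)"
    using compact_uniformly_continuous[OF f compact_Icc]
    unfolding uniformly_continuous_on_def by (elim allE impE)
  then obtain d where d: "d > 0"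
    "\<And>u v. u \<in> {0..1} \<Longrightarrow> v \<in> {0..1} \<Longrightarrow> dist u v < d \<Longrightarrow> dist (f u) (f v) < e / (2 * B)"
    by blast
  obtain n0 where n0: "1 / d < real n0" using reals_Archimedean2 by blast
  have "dist (\<Sum>k<n. (\<phi> (Suc k / n) - \<phi> (k / n)) * f (\<xi> n k)) (integral {0..1} (\<lambda>u. \<phi>' u * f u)) < e"
    if n: "n \<ge> n0 + 1" for n
  proof -
    have npos: "n > 0" using n by simp
    have "1 / d < real n" using n n0 by simp
    then have nd: "1 / real n < d" using d npos by (simp add: field_simps)
    have cont: "continuous_on {0..1} (\<lambda>u. \<phi>' u * f u)" using \<phi>' f by (intro continuous_intros)
    have piece: "\<bar>(\<phi> (Suc k / n) - \<phi> (k / n)) * f (\<xi> n k) - integral {k / n..Suc k / n} (\<lambda>u. \<phi>' u * f u)\<bar>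
        \<le> e / 2 / n" if k: "k < n" for k
    proof -
      let ?I = "{real k / n..real (Suc k) / n}"
      have sub: "?I \<subseteq> {0..1}" using k npos by (auto simp: field_simps)
      have len: "real (Suc k) / n - real k / n = 1 / n" by (simp add: diff_divide_distrib[symmetric])
      have le: "real k / n \<le> real (Suc k) / n" by (simp add: divide_right_mono)
      have "(\<phi>' has_integral (\<phi> (Suc k / n) - \<phi> (k / n))) ?I"
      proof (rule fundamental_theorem_of_calculus[OF le])
        fix u assume "u \<in> ?I"
        then have "u \<in> {0..1}" using sub by blast
        from has_field_derivative_subset[OF \<phi>[OF this] sub]
        show "(\<phi> has_vector_derivative \<phi>' u) (at u within ?I)"
          by (simp only: has_real_derivative_iff_has_vector_derivative)
      qed
      from has_integral_mult_left[OF this, of "f (\<xi> n k)"]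
      have "((\<lambda>u. \<phi>' u * f (\<xi> n k)) has_integral (\<phi> (Suc k / n) - \<phi> (k / n)) * f (\<xi> n k)) ?I" .
      moreover have "(\<lambda>u. \<phi>' u * f u) integrable_on ?I"
        by (rule integrable_continuous_interval[OF continuous_on_subset[OF cont sub]])
      ultimately have hi: "((\<lambda>u. \<phi>' u * f (\<xi> n k) - \<phi>' u * f u) has_integral
          (\<phi> (Suc k / n) - \<phi> (k / n)) * f (\<xi> n k) - integral ?I (\<lambda>u. \<phi>' u * f u)) ?I"
        by (intro has_integral_diff) (auto simp: integrable_integral)
      have "norm ((\<phi> (Suc k / n) - \<phi> (k / n)) * f (\<xi> n k) - integral ?I (\<lambda>u. \<phi>' u * f u))
          \<le> e / 2 * Henstock_Kurzweil_Integration.content ?I"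
      proof (rule has_integral_bound_real[OF _ finite.emptyI hi])
        fix u assume "u \<in> ?I - {}"
        then have u: "u \<in> ?I" by simp
        have "\<bar>\<xi> n k - u\<bar> \<le> 1 / n" using tag[OF k] u len by auto
        then have "dist (f (\<xi> n k)) (f u) < e / (2 * B)"
          using tag[OF k] u sub nd by (intro d(2) subsetD[OF sub]) (auto simp: dist_real_def)
        then have "\<bar>\<phi>' u\<bar> * \<bar>f (\<xi> n k) - f u\<bar> \<le> B * (e / (2 * B))"
          using B(1) B(2)[OF subsetD[OF sub u]] by (intro mult_mono) (auto simp: dist_real_def)
        then show "norm (\<phi>' u * f (\<xi> n k) - \<phi>' u * f u) \<le> e / 2"
          using B by (simp add: right_diff_distrib[symmetric] abs_mult)
      qed (use e in auto)
      then show ?thesis using le len by (simp add: content_real)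
    qed
    have "\<bar>(\<Sum>k<n. (\<phi> (Suc k / n) - \<phi> (k / n)) * f (\<xi> n k)) - integral {0..1} (\<lambda>u. \<phi>' u * f u)\<bar>
      = \<bar>\<Sum>k<n. (\<phi> (Suc k / n) - \<phi> (k / n)) * f (\<xi> n k) - integral {k / n..Suc k / n} (\<lambda>u. \<phi>' u * f u)\<bar>"
      using integral_grid_split[OF integrable_continuous_interval[OF cont] npos]
      by (simp add: sum_subtractf)
    also have "\<dots> \<le> (\<Sum>k<n. e / 2 / n)"
      using piece by (intro order_trans[OF sum_abs] sum_mono) auto
    also have "\<dots> < e" using npos e by simp
    finally show ?thesis by (simp add: dist_real_def)
  qed
  then show "\<forall>\<^sub>F n in sequentially. dist (\<Sum>k<n. (\<phi> (Suc k / n) - \<phi> (k / n)) * f (\<xi> n k))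
      (integral {0..1} (\<lambda>u. \<phi>' u * f u)) < e"
    unfolding eventually_sequentially by blast
qed

lemma riemann_sum_tendsto:
  fixes f :: "real \<Rightarrow> real"
  assumes "continuous_on {0..1} f"
  shows "(\<lambda>n::nat. (\<Sum>k=1..n. f (real k / n)) / n) \<longlonglongrightarrow> integral {0..1} f"
proof -
  have "(\<lambda>n. \<Sum>k<n. (Suc k / n - k / n) * f (Suc k / n)) \<longlonglongrightarrow> integral {0..1} (\<lambda>u. 1 * f u)"
    by (rule riemann_stieltjes_tendsto[OF assms]) (auto intro!: derivative_eq_intros simp: divide_right_mono)
  moreover have "(\<Sum>k<n. (Suc k / n - k / n) * f (Suc k / n)) = (\<Sum>k=1..n. f (real k / n)) / n" for n :: nat
    unfolding One_nat_def sum.atLeast1_atMost_eq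
    by (simp add: sum_divide_distrib diff_divide_distrib[symmetric])
  ultimately show ?thesis by simp
qed

text \<open>Summation by parts moves the differences from \<open>f\<close> to the smooth weight.
  This is essential: a Wiener path cannot be the differentiable integrator of
  \<open>riemann_stieltjes_tendsto\<close>, but it can be the continuous integrand.\<close>

lemma weighted_increments_tendsto:
  fixes f :: "real \<Rightarrow> real"
  assumes f: "continuous_on {0..1} f" and f0: "f 0 = 0"
  shows "(\<lambda>n::nat. \<Sum>k=1..n. (real k / n) ^ j * (f (real k / n) - f ((real k - 1) / n)))
    \<longlonglongrightarrow> f 1 - integral {0..1} (\<lambda>u. f u * (real j * u ^ (j - 1)))"
proof -
  have "(\<lambda>n. \<Sum>k<n. ((Suc k / n) ^ j - (k / n) ^ j) * f (k / n))
      \<longlonglongrightarrow> integral {0..1} (\<lambda>u. (real j * u ^ (j - 1)) * f u)"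
    by (rule riemann_stieltjes_tendsto[OF f])
      (auto intro!: derivative_eq_intros continuous_intros simp: divide_right_mono)
  then have "(\<lambda>n. f 1 - (\<Sum>k<n. ((Suc k / n) ^ j - (k / n) ^ j) * f (k / n)))
      \<longlonglongrightarrow> f 1 - integral {0..1} (\<lambda>u. f u * (real j * u ^ (j - 1)))"
    by (intro tendsto_diff tendsto_const) (simp add: mult.commute)
  moreover have "f 1 - (\<Sum>k<n. ((Suc k / n) ^ j - (k / n) ^ j) * f (k / n))
      = (\<Sum>k=1..n. (real k / n) ^ j * (f (real k / n) - f ((real k - 1) / n)))" if "n > 0" for n :: nat
  proof -
    \<comment> \<open>Abel's identity; \<open>f0\<close> removes the boundary term at 0, and the
      differences of the weights meet \<open>f\<close> at left end points.\<close>
    have "(\<Sum>k<m. (Suc k / n) ^ j * (f (Suc k / n) - f (k / n)))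
        = (m / n) ^ j * f (m / n) - (\<Sum>k<m. ((Suc k / n) ^ j - (k / n) ^ j) * f (k / n))" for m
      by (induction m) (simp_all add: f0 algebra_simps)
    from this[of n] that show ?thesis unfolding One_nat_def sum.atLeast1_atMost_eq by simp
  qed
  ultimately show ?thesis
    by (rule Lim_transform_eventually[OF _ eventually_sequentiallyI[of 1]]) simp
qed

text \<open>Uniform in \<open>t\<close>, as the partial sums of the residuals require. The integrand
  is nondecreasing, so right sums exceed the integral by at most the last term over
  \<open>n\<close>: the cell errors telescope.\<close>

lemma power_sum_bounds:
  fixes n t :: nat
  assumes n: "n > 0" and t: "t \<le> n"
  shows "\<bar>(\<Sum>s=1..t. (real s / n) ^ i) / n - (real t / n) ^ Suc i / Suc i\<bar> \<le> 1 / n"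
proof -
  have der: "((\<lambda>u. u ^ Suc i / Suc i) has_real_derivative u ^ i) (at u)" for u :: real
    by (rule derivative_eq_intros refl | simp)+
  have "0 \<le> (\<Sum>s=1..t. (real s / n) ^ i) / n - (real t / n) ^ Suc i / Suc i \<and>
     (\<Sum>s=1..t. (real s / n) ^ i) / n - (real t / n) ^ Suc i / Suc i \<le> (real t / n) ^ i / n" if "t > 0" for t
    using that
  proof (induction t rule: nat_induct_non_zero)
    case 1
    have "(1 / real n) ^ i * (1 / n) / (1 + real i) \<le> (1 / real n) ^ i * (1 / n) / 1"
      by (intro divide_left_mono) auto
    then show ?case by (simp add: mult.commute)
  next
    case (Suc t)
    let ?x = "real t / n" and ?y = "real (Suc t) / n"
    have xy: "0 \<le> ?x" "?x < ?y" "?y - ?x = 1 / n" using n by (auto simp: field_simps)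
    obtain z where z: "?x < z" "z < ?y" "?y ^ Suc i / Suc i - ?x ^ Suc i / Suc i = (?y - ?x) * z ^ i"
      using MVT2[OF xy(2) der] by blast
    have "?x ^ i \<le> z ^ i" "z ^ i \<le> ?y ^ i" using z(1,2) xy(1) by (intro power_mono; linarith)+
    then have "?x ^ i / n \<le> z ^ i / n" "z ^ i / n \<le> ?y ^ i / n" by (auto intro: divide_right_mono)
    moreover have "(\<Sum>s=1..Suc t. (real s / n) ^ i) / n = (\<Sum>s=1..t. (real s / n) ^ i) / n + ?y ^ i / n"
      by (simp add: add_divide_distrib)
    moreover have "?y ^ Suc i / Suc i - ?x ^ Suc i / Suc i = z ^ i / n"
      using z(3) unfolding xy(3) by (simp only: mult_1_left times_divide_eq_left)
    moreover note Suc.IH[THEN conjunct1] Suc.IH[THEN conjunct2]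
    ultimately show ?case by (intro conjI; linarith)
  qed
  note bounds = this
  have le: "(real t / n) ^ i / n \<le> 1 / n"
    using n t by (intro divide_right_mono power_le_one) auto
  show ?thesis
  proof (cases "t = 0")
    case False
    then show ?thesis using bounds[of t] le by linarith
  qed simp
qed

text \<open>The discrete counterpart of the integral of u^i from 0 to t/n; hence the division by
  \<open>n\<close> and not by \<open>t\<close>.\<close>

definition power_mean :: "nat \<Rightarrow> nat \<Rightarrow> nat \<Rightarrow> real" where
  "power_mean n t i = (\<Sum>s=1..t. (real s / n) ^ i) / n"

text \<open>The weight of the \<open>k\<close>-th observation in the \<open>t\<close>-th partial sum of the residuals, where \<open>B\<close> is the
  inverse of the normalized Gram matrix of the regressors. For \<open>B = 0\<close> nothing is fitted.\<close>
definition detrend_coeff :: "nat \<Rightarrow> (nat \<Rightarrow> nat \<Rightarrow> real) \<Rightarrow> nat \<Rightarrow> nat \<Rightarrow> nat \<Rightarrow> real" where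
  "detrend_coeff r B n t k = indicator {k..} t - (\<Sum>i\<le>r. \<Sum>j\<le>r. power_mean n t i * B i j * (real k / n) ^ j)"

lemma power_mean_bounds:
  assumes "t \<le> n"
  shows "0 \<le> power_mean n t i" "power_mean n t i \<le> 1"
proof -
  show "0 \<le> power_mean n t i" by (auto simp: power_mean_def intro!: divide_nonneg_nonneg sum_nonneg)
  show "power_mean n t i \<le> 1"
  proof (cases "n = 0")
    case False
    have "(\<Sum>s=1..t. (real s / n) ^ i) \<le> (\<Sum>s=1..t. 1)"
      using assms False by (intro sum_mono power_le_one) auto
    also have "\<dots> \<le> real n" using assms by simp
    finally show ?thesis using False by (simp add: power_mean_def)
  qed (simp add: power_mean_def)
qed

lemma detrend_coeff_bound:
  assumes t: "t \<in> {1..n}" and k: "k \<in> {1..n}" and B: "\<And>i j. i \<le> r \<Longrightarrow> j \<le> r \<Longrightarrow> \<bar>B i j\<bar> \<le> b"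
  shows "\<bar>detrend_coeff r B n t k\<bar> \<le> 1 + (real r + 1)\<^sup>2 * b"
proof -
  have "\<bar>\<Sum>i\<le>r. \<Sum>j\<le>r. power_mean n t i * B i j * (real k / n) ^ j\<bar> \<le> (\<Sum>i\<le>r. \<Sum>j\<le>r. b)"
  proof (intro order_trans[OF sum_abs] sum_mono)
    fix i j assume ij: "i \<in> {..r}" "j \<in> {..r}"
    have "\<bar>power_mean n t i * B i j * (real k / n) ^ j\<bar> \<le> 1 * b * 1"
      unfolding abs_mult using power_mean_bounds[of t n i] t k B[of i j] ij
      by (intro mult_mono) (auto simp: power_abs intro!: power_le_one)
    then show "\<bar>power_mean n t i * B i j * (real k / n) ^ j\<bar> \<le> b" by simp
  qed
  moreover have "(\<Sum>i\<le>r. \<Sum>j\<le>r. b) = (real r + 1)\<^sup>2 * b" by (simp add: power2_eq_square algebra_simps)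
  moreover have "\<bar>indicator {k..} t :: real\<bar> \<le> 1" by (simp add: indicator_def)
  ultimately show ?thesis unfolding detrend_coeff_def by linarith
qed

lemma sum_detrend_coeff:
  assumes t: "t \<le> n"
  shows "(\<Sum>k=1..n. detrend_coeff r B n t k * x k)
    = (\<Sum>k=1..t. x k) - (\<Sum>i\<le>r. \<Sum>j\<le>r. power_mean n t i * B i j * (\<Sum>k=1..n. (real k / n) ^ j * x k))"
proof -
  have "(\<Sum>k=1..n. indicator {k..} t * x k) = (\<Sum>k=1..n. if k \<in> {..t} then x k else 0)"
    by (intro sum.cong) auto
  also have "\<dots> = (\<Sum>k\<in>{1..n} \<inter> {..t}. x k)" by (rule sum.inter_restrict[symmetric]) simp
  also have "{1..n} \<inter> {..t} = {1..t}" using t by auto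
  finally have 1: "(\<Sum>k=1..n. indicator {k..} t * x k) = (\<Sum>k=1..t. x k)" .
  have 2: "(\<Sum>k=1..n. (\<Sum>i\<le>r. \<Sum>j\<le>r. power_mean n t i * B i j * (real k / n) ^ j) * x k)
      = (\<Sum>i\<le>r. \<Sum>j\<le>r. power_mean n t i * B i j * (\<Sum>k=1..n. (real k / n) ^ j * x k))"
    unfolding sum_distrib_right sum_distrib_left
    by (subst sum.swap, rule sum.cong[OF refl], subst sum.swap) (simp add: mult.assoc)
  show ?thesis
    unfolding detrend_coeff_def left_diff_distrib sum_subtractf 1 2 ..
qed

text \<open>Stated for one fixed path, to be applied to each path of the Wiener process. The
  indicator part telescopes to \<open>f\<close>, the fitted coefficients converge by
  \<open>weighted_increments_tendsto\<close>, and the approximation is uniform in \<open>t\<close>;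
  a Riemann sum of the squared limit remains.\<close>

lemma mean_square_form_increments_tendsto:
  fixes f :: "real \<Rightarrow> real" and B :: "nat \<Rightarrow> nat \<Rightarrow> nat \<Rightarrow> real"
  assumes f: "continuous_on {0..1} f" and f0: "f 0 = 0"
    and B: "\<And>i j. i \<le> r \<Longrightarrow> j \<le> r \<Longrightarrow> (\<lambda>n. B n i j) \<longlonglongrightarrow> b i j"
  shows "(\<lambda>n::nat. mean_square_form (detrend_coeff r (B n) n) n (\<lambda>k. f (real k / n) - f ((real k - 1) / n)))
    \<longlonglongrightarrow> integral {0..1} (\<lambda>t. (f t - (\<Sum>i\<le>r. \<Sum>j\<le>r. t ^ Suc i / Suc i * b i j *
          (f 1 - integral {0..1} (\<lambda>u. f u * (real j * u ^ (j - 1))))))\<^sup>2)"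
proof -
  define v where "v j = f 1 - integral {0..1} (\<lambda>u. f u * (real j * u ^ (j - 1)))" for j
  define V where "V n j = (\<Sum>k=1..n. (real k / n) ^ j * (f (real k / n) - f ((real k - 1) / n)))" for n j
  have V: "(\<lambda>n. V n j) \<longlonglongrightarrow> v j" for j
    unfolding V_def v_def by (rule weighted_increments_tendsto[OF f f0])
  define w where "w i = (\<Sum>j\<le>r. b i j * v j)" for i
  define U where "U n i = (\<Sum>j\<le>r. B n i j * V n j)" for n i
  have U: "(\<lambda>n. U n i) \<longlonglongrightarrow> w i" if "i \<le> r" for i
    unfolding U_def w_def using that by (intro tendsto_intros V B) auto
  define h where "h t = f t - (\<Sum>i\<le>r. t ^ Suc i / Suc i * w i)" for t
  define H where "H n t = f (real t / n) - (\<Sum>i\<le>r. power_mean n t i * U n i)" for n t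
  \<comment> \<open>The uniform error: power means are at most 1 and multiply the error of
    \<open>U\<close>, while their own error of at most \<open>1 / n\<close> multiplies the limit
    \<open>w\<close>.\<close>
  define d where "d n = (\<Sum>i\<le>r. \<bar>U n i - w i\<bar> + \<bar>w i\<bar> / n)" for n :: nat
  have d: "d \<longlonglongrightarrow> (\<Sum>i\<le>r. \<bar>w i - w i\<bar> + 0)"
    unfolding d_def using lim_const_over_n
    by (intro tendsto_sum tendsto_add tendsto_rabs tendsto_diff U) auto
  have hc: "continuous_on {0..1} h" unfolding h_def by (intro continuous_intros f) auto
  obtain S where "\<forall>t\<in>{0..1}. \<bar>h t\<bar> \<le> S"
    using compact_imp_bounded[OF compact_continuous_image[OF hc compact_Icc]]
    by (auto simp: bounded_iff)
  then have S: "\<bar>h t\<bar> \<le> S" if "t \<in> {0..1}" for t using that by blast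
  have tele: "(\<Sum>k=1..t. f (real k / n) - f ((real k - 1) / n)) = f (real t / n)" for n t :: nat
    unfolding One_nat_def sum.atLeast1_atMost_eq by (induction t) (simp_all add: f0)
  have H_eq: "(\<Sum>k=1..n. detrend_coeff r (B n) n t k * (f (real k / n) - f ((real k - 1) / n))) = H n t"
    if "t \<le> n" for n t
    unfolding sum_detrend_coeff[OF that] tele H_def U_def V_def by (simp add: sum_distrib_left mult.assoc)
  have Hh: "\<bar>H n t - h (real t / n)\<bar> \<le> d n" if "t \<in> {1..n}" for n t
  proof -
    have n: "n > 0" "t \<le> n" using that by auto
    have "H n t - h (real t / n) = (\<Sum>i\<le>r. (real t / n) ^ Suc i / Suc i * w i - power_mean n t i * U n i)"
      by (simp add: H_def h_def sum_subtractf)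
    also have "\<bar>\<dots>\<bar> \<le> d n"
      unfolding d_def
    proof (intro order_trans[OF sum_abs] sum_mono)
      fix i
      have "(real t / n) ^ Suc i / Suc i * w i - power_mean n t i * U n i
        = power_mean n t i * (w i - U n i) - (power_mean n t i - (real t / n) ^ Suc i / Suc i) * w i"
        by (simp add: algebra_simps)
      also have "\<bar>\<dots>\<bar> \<le> \<bar>power_mean n t i\<bar> * \<bar>w i - U n i\<bar>
          + \<bar>power_mean n t i - (real t / n) ^ Suc i / Suc i\<bar> * \<bar>w i\<bar>"
        by (intro order_trans[OF abs_triangle_ineq4]) (simp add: abs_mult)
      also have "\<dots> \<le> 1 * \<bar>w i - U n i\<bar> + 1 / n * \<bar>w i\<bar>"
        using power_sum_bounds[OF n, of i] power_mean_bounds[OF n(2), of i]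
        by (intro add_mono mult_right_mono) (auto simp: power_mean_def)
      finally show "\<bar>(real t / n) ^ Suc i / Suc i * w i - power_mean n t i * U n i\<bar>
          \<le> \<bar>U n i - w i\<bar> + \<bar>w i\<bar> / n" by (simp add: abs_minus_commute)
    qed
    finally show ?thesis .
  qed
  have d0: "d n \<ge> 0" for n unfolding d_def by (intro sum_nonneg) auto
  have err: "\<bar>(\<Sum>t=1..n. (H n t)\<^sup>2) / n - (\<Sum>t=1..n. (h (real t / n))\<^sup>2) / n\<bar> \<le> d n * (d n + 2 * S)" for n
  proof (cases "n = 0")
    case True
    have "S \<ge> 0" using S[of 0] by force
    then show ?thesis using True d0[of n] by simp
  next
    case False
    have "\<bar>(\<Sum>t=1..n. (H n t)\<^sup>2) - (\<Sum>t=1..n. (h (real t / n))\<^sup>2)\<bar> \<le> (\<Sum>t=1..n. d n * (d n + 2 * S))"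
      unfolding sum_subtractf[symmetric]
    proof (intro order_trans[OF sum_abs] sum_mono)
      fix t assume t: "t \<in> {1..n}"
      \<comment> \<open>In this factorization only \<open>h\<close> has to be bounded, not
        \<open>H\<close>.\<close>
      have "(H n t)\<^sup>2 - (h (real t / n))\<^sup>2 = (H n t - h (real t / n)) * ((H n t - h (real t / n)) + 2 * h (real t / n))"
        by (simp add: power2_eq_square algebra_simps)
      also have "\<bar>\<dots>\<bar> \<le> d n * (d n + 2 * S)"
        unfolding abs_mult using Hh[OF t] S[of "real t / n"] t d0[of n]
        by (intro mult_mono order_trans[OF abs_triangle_ineq] add_mono) auto
      finally show "\<bar>(H n t)\<^sup>2 - (h (real t / n))\<^sup>2\<bar> \<le> d n * (d n + 2 * S)" .
    qed
    then show ?thesis using False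
      by (simp add: diff_divide_distrib[symmetric] divide_simps mult.commute)
  qed
  have "d \<longlonglongrightarrow> 0" using d by simp
  then have "(\<lambda>n. d n * (d n + 2 * S)) \<longlonglongrightarrow> 0 * (0 + 2 * S)"
    by (intro tendsto_mult tendsto_add tendsto_const)
  then have "(\<lambda>n. d n * (d n + 2 * S)) \<longlonglongrightarrow> 0" by simp
  moreover have "\<forall>\<^sub>F n::nat in sequentially. norm ((\<Sum>t=1..n. (H n t)\<^sup>2) / n - (\<Sum>t=1..n. (h (real t / n))\<^sup>2) / n)
      \<le> d n * (d n + 2 * S)"
    by (intro always_eventually allI) (simp only: real_norm_def err)
  ultimately have "(\<lambda>n::nat. (\<Sum>t=1..n. (H n t)\<^sup>2) / n - (\<Sum>t=1..n. (h (real t / n))\<^sup>2) / n) \<longlonglongrightarrow> 0"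
    by (rule Lim_null_comparison[rotated])
  note diff = this
  have "(\<lambda>n::nat. (\<Sum>t=1..n. (h (real t / n))\<^sup>2) / n) \<longlonglongrightarrow> integral {0..1} (\<lambda>t. (h t)\<^sup>2)"
    by (rule riemann_sum_tendsto) (intro continuous_intros hc)
  from tendsto_add[OF diff this]
  have "(\<lambda>n::nat. (\<Sum>t=1..n. (H n t)\<^sup>2) / n) \<longlonglongrightarrow> integral {0..1} (\<lambda>t. (h t)\<^sup>2)"
    by simp
  moreover have "mean_square_form (detrend_coeff r (B n) n) n (\<lambda>k. f (real k / n) - f ((real k - 1) / n))
      = (\<Sum>t=1..n. (H n t)\<^sup>2) / n" for n
    unfolding mean_square_form_def
    by (intro arg_cong2[where f="(/)"] sum.cong refl arg_cong[where f="\<lambda>x. x\<^sup>2"] H_eq) simp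
  moreover have "f t - (\<Sum>i\<le>r. \<Sum>j\<le>r. t ^ Suc i / Suc i * b i j * v j) = h t" for t
    by (simp add: h_def w_def sum_distrib_left mult.assoc)
  ultimately show ?thesis unfolding v_def[symmetric] by simp
qed

section \<open>Least squares and the Hilbert matrix\<close>

text \<open>Continuity in the entries, read off from the Leibniz formula; limits of matrices are
  taken entrywise throughout.\<close>

lemma tendsto_det:
  fixes A :: "'x \<Rightarrow> real mat"
  assumes A: "\<And>x. A x \<in> carrier_mat n n" and L: "L \<in> carrier_mat n n"
    and lim: "\<And>i j. i < n \<Longrightarrow> j < n \<Longrightarrow> ((\<lambda>x. A x $$ (i, j)) \<longlongrightarrow> L $$ (i, j)) F"
  shows "((\<lambda>x. Determinant.det (A x)) \<longlongrightarrow> Determinant.det L) F"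
proof -
  have "((\<lambda>x. \<Sum>p | p permutes {0..<n}. signof p * (\<Prod>i=0..<n. A x $$ (i, p i)))
     \<longlongrightarrow> (\<Sum>p | p permutes {0..<n}. signof p * (\<Prod>i=0..<n. L $$ (i, p i)))) F"
    by (intro tendsto_sum tendsto_mult tendsto_const tendsto_prod lim)
      (auto dest: permutes_in_image)
  then show ?thesis by (simp add: det_def'[OF A] det_def'[OF L])
qed

lemma tendsto_cofactor:
  fixes A :: "'x \<Rightarrow> real mat"
  assumes A: "\<And>x. A x \<in> carrier_mat n n" and L: "L \<in> carrier_mat n n"
    and lim: "\<And>i j. i < n \<Longrightarrow> j < n \<Longrightarrow> ((\<lambda>x. A x $$ (i, j)) \<longlongrightarrow> L $$ (i, j)) F"
    and ij: "i < n" "j < n"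
  shows "((\<lambda>x. cofactor (A x) i j) \<longlongrightarrow> cofactor L i j) F"
proof -
  have "mat_delete (A x) i j \<in> carrier_mat (n - 1) (n - 1)" for x
    using A by (rule mat_delete_carrier)
  moreover have "mat_delete L i j \<in> carrier_mat (n - 1) (n - 1)"
    using L by (rule mat_delete_carrier)
  moreover have "((\<lambda>x. mat_delete (A x) i j $$ (k, l)) \<longlongrightarrow> mat_delete L i j $$ (k, l)) F"
    if "k < n - 1" "l < n - 1" for k l
  proof -
    have "dim_row (A x) = n" "dim_col (A x) = n" for x using A by auto
    moreover have "dim_row L = n" "dim_col L = n" using L by auto
    ultimately show ?thesis using that
      by (auto simp: mat_delete_def intro!: lim)
  qed
  ultimately show ?thesis
    unfolding cofactor_def by (intro tendsto_mult tendsto_const tendsto_det[where n="n - 1"])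
qed

text \<open>Cramer's formula as a total function. Its continuity in the entries, wherever the
  determinant is nonzero, yields the convergence of inverses entry by entry.\<close>

definition cofactor_inverse :: "real mat \<Rightarrow> nat \<Rightarrow> nat \<Rightarrow> real" where
  "cofactor_inverse A i j = cofactor A j i / Determinant.det A"

lemma cofactor_inverse_left:
  assumes A: "A \<in> carrier_mat n n" and det: "Determinant.det A \<noteq> 0" and ij: "i < n" "k < n"
  shows "(\<Sum>j<n. cofactor_inverse A i j * A $$ (j, k)) = (if i = k then 1 else 0)"
proof -
  have "(adj_mat A * A) $$ (i, k) = (\<Sum>j<n. cofactor A j i * A $$ (j, k))"
    using A ij by (auto simp: adj_mat_def scalar_prod_def lessThan_atLeast0)
  moreover have "(adj_mat A * A) $$ (i, k) = Determinant.det A * (if i = k then 1 else 0)"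
    using adj_mat(3)[OF A] ij by simp
  ultimately have "(\<Sum>j<n. cofactor A j i * A $$ (j, k)) = Determinant.det A * (if i = k then 1 else 0)"
    by simp
  then have "(\<Sum>j<n. cofactor A j i * A $$ (j, k)) / Determinant.det A = (if i = k then 1 else 0)"
    using det by (simp only:) simp
  then show ?thesis by (simp add: cofactor_inverse_def sum_divide_distrib)
qed

lemma the_mat_inverse_cofactor:
  assumes A: "A \<in> carrier_mat n n" and det: "Determinant.det A \<noteq> 0"
  shows "the (mat_inverse A) = Matrix.mat n n (\<lambda>(i, j). cofactor_inverse A i j)"
proof -
  let ?B = "Matrix.mat n n (\<lambda>(i, j). cofactor_inverse A i j)"
  have "?B * A = 1\<^sub>m n"
  proof (rule eq_matI)
    fix i k assume "i < dim_row (1\<^sub>m n :: real mat)" "k < dim_col (1\<^sub>m n :: real mat)"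
    then show "(?B * A) $$ (i, k) = 1\<^sub>m n $$ (i, k)"
      using cofactor_inverse_left[OF A det, of i k] A
      by (simp add: scalar_prod_def lessThan_atLeast0)
  qed (use A in auto)
  then have "A * ?B = 1\<^sub>m n"
    using mat_mult_left_right_inverse[of ?B n A] A by simp
  then show ?thesis by (intro the_mat_inverse_eqI[OF A]) auto
qed

lemma has_integral_power_Icc:
  fixes t :: real
  assumes "t \<ge> 0"
  shows "((\<lambda>u. u ^ m) has_integral t ^ Suc m / Suc m) {0..t}"
proof -
  have "((\<lambda>u::real. u ^ m) has_integral t ^ Suc m / Suc m - 0 ^ Suc m / Suc m) {0..t}"
  proof (rule fundamental_theorem_of_calculus)
    fix u :: real
    have "((\<lambda>u. u ^ Suc m / Suc m) has_real_derivative u ^ m) (at u within {0..t})"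
      by (rule derivative_eq_intros refl | simp)+
    then show "((\<lambda>u. u ^ Suc m / Suc m) has_vector_derivative u ^ m) (at u within {0..t})"
      by (simp only: has_real_derivative_iff_has_vector_derivative)
  qed (use assms in simp)
  then show ?thesis by simp
qed

lemma has_integral_power_unit: "((\<lambda>u::real. u ^ m) has_integral 1 / (real m + 1)) {0..1}"
  using has_integral_power_Icc[of 1 m] by (simp add: add.commute)

text \<open>The Hilbert matrix is the Gram matrix of the powers of u on the unit interval. For a
  kernel vector \<open>v\<close> the square of the polynomial with coefficients \<open>v\<close> has
  integral 0, so this polynomial vanishes on the whole interval and has too many roots.\<close>

lemma hilbert_mat_det: "Determinant.det (hilbert_mat r) \<noteq> 0"
proof
  assume "Determinant.det (hilbert_mat r) = 0"
  moreover have H: "hilbert_mat r \<in> carrier_mat (r + 1) (r + 1)" by (simp add: hilbert_mat_def)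
  ultimately obtain v where v: "v \<in> carrier_vec (r + 1)" "v \<noteq> 0\<^sub>v (r + 1)"
    "hilbert_mat r *\<^sub>v v = 0\<^sub>v (r + 1)"
    using det_0_iff_vec_prod_zero[OF H] by blast
  define q where "q u = (\<Sum>i\<le>r. vec_index v i * u ^ i)" for u :: real
  have "((\<lambda>u. (q u)\<^sup>2) has_integral (\<Sum>i\<le>r. \<Sum>j\<le>r. vec_index v i * vec_index v j * (1 / (real i + real j + 1)))) {0..1}"
  proof -
    have "(q u)\<^sup>2 = (\<Sum>i\<le>r. \<Sum>j\<le>r. vec_index v i * vec_index v j * u ^ (i + j))" for u
      by (simp add: q_def power2_eq_square sum_product power_add mult_ac)
    moreover have "((\<lambda>u. \<Sum>i\<le>r. \<Sum>j\<le>r. vec_index v i * vec_index v j * u ^ (i + j)) has_integral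
       (\<Sum>i\<le>r. \<Sum>j\<le>r. vec_index v i * vec_index v j * (1 / (real i + real j + 1)))) {0..1}"
      using has_integral_power_unit[of "_ + _"] by (intro has_integral_sum has_integral_mult_right) auto
    ultimately show ?thesis by simp
  qed
  moreover have "(\<Sum>j\<le>r. vec_index v j * (1 / (real i + real j + 1))) = 0" if "i \<le> r" for i
  proof -
    have "vec_index (hilbert_mat r *\<^sub>v v) i = 0" using v(3) that by simp
    then show ?thesis using that v(1)
      by (simp add: hilbert_mat_def mult_mat_vec_def scalar_prod_def lessThan_Suc_atMost
          atLeast0LessThan mult.commute)
  qed
  then have "vec_index v i * (\<Sum>j\<le>r. vec_index v j * (1 / (real i + real j + 1))) = 0" if "i \<in> {..r}" for i
    using that by simp
  then have "(\<Sum>i\<le>r. vec_index v i * (\<Sum>j\<le>r. vec_index v j * (1 / (real i + real j + 1)))) = 0"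
    by (intro sum.neutral ballI)
  then have "(\<Sum>i\<le>r. \<Sum>j\<le>r. vec_index v i * vec_index v j * (1 / (real i + real j + 1))) = 0"
    by (simp only: mult.assoc sum_distrib_left)
  ultimately have "((\<lambda>u. (q u)\<^sup>2) has_integral 0) {0..1}" by simp
  moreover have "continuous_on {0..1} (\<lambda>u. (q u)\<^sup>2)" unfolding q_def by (intro continuous_intros)
  ultimately have q0: "q u = 0" if "u \<in> {0..1}" for u
    using has_integral_0_cbox_imp_0[of 0 1 "\<lambda>u. (q u)\<^sup>2" u] that by (simp add: cbox_interval)
  have "vec_index v i = 0" if "i \<le> r" for i
  proof (rule ccontr)
    assume "vec_index v i \<noteq> 0"
    with that have "\<exists>k\<le>r. vec_index v k \<noteq> 0" by blast
    from polyfun_rootbound[OF this] have "finite {u. q u = 0}" unfolding q_def by blast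
    then have "finite {0..1::real}" by (rule finite_subset[rotated]) (use q0 in auto)
    with infinite_Icc[of "0::real" 1] show False by simp
  qed
  then have "v = 0\<^sub>v (r + 1)" using v(1) by (intro eq_vecI) auto
  with v(2) show False by simp
qed

text \<open>The matrix of the normal equations divided by \<open>n\<close>, so that its entries are
  Riemann sums with the entries of \<open>hilbert_mat\<close> as limits.\<close>

definition gram_mat :: "nat \<Rightarrow> nat \<Rightarrow> real mat" where
  "gram_mat r n = Matrix.mat (r + 1) (r + 1) (\<lambda>(i, j). (\<Sum>t=1..n. (real t / n) ^ i * (real t / n) ^ j) / n)"

text \<open>Moving one coefficient by \<open>h\<close> changes the sum of squares by a quadratic in
  \<open>h\<close> with minimum at 0, so its linear term vanishes.\<close>

lemma ols_normal_equations:
  assumes ols: "ols_trend_fit r n y a" and j: "j \<le> r"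
  shows "(\<Sum>t=1..n. (y t - trend r a (real t / n)) * (real t / n) ^ j) = 0"
proof -
  let ?l = "\<lambda>t. (real t / n) ^ j"
  let ?e = "\<lambda>t. y t - trend r a (real t / n)"
  define b where "b = (\<Sum>t=1..n. ?e t * ?l t)"
  define c where "c = (\<Sum>t=1..n. (?l t)\<^sup>2)"
  have upd: "trend r (a(j := a j + h)) u = trend r a u + h * u ^ j" for h u
  proof -
    have "trend r (a(j := a j + h)) u - trend r a u = (\<Sum>i\<le>r. if i = j then h * u ^ j else 0)"
      unfolding trend_def sum_subtractf[symmetric] by (intro sum.cong) (auto simp: algebra_simps)
    then show ?thesis using j by simp
  qed
  have ge: "0 \<le> h * (c * h - 2 * b)" for h
  proof -
    have "(\<Sum>t=1..n. (?e t)\<^sup>2) \<le> (\<Sum>t=1..n. (y t - trend r (a(j := a j + h)) (real t / n))\<^sup>2)"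
      using ols unfolding ols_trend_fit_def is_arg_min_def by (meson linorder_not_less)
    also have "\<dots> = (\<Sum>t=1..n. (?e t)\<^sup>2 - 2 * h * (?e t * ?l t) + h\<^sup>2 * (?l t)\<^sup>2)"
      unfolding upd by (intro sum.cong) (auto simp: power2_eq_square algebra_simps)
    also have "\<dots> = (\<Sum>t=1..n. (?e t)\<^sup>2) - 2 * h * b + h\<^sup>2 * c"
      by (simp add: sum.distrib sum_subtractf b_def c_def sum_distrib_left)
    finally show ?thesis by (simp add: power2_eq_square algebra_simps)
  qed
  have c: "c \<ge> 0" unfolding c_def by (intro sum_nonneg) simp
  \<comment> \<open>The quadratic is smallest at \<open>b / c\<close>, but \<open>c\<close> is 0 for
    \<open>n = 0\<close>. With \<open>c + 1\<close> there is no division by zero, and the value is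
    still negative unless \<open>b\<close> is 0.\<close>
  have "0 \<le> b / (c + 1) * (c * (b / (c + 1)) - 2 * b)" by (rule ge)
  also have "\<dots> = - (b\<^sup>2 * (c + 2)) / (c + 1)\<^sup>2"
    using c by (simp add: divide_simps power2_eq_square) (simp add: algebra_simps)
  finally have "b\<^sup>2 * (c + 2) \<le> 0" using c by (simp add: divide_simps)
  then have "b\<^sup>2 \<le> 0" using c by (simp add: mult_le_0_iff)
  then show ?thesis by (simp add: b_def)
qed

text \<open>The normal equations solved by the left inverse; in particular every minimizer has the
  same relevant coefficients once the Gram matrix is invertible.\<close>

lemma ols_coefficients:
  assumes ols: "ols_trend_fit r n y a" and n: "n > 0"
    and det: "Determinant.det (gram_mat r n) \<noteq> 0" and i: "i \<le> r"
  shows "a i = (\<Sum>j\<le>r. cofactor_inverse (gram_mat r n) i j * ((\<Sum>k=1..n. (real k / n) ^ j * y k) / n))"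
proof -
  have G: "gram_mat r n \<in> carrier_mat (r + 1) (r + 1)" by (simp add: gram_mat_def)
  let ?G = "\<lambda>j l. (\<Sum>t=1..n. (real t / n) ^ j * (real t / n) ^ l) / n"
  have Gjl: "gram_mat r n $$ (j, l) = ?G j l" if "j \<le> r" "l \<le> r" for j l
    using that by (simp add: gram_mat_def)
  have "(\<Sum>k=1..n. (real k / n) ^ j * y k) / n = (\<Sum>l\<le>r. ?G j l * a l)" if "j \<le> r" for j
  proof -
    have "(\<Sum>k=1..n. (real k / n) ^ j * y k) = (\<Sum>k=1..n. trend r a (real k / n) * (real k / n) ^ j)"
      using ols_normal_equations[OF ols that]
      by (simp add: left_diff_distrib sum_subtractf mult.commute[of _ "_ ^ j"])
        (simp add: right_diff_distrib sum_subtractf)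
    also have "\<dots> = (\<Sum>l\<le>r. \<Sum>k=1..n. (real k / n) ^ j * (real k / n) ^ l * a l)"
      unfolding trend_def sum_distrib_right by (subst sum.swap) (simp add: mult_ac)
    finally show ?thesis by (simp add: sum_divide_distrib sum_distrib_right)
  qed
  then have "(\<Sum>j\<le>r. cofactor_inverse (gram_mat r n) i j * ((\<Sum>k=1..n. (real k / n) ^ j * y k) / n))
     = (\<Sum>j\<le>r. cofactor_inverse (gram_mat r n) i j * (\<Sum>l\<le>r. gram_mat r n $$ (j, l) * a l))"
    by (intro sum.cong) (simp_all add: Gjl)
  also have "\<dots> = (\<Sum>l\<le>r. (\<Sum>j\<le>r. cofactor_inverse (gram_mat r n) i j * gram_mat r n $$ (j, l)) * a l)"
    unfolding sum_distrib_left sum_distrib_right by (subst sum.swap) (simp add: mult.assoc)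
  also have "\<dots> = (\<Sum>l\<le>r. (if i = l then 1 else 0) * a l)"
  proof (intro sum.cong refl)
    fix l assume "l \<in> {..r}"
    then show "(\<Sum>j\<le>r. cofactor_inverse (gram_mat r n) i j * gram_mat r n $$ (j, l)) * a l
        = (if i = l then 1 else 0) * a l"
      using cofactor_inverse_left[OF G det, of i l] i by (simp add: lessThan_Suc_atMost)
  qed
  also have "\<dots> = a i" using i by (simp add: if_distrib[of "\<lambda>c. c * _"] cong: if_cong)
  finally show ?thesis ..
qed


lemma gram_mat_tendsto:
  assumes "i \<le> r" "j \<le> r"
  shows "(\<lambda>n. gram_mat r n $$ (i, j)) \<longlonglongrightarrow> hilbert_mat r $$ (i, j)"
proof -
  have "(\<lambda>n. (\<Sum>t=1..n. (real t / n) ^ (i + j)) / n) \<longlonglongrightarrow> integral {0..1} (\<lambda>u. u ^ (i + j))"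
    by (rule riemann_sum_tendsto) (intro continuous_intros)
  moreover have "integral {0..1} (\<lambda>u::real. u ^ (i + j)) = 1 / (real i + real j + 1)"
    using has_integral_power_unit[of "i + j"] by (simp add: integral_unique)
  ultimately show ?thesis using assms by (simp add: gram_mat_def hilbert_mat_def power_add)
qed

lemma gram_mat_carrier: "gram_mat r n \<in> carrier_mat (r + 1) (r + 1)"
  and hilbert_mat_carrier: "hilbert_mat r \<in> carrier_mat (r + 1) (r + 1)"
  by (simp_all add: gram_mat_def hilbert_mat_def)

lemma gram_mat_det_tendsto:
  "(\<lambda>n. Determinant.det (gram_mat r n)) \<longlonglongrightarrow> Determinant.det (hilbert_mat r)"
  by (rule tendsto_det[OF gram_mat_carrier hilbert_mat_carrier], rule gram_mat_tendsto) auto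

lemma eventually_gram_mat_det: "\<forall>\<^sub>F n in sequentially. Determinant.det (gram_mat r n) \<noteq> 0"
  by (rule tendsto_imp_eventually_ne[OF gram_mat_det_tendsto hilbert_mat_det])

lemma cofactor_inverse_gram_mat_tendsto:
  assumes "i \<le> r" "j \<le> r"
  shows "(\<lambda>n. cofactor_inverse (gram_mat r n) i j) \<longlonglongrightarrow> cofactor_inverse (hilbert_mat r) i j"
  unfolding cofactor_inverse_def
proof (intro tendsto_divide gram_mat_det_tendsto hilbert_mat_det)
  show "(\<lambda>n. cofactor (gram_mat r n) j i) \<longlonglongrightarrow> cofactor (hilbert_mat r) j i"
    by (rule tendsto_cofactor[OF gram_mat_carrier hilbert_mat_carrier], rule gram_mat_tendsto)
      (use assms in auto)
qed

text \<open>Brings the matrix notation of \<open>bridge\<close> into the double sum in which the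
  limit of the quadratic form appears.\<close>

lemma bridge_eq:
  assumes t: "t \<ge> 0"
  shows "bridge r f t = f t - (\<Sum>i\<le>r. \<Sum>j\<le>r. t ^ Suc i / Suc i * cofactor_inverse (hilbert_mat r) i j *
    (f 1 - integral {0..1} (\<lambda>u. f u * (real j * u ^ (j - 1)))))"
proof -
  have I: "integral {0..t} (\<lambda>u. u ^ i) = t ^ Suc i / Suc i" for i
    using has_integral_power_Icc[OF t] by (simp add: integral_unique)
  have L: "vec_integral (r + 1) 0 t (Lam r) = Matrix.vec (r + 1) (\<lambda>i. t ^ Suc i / Suc i)"
    unfolding vec_integral_def Lam_def using I by (intro eq_vecI) auto
  have V: "f 1 \<cdot>\<^sub>v Lam r 1 - vec_integral (r + 1) 0 1 (\<lambda>u. f u \<cdot>\<^sub>v Lam_deriv r u)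
      = Matrix.vec (r + 1) (\<lambda>j. f 1 - integral {0..1} (\<lambda>u. f u * (real j * u ^ (j - 1))))"
    unfolding vec_integral_def Lam_def Lam_deriv_def by (intro eq_vecI) auto
  show ?thesis
    unfolding bridge_def L V the_mat_inverse_cofactor[OF hilbert_mat_carrier hilbert_mat_det]
    by (simp add: scalar_prod_def mult_mat_vec_def atLeast0LessThan lessThan_Suc_atMost sum_distrib_left
        mult.assoc del: power_Suc of_nat_Suc)
qed

section \<open>Stable autoregressions\<close>

lemma coeff_ar_poly: "coeff (ar_poly p \<theta>) i = (if i = 0 then 1 else if i \<le> p then - \<theta> i else 0)"
proof -
  have "coeff (\<Sum>j=1..p. monom (\<theta> j) j) i = (\<Sum>j=1..p. if i = j then \<theta> j else 0)"
    unfolding coeff_sum by (intro sum.cong) auto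
  then show ?thesis by (auto simp: ar_poly_def)
qed

text \<open>The degree can be smaller than \<open>p\<close>, since the last coefficients may vanish;
  the sum is extended by zero terms.\<close>

lemma lag_poly_ar_poly:
  "lag_poly (ar_poly p \<theta>) x t = x t - (\<Sum>i=1..p. \<theta> i * x (t - int i))"
proof -
  have lag: "(lag ^^ i) x t = x (t - int i)" for i
  proof (induction i arbitrary: t)
    case (Suc i)
    then show ?case by (simp add: lag_def algebra_simps)
  qed simp
  have deg: "degree (ar_poly p \<theta>) \<le> p"
    by (rule degree_le) (simp add: coeff_ar_poly)
  have "lag_poly (ar_poly p \<theta>) x t = (\<Sum>i\<le>p. coeff (ar_poly p \<theta>) i * x (t - int i))"
    unfolding lag_poly_def lag
    by (rule sum.mono_neutral_left) (use deg in \<open>auto simp: coeff_eq_0\<close>)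
  also have "{..p} = insert 0 {1..p}" by auto
  also have "(\<Sum>i\<in>insert 0 {1..p}. coeff (ar_poly p \<theta>) i * x (t - int i))
      = x t + (\<Sum>i=1..p. coeff (ar_poly p \<theta>) i * x (t - int i))"
    by (subst sum.insert) (auto simp: coeff_ar_poly)
  also have "(\<Sum>i=1..p. coeff (ar_poly p \<theta>) i * x (t - int i)) = (\<Sum>i=1..p. - (\<theta> i * x (t - int i)))"
    by (intro sum.cong) (auto simp: coeff_ar_poly)
  finally show ?thesis by (simp add: sum_negf)
qed

definition ar_fps :: "nat \<Rightarrow> (nat \<Rightarrow> real) \<Rightarrow> complex fps" where
  "ar_fps p \<theta> = fps_of_poly (map_poly of_real (ar_poly p \<theta>))"

text \<open>Moduli of the coefficients of the reciprocal of the autoregressive polynomial, the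
  weights of the moving average representation. The series is complex because complex zeros govern
  its radius of convergence.\<close>

definition impulse_response :: "nat \<Rightarrow> (nat \<Rightarrow> real) \<Rightarrow> nat \<Rightarrow> real" where
  "impulse_response p \<theta> j = norm (fps_nth (inverse (ar_fps p \<theta>)) j)"

lemma ar_fps_nth: "fps_nth (ar_fps p \<theta>) i = of_real (coeff (ar_poly p \<theta>) i)"
  by (simp add: ar_fps_def coeff_map_poly)

text \<open>The finitely many zeros leave free a disc of radius larger than 1, so the reciprocal
  series converges absolutely at 1.\<close>

lemma summable_impulse_response:
  assumes "zeros_outside_unit_circle (ar_poly p \<theta>)"
  shows "summable (impulse_response p \<theta>)"
proof -
  define Q where "Q = map_poly complex_of_real (ar_poly p \<theta>)"
  define Z where "Z = {z. poly Q z = 0}"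
  have "coeff Q 0 = 1" by (simp add: Q_def coeff_map_poly coeff_ar_poly)
  then have "Q \<noteq> 0" by auto
  then have fin: "finite Z" unfolding Z_def by (rule poly_roots_finite)
  have Z1: "norm z > 1" if "z \<in> Z" for z
    using assms that by (auto simp: zeros_outside_unit_circle_def Z_def Q_def)
  \<comment> \<open>The 2 makes the set nonempty when there are no zeros.\<close>
  define R where "R = Min (insert 2 (norm ` Z))"
  have R: "R > 1" unfolding R_def using fin Z1 by (subst Min_gr_iff) auto
  have "poly Q z \<noteq> 0" if "norm z < R" for z
  proof
    assume "poly Q z = 0"
    then have "R \<le> norm z" unfolding R_def using fin by (intro Min_le) (auto simp: Z_def)
    with that show False by simp
  qed
  then have "min (ereal R) (fps_conv_radius (fps_of_poly Q)) \<le> fps_conv_radius (inverse (fps_of_poly Q))"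
    by (intro fps_conv_radius_inverse) simp
  then have "ereal R \<le> fps_conv_radius (inverse (ar_fps p \<theta>))"
    by (simp add: ar_fps_def Q_def)
  moreover have "ereal (norm (1::complex)) < ereal R" using R by simp
  ultimately have "ereal (norm (1::complex)) < fps_conv_radius (inverse (ar_fps p \<theta>))"
    by (rule less_le_trans[rotated])
  from norm_summable_fps[OF this] show ?thesis by (simp add: impulse_response_def[abs_def])
qed

text \<open>The point 1 lies on the unit circle, where no zero is allowed.\<close>

lemma ar_poly_at_1_nonzero:
  assumes "zeros_outside_unit_circle (ar_poly p \<theta>)"
  shows "1 - (\<Sum>i=1..p. \<theta> i) \<noteq> 0"
proof
  assume *: "1 - (\<Sum>i=1..p. \<theta> i) = 0"
  have "poly (ar_poly p \<theta>) 1 = 1 - (\<Sum>i=1..p. \<theta> i)"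
    by (simp add: ar_poly_def poly_sum poly_monom)
  then have "poly (ar_poly p \<theta>) 1 = 0" using * by simp
  moreover have "poly (map_poly complex_of_real P) (of_real 1) = of_real (poly P 1)" for P :: "real poly"
    by (induction P) (auto simp: map_poly_pCons)
  ultimately have "poly (map_poly complex_of_real (ar_poly p \<theta>)) (of_real 1) = 0"
    by (simp only: of_real_0)
  then have "norm (complex_of_real 1) > 1"
    using assms unfolding zeros_outside_unit_circle_def by blast
  then show False by simp
qed

text \<open>By the recursion, the power series of the path times that of the polynomial has
  coefficients \<open>g\<close>; multiplication by the reciprocal series solves for the path. Zero
  initial values leave no transient term.\<close>

lemma ar_solution_le_convolution:
  fixes x :: "int \<Rightarrow> real" and g :: "nat \<Rightarrow> real"
  assumes init: "\<And>s. s \<in> {- int p + 1..0} \<Longrightarrow> x s = 0"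
    and eq: "\<And>t. t \<in> {1..n} \<Longrightarrow> x (int t) - (\<Sum>i=1..p. \<theta> i * x (int t - int i)) = g t"
    and t: "t \<in> {1..n}"
  shows "\<bar>x (int t)\<bar> \<le> (\<Sum>j<t. impulse_response p \<theta> j * \<bar>g (t - j)\<bar>)"
proof -
  define c where "c = coeff (ar_poly p \<theta>)"
  \<comment> \<open>Nothing is known at times before the initial range; the value 0 there lets the
    convolution run past it.\<close>
  define x0 where "x0 s = (if s \<le> 0 then 0 else x s)" for s
  define F where "F = ar_fps p \<theta>"
  \<comment> \<open>Cut off beyond \<open>n\<close>, where the recursion is not assumed; the
    coefficients up to \<open>n\<close> of a product do not see the tail.\<close>
  define X where "X = Abs_fps (\<lambda>k. if k \<in> {1..n} then complex_of_real (x (int k)) else 0)"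
  have F: "fps_nth F i = of_real (c i)" for i by (simp add: F_def ar_fps_nth c_def)
  have F0: "fps_nth F 0 = 1" by (simp add: F c_def coeff_ar_poly)
  have G: "fps_nth (F * X) m = of_real (g m)" if m: "m \<in> {1..n}" for m
  proof -
    have "fps_nth (F * X) m = (\<Sum>i=0..m. of_real (c i * x0 (int m - int i)))"
      unfolding fps_mult_nth using m
      by (intro sum.cong) (auto simp: F X_def x0_def of_nat_diff)
    also have "\<dots> = of_real (\<Sum>i=0..m. c i * x0 (int m - int i))" by simp
    \<comment> \<open>Passing through \<open>m + p\<close> covers all orders of \<open>m\<close> and
      \<open>p\<close> at once: beyond \<open>m\<close> the path vanishes, beyond \<open>p\<close>
      the coefficients do.\<close>
    also have "(\<Sum>i=0..m. c i * x0 (int m - int i)) = (\<Sum>i=0..m + p. c i * x0 (int m - int i))"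
      by (rule sum.mono_neutral_left) (auto simp: x0_def)
    also have "\<dots> = (\<Sum>i=0..p. c i * x0 (int m - int i))"
      by (rule sum.mono_neutral_right) (auto simp: c_def coeff_ar_poly)
    also have "\<dots> = c 0 * x0 (int m) + (\<Sum>i=1..p. c i * x0 (int m - int i))"
      by (simp add: sum.atLeast_Suc_atMost)
    also have "(\<Sum>i=1..p. c i * x0 (int m - int i)) = (\<Sum>i=1..p. - (\<theta> i * x (int m - int i)))"
    proof (intro sum.cong refl)
      fix i assume i: "i \<in> {1..p}"
      have "x0 (int m - int i) = x (int m - int i)"
        using init[of "int m - int i"] i m by (auto simp: x0_def)
      then show "c i * x0 (int m - int i) = - (\<theta> i * x (int m - int i))"
        using i by (simp add: c_def coeff_ar_poly)
    qed
    also have "c 0 * x0 (int m) + (\<Sum>i=1..p. - (\<theta> i * x (int m - int i))) = g m"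
      using eq[OF m] m by (simp add: c_def coeff_ar_poly x0_def sum_negf)
    finally show ?thesis .
  qed
  have G0: "fps_nth (F * X) 0 = 0" by (simp add: X_def)
  have "inverse F * F = 1" using F0 by (intro inverse_mult_eq_1) simp
  then have X_eq: "inverse F * (F * X) = X" by (simp only: mult.assoc[symmetric] mult_1_left)
  have "fps_nth X t = fps_nth (inverse F * (F * X)) t" unfolding X_eq ..
  also have "\<dots> = (\<Sum>j=0..t. fps_nth (inverse F) j * fps_nth (F * X) (t - j))"
    by (rule fps_mult_nth)
  \<comment> \<open>The term \<open>j = t\<close> carries the coefficient at 0, which is 0.\<close>
  also have "\<dots> = (\<Sum>j<t. fps_nth (inverse F) j * fps_nth (F * X) (t - j))"
    by (rule sum.mono_neutral_right) (use G0 in auto)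
  also have "norm \<dots> \<le> (\<Sum>j<t. impulse_response p \<theta> j * \<bar>g (t - j)\<bar>)"
  proof (rule order_trans[OF norm_sum], rule sum_mono)
    fix j assume "j \<in> {..<t}"
    then have "t - j \<in> {1..n}" using t by auto
    from G[OF this] show "norm (fps_nth (inverse F) j * fps_nth (F * X) (t - j)) \<le> impulse_response p \<theta> j * \<bar>g (t - j)\<bar>"
      by (simp add: norm_mult impulse_response_def F_def)
  qed
  finally show ?thesis using t by (simp add: X_def)
qed

lemma impulse_response_partial_sums:
  assumes "zeros_outside_unit_circle (ar_poly p \<theta>)"
  shows "(\<Sum>j<m. impulse_response p \<theta> j) \<le> suminf (impulse_response p \<theta>)"
    and "0 \<le> suminf (impulse_response p \<theta>)"
proof -
  have nonneg: "impulse_response p \<theta> j \<ge> 0" for j by (simp add: impulse_response_def)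
  show "(\<Sum>j<m. impulse_response p \<theta> j) \<le> suminf (impulse_response p \<theta>)"
    using nonneg by (intro sum_le_suminf summable_impulse_response[OF assms]) auto
  show "0 \<le> suminf (impulse_response p \<theta>)"
    using nonneg by (intro suminf_nonneg summable_impulse_response[OF assms])
qed

lemma ar_solution_bound:
  fixes x :: "int \<Rightarrow> real" and g :: "nat \<Rightarrow> real"
  assumes causal: "zeros_outside_unit_circle (ar_poly p \<theta>)"
    and init: "\<And>s. s \<in> {- int p + 1..0} \<Longrightarrow> x s = 0"
    and eq: "\<And>t. t \<in> {1..n} \<Longrightarrow> x (int t) - (\<Sum>i=1..p. \<theta> i * x (int t - int i)) = g t"
    and t: "t \<in> {1..n}" and g: "\<And>t. t \<in> {1..n} \<Longrightarrow> \<bar>g t\<bar> \<le> b"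
  shows "\<bar>x (int t)\<bar> \<le> suminf (impulse_response p \<theta>) * b"
proof -
  have b: "b \<ge> 0" using g[OF t] by linarith
  have "\<bar>x (int t)\<bar> \<le> (\<Sum>j<t. impulse_response p \<theta> j * \<bar>g (t - j)\<bar>)"
    using init eq t by (rule ar_solution_le_convolution)
  also have "\<dots> \<le> (\<Sum>j<t. impulse_response p \<theta> j * b)"
  proof (intro sum_mono mult_left_mono)
    fix j assume "j \<in> {..<t}"
    then have "t - j \<in> {1..n}" using t by auto
    then show "\<bar>g (t - j)\<bar> \<le> b" by (rule g)
  qed (simp add: impulse_response_def)
  also have "\<dots> = (\<Sum>j<t. impulse_response p \<theta> j) * b" by (simp add: sum_distrib_right)
  also have "\<dots> \<le> suminf (impulse_response p \<theta>) * b"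
    using impulse_response_partial_sums[OF causal] b by (intro mult_right_mono)
  finally show ?thesis .
qed

text \<open>Truncated subtraction sends the first \<open>j\<close> times to 0, where
  \<open>h\<close> vanishes.\<close>

lemma sum_shift_truncated:
  fixes h :: "nat \<Rightarrow> real"
  assumes "h 0 = 0"
  shows "(\<Sum>t=1..n. h (t - j)) = (\<Sum>s=1..n - j. h s)"
proof (induction n)
  case (Suc n)
  then show ?case using assms by (cases "j \<le> n") (simp_all add: Suc_diff_le)
qed simp

text \<open>Young's inequality for the convolution of a summable with a square summable
  sequence.\<close>

lemma ar_solution_L2_bound:
  fixes x :: "int \<Rightarrow> real" and g :: "nat \<Rightarrow> real"
  assumes causal: "zeros_outside_unit_circle (ar_poly p \<theta>)"
    and init: "\<And>s. s \<in> {- int p + 1..0} \<Longrightarrow> x s = 0"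
    and eq: "\<And>t. t \<in> {1..n} \<Longrightarrow> x (int t) - (\<Sum>i=1..p. \<theta> i * x (int t - int i)) = g t"
  shows "L2_set (\<lambda>t. x (int t)) {1..n} \<le> suminf (impulse_response p \<theta>) * L2_set g {1..n}"
proof -
  let ?c = "impulse_response p \<theta>"
  let ?C = "suminf ?c"
  \<comment> \<open>Zero outside the range, in particular at 0, the value of \<open>t - j\<close>
    for \<open>j >= t\<close>.\<close>
  define h where "h s = (if s \<in> {1..n} then (g s)\<^sup>2 else 0)" for s
  have c0: "?c j \<ge> 0" for j by (simp add: impulse_response_def)
  have C0: "?C \<ge> 0" by (rule impulse_response_partial_sums[OF causal])
  have "(x (int t))\<^sup>2 \<le> ?C * (\<Sum>j<n. ?c j * h (t - j))" if t: "t \<in> {1..n}" for t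
  proof -
    have "(x (int t))\<^sup>2 \<le> (\<Sum>j<t. ?c j * \<bar>g (t - j)\<bar>)\<^sup>2"
      using power_mono[OF ar_solution_le_convolution[OF init eq t] abs_ge_zero, of 2] by simp
    \<comment> \<open>Splitting the weight into two square roots prepares the Cauchy-Schwarz
      inequality: one factor has total mass at most \<open>?C\<close>, the other keeps the squares
      of \<open>g\<close>.\<close>
    also have "\<dots> = (\<Sum>j<t. sqrt (?c j) * (sqrt (?c j) * \<bar>g (t - j)\<bar>))\<^sup>2"
      using c0 by (simp add: mult.assoc[symmetric])
    also have "\<dots> \<le> (\<Sum>j<t. (sqrt (?c j))\<^sup>2) * (\<Sum>j<t. (sqrt (?c j) * \<bar>g (t - j)\<bar>)\<^sup>2)"
      by (rule Cauchy_Schwarz_ineq_sum)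
    also have "\<dots> = (\<Sum>j<t. ?c j) * (\<Sum>j<t. ?c j * h (t - j))"
    proof -
      have "(\<Sum>j<t. (sqrt (?c j) * \<bar>g (t - j)\<bar>)\<^sup>2) = (\<Sum>j<t. ?c j * h (t - j))"
        using c0 t by (intro sum.cong) (auto simp: power_mult_distrib h_def)
      then show ?thesis using c0 by simp
    qed
    also have "(\<Sum>j<t. ?c j * h (t - j)) = (\<Sum>j<n. ?c j * h (t - j))"
      using t by (intro sum.mono_neutral_left) (auto simp: h_def)
    also have "(\<Sum>j<t. ?c j) * (\<Sum>j<n. ?c j * h (t - j)) \<le> ?C * (\<Sum>j<n. ?c j * h (t - j))"
      using impulse_response_partial_sums[OF causal] c0
      by (intro mult_right_mono sum_nonneg mult_nonneg_nonneg) (auto simp: h_def)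
    finally show ?thesis .
  qed
  then have "(\<Sum>t=1..n. (x (int t))\<^sup>2) \<le> (\<Sum>t=1..n. ?C * (\<Sum>j<n. ?c j * h (t - j)))"
    by (intro sum_mono)
  also have "\<dots> = ?C * (\<Sum>j<n. ?c j * (\<Sum>t=1..n. h (t - j)))"
    unfolding sum_distrib_left by (rule sum.swap)
  also have "\<dots> \<le> ?C * (\<Sum>j<n. ?c j * (\<Sum>s=1..n. h s))"
  proof (rule mult_left_mono[OF sum_mono C0], rule mult_left_mono[OF _ c0])
    fix j
    have "(\<Sum>t=1..n. h (t - j)) = (\<Sum>s=1..n - j. h s)"
      by (rule sum_shift_truncated) (simp add: h_def)
    also have "\<dots> \<le> (\<Sum>s=1..n. h s)" by (intro sum_mono2) (auto simp: h_def)
    finally show "(\<Sum>t=1..n. h (t - j)) \<le> (\<Sum>s=1..n. h s)" .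
  qed
  also have "\<dots> = ?C * ((\<Sum>j<n. ?c j) * (\<Sum>s=1..n. h s))" by (simp add: sum_distrib_right)
  also have "\<dots> \<le> ?C * (?C * (\<Sum>s=1..n. h s))"
    using impulse_response_partial_sums[OF causal] C0
    by (intro mult_left_mono mult_right_mono sum_nonneg) (auto simp: h_def)
  also have "(\<Sum>s=1..n. h s) = (\<Sum>s=1..n. (g s)\<^sup>2)" by (intro sum.cong) (auto simp: h_def)
  finally have "(\<Sum>t=1..n. (x (int t))\<^sup>2) \<le> ?C\<^sup>2 * (\<Sum>s=1..n. (g s)\<^sup>2)"
    by (simp add: power2_eq_square mult.assoc)
  then have "sqrt (\<Sum>t=1..n. (x (int t))\<^sup>2) \<le> sqrt (?C\<^sup>2 * (\<Sum>s=1..n. (g s)\<^sup>2))"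
    by (rule real_sqrt_le_mono)
  then show ?thesis unfolding L2_set_def using C0 by (simp add: real_sqrt_mult)
qed

text \<open>A Beveridge-Nelson decomposition: the partial sums of the solution are those of the innovations
  divided by the value of the autoregressive polynomial at 1, up to a boundary term.\<close>
lemma ar_solution_partial_sums:
  fixes x :: "int \<Rightarrow> real" and g :: "nat \<Rightarrow> real"
  assumes c: "1 - (\<Sum>i=1..p. \<theta> i) \<noteq> 0"
    and init: "\<And>s. s \<in> {- int p + 1..0} \<Longrightarrow> x s = 0"
    and eq: "\<And>t. t \<in> {1..n} \<Longrightarrow> x (int t) - (\<Sum>i=1..p. \<theta> i * x (int t - int i)) = g t"
    and bnd: "\<And>t. t \<in> {1..n} \<Longrightarrow> \<bar>x (int t)\<bar> \<le> b" and b: "b \<ge> 0"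
    and i: "i \<le> p" and t: "t \<le> n"
  shows "\<bar>(\<Sum>k=1..t. x (int k - int i)) - (\<Sum>k=1..t. g k) / (1 - (\<Sum>i=1..p. \<theta> i))\<bar>
    \<le> (p + p * (\<Sum>i=1..p. \<bar>\<theta> i\<bar>) / \<bar>1 - (\<Sum>i=1..p. \<theta> i)\<bar>) * b"
proof -
  define c where "c = 1 - (\<Sum>i=1..p. \<theta> i)"
  define Z where "Z i = (\<Sum>k=1..t. x (int k - int i))" for i
  have xb: "\<bar>x s\<bar> \<le> b" if "s \<ge> - int p + 1" "s \<le> int n" for s
  proof (cases "s \<le> 0")
    case True
    then show ?thesis using init[of s] that b by simp
  next
    case False
    then have "nat s \<in> {1..n}" using that by auto
    from bnd[OF this] False show ?thesis by simp
  qed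
  have ZZ: "\<bar>Z 0 - Z i\<bar> \<le> real i * b" if "i \<le> p" for i
    using that
  proof (induction i)
    case (Suc i)
    \<comment> \<open>Sums over neighbouring lags differ by two end values, one of which is an
      initial value and hence 0.\<close>
    have tele: "(\<Sum>k=1..m. x (int k - int i) - x (int k - int (Suc i))) = x (int m - int i) - x (- int i)" for m
      by (induction m) (auto simp: algebra_simps)
    have "Z i - Z (Suc i) = x (int t - int i) - x (- int i)"
      using tele[of t] by (simp only: Z_def sum_subtractf)
    also have "x (- int i) = 0" using Suc.prems by (intro init) auto
    also have "\<bar>x (int t - int i) - 0\<bar> \<le> b" using Suc.prems t by (simp add: xb)
    finally have "\<bar>Z i - Z (Suc i)\<bar> \<le> b" .
    moreover have "\<bar>Z 0 - Z i\<bar> \<le> real i * b" using Suc by simp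
    moreover have "real (Suc i) * b = real i * b + b" by (simp add: algebra_simps)
    ultimately show ?case by linarith
  qed simp
  have "(\<Sum>k=1..t. g k) = (\<Sum>k=1..t. x (int k) - (\<Sum>i=1..p. \<theta> i * x (int k - int i)))"
    using eq t by (intro sum.cong) auto
  also have "\<dots> = Z 0 - (\<Sum>i=1..p. \<theta> i * Z i)"
    unfolding sum_subtractf Z_def sum_distrib_left by (subst sum.swap) simp
  \<comment> \<open>Replacing every lag by lag 0 collects the value of the polynomial at 1 in front
    of \<open>Z 0\<close>.\<close>
  also have "\<dots> = c * Z 0 + (\<Sum>i=1..p. \<theta> i * (Z 0 - Z i))"
    by (simp add: c_def right_diff_distrib left_diff_distrib sum_subtractf sum_distrib_right)
  finally have G: "(\<Sum>k=1..t. g k) / c = Z 0 + (\<Sum>i=1..p. \<theta> i * (Z 0 - Z i)) / c"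
    using c by (simp add: c_def add_divide_distrib)
  have "\<bar>\<Sum>i=1..p. \<theta> i * (Z 0 - Z i)\<bar> \<le> (\<Sum>i=1..p. \<bar>\<theta> i\<bar> * (p * b))"
  proof (intro order_trans[OF sum_abs] sum_mono)
    fix i assume i: "i \<in> {1..p}"
    have "\<bar>Z 0 - Z i\<bar> \<le> real i * b" using ZZ i by simp
    also have "\<dots> \<le> p * b" using i b by (intro mult_right_mono) auto
    finally show "\<bar>\<theta> i * (Z 0 - Z i)\<bar> \<le> \<bar>\<theta> i\<bar> * (p * b)"
      by (simp add: abs_mult mult_left_mono)
  qed
  then have "\<bar>\<Sum>i=1..p. \<theta> i * (Z 0 - Z i)\<bar> / \<bar>c\<bar> \<le> (\<Sum>i=1..p. \<bar>\<theta> i\<bar>) * (p * b) / \<bar>c\<bar>"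
    by (simp add: sum_distrib_right divide_right_mono)
  moreover have "\<bar>Z 0 - Z i\<bar> \<le> p * b"
    using ZZ[OF i] i b by (intro order_trans[OF ZZ[OF i]] mult_right_mono) auto
  moreover have "\<bar>(\<Sum>i=1..p. \<theta> i * (Z 0 - Z i)) / c\<bar> = \<bar>\<Sum>i=1..p. \<theta> i * (Z 0 - Z i)\<bar> / \<bar>c\<bar>"
    by (rule abs_divide)
  ultimately have "\<bar>Z i - (\<Sum>k=1..t. g k) / c\<bar> \<le> p * b + (\<Sum>i=1..p. \<bar>\<theta> i\<bar>) * (p * b) / \<bar>c\<bar>"
    unfolding G by linarith
  also have "\<dots> = (p + p * (\<Sum>i=1..p. \<bar>\<theta> i\<bar>) / \<bar>c\<bar>) * b" by (simp add: algebra_simps)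
  finally show ?thesis by (simp only: Z_def c_def)
qed

lemma ar_filter_diff:
  assumes "x (int t) - (\<Sum>i=1..p. \<theta> i * x (int t - int i)) = g t"
  shows "ar_filter p \<theta>c x t = g t + (\<Sum>i=1..p. (\<theta> i - \<theta>c i) * x (int t - int i))"
  unfolding ar_filter_def assms[symmetric] by (simp add: left_diff_distrib sum_subtractf)

text \<open>The factor of the sums of \<open>g\<close> is the ratio of the estimated to the true
  polynomial at 1. The boundary term is multiplied by the estimation error, which makes it
  negligible even for \<open>b\<close> of order sqrt n.\<close>

lemma ar_filter_partial_sums:
  fixes x :: "int \<Rightarrow> real" and g :: "nat \<Rightarrow> real"
  assumes c: "1 - (\<Sum>i=1..p. \<theta> i) \<noteq> 0"
    and init: "\<And>s. s \<in> {- int p + 1..0} \<Longrightarrow> x s = 0"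
    and eq: "\<And>t. t \<in> {1..n} \<Longrightarrow> x (int t) - (\<Sum>i=1..p. \<theta> i * x (int t - int i)) = g t"
    and bnd: "\<And>t. t \<in> {1..n} \<Longrightarrow> \<bar>x (int t)\<bar> \<le> b" and b: "b \<ge> 0" and t: "t \<le> n"
  shows "\<bar>(\<Sum>k=1..t. ar_filter p \<theta>c x k)
      - (1 + (\<Sum>i=1..p. \<theta> i - \<theta>c i) / (1 - (\<Sum>i=1..p. \<theta> i))) * (\<Sum>k=1..t. g k)\<bar>
    \<le> (\<Sum>i=1..p. \<bar>\<theta> i - \<theta>c i\<bar>) * ((p + p * (\<Sum>i=1..p. \<bar>\<theta> i\<bar>) / \<bar>1 - (\<Sum>i=1..p. \<theta> i)\<bar>) * b)"
proof -
  let ?G = "\<Sum>k=1..t. g k" and ?c = "1 - (\<Sum>i=1..p. \<theta> i)"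
  have "(\<Sum>k=1..t. ar_filter p \<theta>c x k) = (\<Sum>k=1..t. g k + (\<Sum>i=1..p. (\<theta> i - \<theta>c i) * x (int k - int i)))"
    using eq t by (intro sum.cong refl ar_filter_diff) auto
  also have "\<dots> = ?G + (\<Sum>i=1..p. (\<theta> i - \<theta>c i) * (\<Sum>k=1..t. x (int k - int i)))"
    unfolding sum.distrib sum_distrib_left by (subst sum.swap) simp
  finally have P: "(\<Sum>k=1..t. ar_filter p \<theta>c x k)
      = ?G + (\<Sum>i=1..p. (\<theta> i - \<theta>c i) * (\<Sum>k=1..t. x (int k - int i)))" .
  have alg: "P - (1 + d / c) * G = S - d * (G / c)" if "P = G + S" for P G S d c :: real
    using that by (simp add: algebra_simps)
  have dist: "(\<Sum>i\<in>A. D i * (Z i - w)) = (\<Sum>i\<in>A. D i * Z i) - (\<Sum>i\<in>A. D i) * w"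
    for A and D Z :: "nat \<Rightarrow> real" and w
    by (simp add: right_diff_distrib sum_subtractf sum_distrib_right)
  have S_eq: "(\<Sum>k=1..t. ar_filter p \<theta>c x k) - (1 + (\<Sum>i=1..p. \<theta> i - \<theta>c i) / ?c) * ?G
    = (\<Sum>i=1..p. (\<theta> i - \<theta>c i) * ((\<Sum>k=1..t. x (int k - int i)) - ?G / ?c))"
    unfolding alg[OF P] by (rule dist[symmetric])
  show ?thesis
    unfolding S_eq sum_distrib_right[of "\<lambda>i. \<bar>\<theta> i - \<theta>c i\<bar>"]
  proof (intro order_trans[OF sum_abs] sum_mono)
    fix i assume "i \<in> {1..p}"
    then have "\<bar>(\<Sum>k=1..t. x (int k - int i)) - ?G / ?c\<bar> \<le> (p + p * (\<Sum>i=1..p. \<bar>\<theta> i\<bar>) / \<bar>?c\<bar>) * b"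
      using c init eq bnd b t by (intro ar_solution_partial_sums[where n=n]) auto
    then show "\<bar>(\<theta> i - \<theta>c i) * ((\<Sum>k=1..t. x (int k - int i)) - ?G / ?c)\<bar>
        \<le> \<bar>\<theta> i - \<theta>c i\<bar> * ((p + p * (\<Sum>i=1..p. \<bar>\<theta> i\<bar>) / \<bar>?c\<bar>) * b)"
      unfolding abs_mult by (rule mult_left_mono) simp
  qed
qed

lemma L2_set_sum_le: "L2_set (\<lambda>k. \<Sum>i\<in>I. f i k) A \<le> (\<Sum>i\<in>I. L2_set (f i) A)"
proof (induction I rule: infinite_finite_induct)
  case (insert i I)
  then show ?case using L2_set_triangle_ineq[of "f i" "\<lambda>k. \<Sum>i\<in>I. f i k" A] by simp
qed (simp_all add: L2_set_def)

lemma L2_set_cmult: "L2_set (\<lambda>k. a * f k) A = \<bar>a\<bar> * L2_set f A"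
  by (simp add: L2_set_def power_mult_distrib sum_distrib_left[symmetric] real_sqrt_mult)

text \<open>With zero initial values a lag only drops terms from the sum of squares.\<close>

lemma ar_filter_L2_diff:
  fixes x :: "int \<Rightarrow> real" and g :: "nat \<Rightarrow> real"
  assumes init: "\<And>s. s \<in> {- int p + 1..0} \<Longrightarrow> x s = 0"
    and eq: "\<And>t. t \<in> {1..n} \<Longrightarrow> x (int t) - (\<Sum>i=1..p. \<theta> i * x (int t - int i)) = g t"
  shows "L2_set (\<lambda>k. ar_filter p \<theta>c x k - g k) {1..n}
    \<le> (\<Sum>i=1..p. \<bar>\<theta> i - \<theta>c i\<bar>) * L2_set (\<lambda>t. x (int t)) {1..n}"
proof -
  have "L2_set (\<lambda>k. ar_filter p \<theta>c x k - g k) {1..n}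
      = L2_set (\<lambda>k. \<Sum>i=1..p. (\<theta> i - \<theta>c i) * x (int k - int i)) {1..n}"
  proof (intro L2_set_cong refl)
    fix k assume "k \<in> {1..n}"
    from ar_filter_diff[where x=x and g=g and \<theta>=\<theta> and \<theta>c=\<theta>c, OF eq[OF this]]
    show "ar_filter p \<theta>c x k - g k = (\<Sum>i=1..p. (\<theta> i - \<theta>c i) * x (int k - int i))" by simp
  qed
  also have "\<dots> \<le> (\<Sum>i=1..p. L2_set (\<lambda>k. (\<theta> i - \<theta>c i) * x (int k - int i)) {1..n})"
    by (rule L2_set_sum_le)
  also have "\<dots> \<le> (\<Sum>i=1..p. \<bar>\<theta> i - \<theta>c i\<bar> * L2_set (\<lambda>t. x (int t)) {1..n})"
    unfolding L2_set_cmult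
  proof (intro sum_mono mult_left_mono abs_ge_zero)
    fix i assume i: "i \<in> {1..p}"
    define h where "h s = (if s = 0 then 0 else (x (int s))\<^sup>2)" for s :: nat
    have "(\<Sum>k=1..n. (x (int k - int i))\<^sup>2) = (\<Sum>k=1..n. h (k - i))"
    proof (intro sum.cong refl)
      fix k assume "k \<in> {1..n}"
      then show "(x (int k - int i))\<^sup>2 = h (k - i)"
        using init[of "int k - int i"] i by (cases "k \<le> i") (auto simp: h_def of_nat_diff)
    qed
    also have "\<dots> = (\<Sum>s=1..n - i. h s)" by (rule sum_shift_truncated) (simp add: h_def)
    also have "\<dots> \<le> (\<Sum>s=1..n. h s)" by (intro sum_mono2) (auto simp: h_def)
    also have "\<dots> = (\<Sum>t=1..n. (x (int t))\<^sup>2)" by (intro sum.cong) (auto simp: h_def)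
    finally show "L2_set (\<lambda>k. x (int k - int i)) {1..n} \<le> L2_set (\<lambda>t. x (int t)) {1..n}"
      unfolding L2_set_def by (rule real_sqrt_le_mono)
  qed
  finally show ?thesis by (simp add: sum_distrib_right)
qed

section \<open>Residuals\<close>

text \<open>Explicit and linear in \<open>y\<close>, in contrast to a minimizer. The inverse of
  \<open>gram_mat\<close> as \<open>B\<close> gives the least squares residuals, the zero matrix
  returns \<open>y\<close>.\<close>

definition fit_resid :: "nat \<Rightarrow> (nat \<Rightarrow> nat \<Rightarrow> real) \<Rightarrow> nat \<Rightarrow> (nat \<Rightarrow> real) \<Rightarrow> nat \<Rightarrow> real" where
  "fit_resid r B n y k =
     y k - (\<Sum>i\<le>r. \<Sum>j\<le>r. (real k / n) ^ i * B i j * ((\<Sum>l=1..n. (real l / n) ^ j * y l) / n))"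

lemma fit_resid_add: "fit_resid r B n (\<lambda>k. y k + z k) k = fit_resid r B n y k + fit_resid r B n z k"
  by (simp add: fit_resid_def distrib_left sum.distrib add_divide_distrib)

lemma fit_resid_cmult: "fit_resid r B n (\<lambda>k. a * y k) k = a * fit_resid r B n y k"
proof -
  have "(\<Sum>l=1..n. (real l / n) ^ j * (a * y l)) / n = a * ((\<Sum>l=1..n. (real l / n) ^ j * y l) / n)" for j
    by (simp add: sum_distrib_left mult.left_commute)
  then have "(real k / n) ^ i * B i j * ((\<Sum>l=1..n. (real l / n) ^ j * (a * y l)) / n)
     = a * ((real k / n) ^ i * B i j * ((\<Sum>l=1..n. (real l / n) ^ j * y l) / n))" for i j
    by (simp only: mult_ac)
  then show ?thesis unfolding fit_resid_def by (simp only: sum_distrib_left[symmetric] right_diff_distrib)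
qed

lemma fit_resid_partial_sums:
  assumes "t \<le> n"
  shows "(\<Sum>k=1..t. fit_resid r B n y k) = (\<Sum>k=1..n. detrend_coeff r B n t k * y k)"
proof -
  have "(\<Sum>k=1..t. \<Sum>i\<le>r. \<Sum>j\<le>r. (real k / n) ^ i * B i j * (v j / n))
      = (\<Sum>i\<le>r. \<Sum>j\<le>r. power_mean n t i * B i j * v j)" for v :: "nat \<Rightarrow> real"
  proof -
    have "(\<Sum>k=1..t. \<Sum>i\<le>r. \<Sum>j\<le>r. (real k / n) ^ i * B i j * (v j / n))
      = (\<Sum>i\<le>r. \<Sum>j\<le>r. \<Sum>k=1..t. (real k / n) ^ i * B i j * (v j / n))"
      by (subst sum.swap) (intro sum.cong refl sum.swap)
    also have "\<dots> = (\<Sum>i\<le>r. \<Sum>j\<le>r. power_mean n t i * B i j * v j)"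
      unfolding power_mean_def
      by (intro sum.cong refl) (simp add: sum_distrib_right sum_divide_distrib)
    finally show ?thesis .
  qed
  then show ?thesis unfolding sum_detrend_coeff[OF assms] fit_resid_def sum_subtractf by simp
qed

section \<open>Stability of detrending in terms of partial sums and of mean squares\<close>

lemma double_sum_bound:
  fixes r :: nat
  assumes "\<And>i j. i \<le> r \<Longrightarrow> j \<le> r \<Longrightarrow> \<bar>c i j\<bar> \<le> (b :: real)"
  shows "\<bar>\<Sum>i\<le>r. \<Sum>j\<le>r. c i j\<bar> \<le> (real r + 1)\<^sup>2 * b"
proof -
  have "\<bar>\<Sum>i\<le>r. \<Sum>j\<le>r. c i j\<bar> \<le> (\<Sum>i\<le>r. \<bar>\<Sum>j\<le>r. c i j\<bar>)" by (rule sum_abs)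
  also have "\<dots> \<le> (\<Sum>i\<le>r. \<Sum>j\<le>r. \<bar>c i j\<bar>)" by (intro sum_mono sum_abs)
  also have "\<dots> \<le> (\<Sum>i\<le>r. \<Sum>j\<le>r. b)" using assms by (intro sum_mono) auto
  also have "\<dots> = (real r + 1)\<^sup>2 * b" by (simp add: power2_eq_square algebra_simps)
  finally show ?thesis .
qed

text \<open>Summation by parts: the weights increase to 1 from a nonnegative value, so the boundary
  term and the total variation contribute \<rho> each.\<close>

lemma abel_power_weights:
  fixes y :: "nat \<Rightarrow> real"
  assumes P: "\<And>t. t \<le> n \<Longrightarrow> \<bar>\<Sum>k=1..t. y k\<bar> \<le> \<rho>"
  shows "\<bar>\<Sum>k=1..n. (real k / n) ^ j * y k\<bar> \<le> 2 * \<rho>"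
proof (cases "n = 0")
  case True
  then show ?thesis using P[of 0] by simp
next
  case False
  define a where "a k = (real k / n) ^ j" for k :: nat
  define S where "S t = (\<Sum>k=1..t. y k)" for t
  have a_mono: "a k \<le> a (Suc k)" for k
    unfolding a_def by (intro power_mono divide_right_mono) auto
  have a01: "0 \<le> a k" for k by (simp add: a_def)
  have an: "a n = 1" using False by (simp add: a_def)
  have abel: "(\<Sum>k=1..m. a k * y k) = a m * S m - (\<Sum>k<m. (a (Suc k) - a k) * S k)" for m
    by (induction m) (simp_all add: S_def algebra_simps)
  have "\<bar>\<Sum>k<n. (a (Suc k) - a k) * S k\<bar> \<le> (\<Sum>k<n. (a (Suc k) - a k) * \<rho>)"
  proof (intro order_trans[OF sum_abs] sum_mono)
    fix k assume "k \<in> {..<n}"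
    then show "\<bar>(a (Suc k) - a k) * S k\<bar> \<le> (a (Suc k) - a k) * \<rho>"
      using a_mono[of k] P[of k] by (simp add: abs_mult S_def mult_left_mono)
  qed
  also have "\<dots> = (a n - a 0) * \<rho>" by (simp add: sum_distrib_right[symmetric] sum_lessThan_telescope)
  also have "\<dots> \<le> 1 * \<rho>" using an a01[of 0] P[of 0] by (intro mult_right_mono) auto
  finally have "\<bar>\<Sum>k<n. (a (Suc k) - a k) * S k\<bar> \<le> \<rho>" by simp
  moreover have "\<bar>S n\<bar> \<le> \<rho>" using P[of n] by (simp add: S_def)
  ultimately show ?thesis using abel[of n] an by (simp add: a_def[symmetric])
qed

text \<open>The input is controlled through its partial sums only, as supplied by
  \<open>ar_filter_partial_sums\<close>; \<open>abel_power_weights\<close> extends this control to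
  the fitted coefficients.\<close>

lemma detrended_partial_sums_bound:
  fixes y :: "nat \<Rightarrow> real"
  assumes P: "\<And>t. t \<le> n \<Longrightarrow> \<bar>\<Sum>k=1..t. y k\<bar> \<le> \<rho>" and t: "t \<le> n"
    and B: "\<And>i j. i \<le> r \<Longrightarrow> j \<le> r \<Longrightarrow> \<bar>B i j\<bar> \<le> \<beta>"
  shows "\<bar>\<Sum>k=1..n. detrend_coeff r B n t k * y k\<bar> \<le> (1 + (real r + 1)\<^sup>2 * (2 * \<beta>)) * \<rho>"
proof -
  have \<rho>: "\<rho> \<ge> 0" using P[of 0] by simp
  have "\<bar>\<Sum>i\<le>r. \<Sum>j\<le>r. power_mean n t i * B i j * (\<Sum>k=1..n. (real k / n) ^ j * y k)\<bar>
      \<le> (real r + 1)\<^sup>2 * (2 * \<beta> * \<rho>)"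
  proof (rule double_sum_bound)
    fix i j assume ij: "i \<le> r" "j \<le> r"
    have "\<bar>power_mean n t i * B i j * (\<Sum>k=1..n. (real k / n) ^ j * y k)\<bar> \<le> 1 * \<beta> * (2 * \<rho>)"
      unfolding abs_mult using power_mean_bounds[OF t, of i] B[OF ij] abel_power_weights[where y=y and \<rho>=\<rho> and n=n and j=j, OF P]
      by (intro mult_mono) auto
    then show "\<bar>power_mean n t i * B i j * (\<Sum>k=1..n. (real k / n) ^ j * y k)\<bar> \<le> 2 * \<beta> * \<rho>" by simp
  qed
  moreover have "\<bar>\<Sum>k=1..t. y k\<bar> \<le> \<rho>" using P t by simp
  ultimately have "\<bar>\<Sum>k=1..n. detrend_coeff r B n t k * y k\<bar> \<le> \<rho> + (real r + 1)\<^sup>2 * (2 * \<beta> * \<rho>)"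
    unfolding sum_detrend_coeff[OF t] by linarith
  then show ?thesis by (simp add: algebra_simps)
qed

lemma L2_set_bounded:
  fixes w :: "nat \<Rightarrow> real"
  assumes w: "\<And>k. k \<in> {1..n} \<Longrightarrow> \<bar>w k\<bar> \<le> b" and b: "b \<ge> 0"
  shows "L2_set w {1..n} \<le> sqrt n * b"
proof -
  have "(\<Sum>k=1..n. (w k)\<^sup>2) \<le> (\<Sum>k=1..n. b\<^sup>2)"
  proof (rule sum_mono)
    fix k assume "k \<in> {1..n}"
    from power_mono[OF w[OF this] abs_ge_zero, of 2] show "(w k)\<^sup>2 \<le> b\<^sup>2" by simp
  qed
  then have "L2_set w {1..n} \<le> sqrt (n * b\<^sup>2)" unfolding L2_set_def by (intro real_sqrt_le_mono) simp
  then show ?thesis using b by (simp add: real_sqrt_mult)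
qed

lemma mean_power_weights_bound:
  fixes y :: "nat \<Rightarrow> real"
  shows "\<bar>(\<Sum>l=1..n. (real l / n) ^ j * y l) / n\<bar> \<le> L2_set y {1..n} / sqrt n"
proof (cases "n = 0")
  case False
  have "(\<Sum>l=1..n. (real l / n) ^ j * y l)\<^sup>2 \<le> (\<Sum>l=1..n. ((real l / n) ^ j)\<^sup>2) * (\<Sum>l=1..n. (y l)\<^sup>2)"
    by (rule Cauchy_Schwarz_ineq_sum)
  also have "\<dots> \<le> (\<Sum>l=1..n. 1) * (\<Sum>l=1..n. (y l)\<^sup>2)"
    using False by (intro mult_right_mono sum_mono sum_nonneg power_le_one) auto
  finally have "sqrt ((\<Sum>l=1..n. (real l / n) ^ j * y l)\<^sup>2) \<le> sqrt (n * (\<Sum>l=1..n. (y l)\<^sup>2))"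
    by (intro real_sqrt_le_mono) simp
  then have "\<bar>\<Sum>l=1..n. (real l / n) ^ j * y l\<bar> \<le> sqrt n * L2_set y {1..n}"
    by (simp add: real_sqrt_mult L2_set_def)
  then have "\<bar>\<Sum>l=1..n. (real l / n) ^ j * y l\<bar> / n \<le> sqrt n * L2_set y {1..n} / n"
    by (intro divide_right_mono) auto
  also have "\<dots> = L2_set y {1..n} / sqrt n" using False
    by (simp add: field_simps power2_eq_square[symmetric] flip: real_sqrt_mult)
  finally show ?thesis by simp
qed simp

text \<open>\<open>V\<close> stays a parameter: for the noise it tends to 0, for the filter error it
  comes from the Cauchy-Schwarz inequality.\<close>

lemma fit_resid_diff_L2:
  fixes y :: "nat \<Rightarrow> real"
  assumes v: "\<And>j. j \<le> r \<Longrightarrow> \<bar>(\<Sum>l=1..n. (real l / n) ^ j * y l) / n\<bar> \<le> V"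
    and B: "\<And>i j. i \<le> r \<Longrightarrow> j \<le> r \<Longrightarrow> \<bar>B i j\<bar> \<le> \<beta>"
  shows "L2_set (\<lambda>k. fit_resid r B n y k - y k) {1..n} \<le> sqrt n * ((real r + 1)\<^sup>2 * (\<beta> * V))"
proof (rule L2_set_bounded)
  have V: "V \<ge> 0" using v[of 0] by linarith
  have \<beta>: "\<beta> \<ge> 0" using B[of 0 0] by linarith
  show "(real r + 1)\<^sup>2 * (\<beta> * V) \<ge> 0" using V \<beta> by simp
  fix k assume k: "k \<in> {1..n}"
  have "\<bar>\<Sum>i\<le>r. \<Sum>j\<le>r. (real k / n) ^ i * B i j * ((\<Sum>l=1..n. (real l / n) ^ j * y l) / n)\<bar>
      \<le> (real r + 1)\<^sup>2 * (\<beta> * V)"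
  proof (rule double_sum_bound)
    fix i j assume ij: "i \<le> r" "j \<le> r"
    have "(real k / n) ^ i \<le> 1" using k by (intro power_le_one) auto
    then have "\<bar>(real k / n) ^ i * B i j * ((\<Sum>l=1..n. (real l / n) ^ j * y l) / n)\<bar> \<le> 1 * \<beta> * V"
      unfolding abs_mult[of "_ * _"] abs_mult[of "_ ^ _"] using B[OF ij] v[OF ij(2)] \<beta>
      by (intro mult_mono) auto
    then show "\<bar>(real k / n) ^ i * B i j * ((\<Sum>l=1..n. (real l / n) ^ j * y l) / n)\<bar> \<le> \<beta> * V" by simp
  qed
  then show "\<bar>fit_resid r B n y k - y k\<bar> \<le> (real r + 1)\<^sup>2 * (\<beta> * V)"
    by (simp add: fit_resid_def)
qed

lemma fit_resid_L2:
  fixes y :: "nat \<Rightarrow> real"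
  assumes B: "\<And>i j. i \<le> r \<Longrightarrow> j \<le> r \<Longrightarrow> \<bar>B i j\<bar> \<le> \<beta>" and n: "n > 0"
  shows "L2_set (fit_resid r B n y) {1..n} \<le> (1 + (real r + 1)\<^sup>2 * \<beta>) * L2_set y {1..n}"
proof -
  have "L2_set (\<lambda>k. y k + (fit_resid r B n y k - y k)) {1..n}
      \<le> L2_set y {1..n} + L2_set (\<lambda>k. fit_resid r B n y k - y k) {1..n}"
    by (rule L2_set_triangle_ineq)
  also have "L2_set (\<lambda>k. fit_resid r B n y k - y k) {1..n}
      \<le> sqrt n * ((real r + 1)\<^sup>2 * (\<beta> * (L2_set y {1..n} / sqrt n)))"
    by (rule fit_resid_diff_L2[OF mean_power_weights_bound B])
  also have "\<dots> = (real r + 1)\<^sup>2 * \<beta> * L2_set y {1..n}" using n by simp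
  finally show ?thesis by (simp add: algebra_simps)
qed

lemma L2_set_diff_le: "\<bar>L2_set f A - L2_set g A\<bar> \<le> L2_set (\<lambda>k. f k - g k) A"
proof -
  have "L2_set (\<lambda>k. g k + (f k - g k)) A \<le> L2_set g A + L2_set (\<lambda>k. f k - g k) A"
    by (rule L2_set_triangle_ineq)
  moreover have "L2_set (\<lambda>k. f k + (g k - f k)) A \<le> L2_set f A + L2_set (\<lambda>k. g k - f k) A"
    by (rule L2_set_triangle_ineq)
  moreover have "L2_set (\<lambda>k. g k - f k) A = L2_set (\<lambda>k. f k - g k) A"
    by (simp add: L2_set_def power2_commute)
  ultimately show ?thesis by simp
qed

lemma residual_eq_fit_resid:
  assumes "ols_trend_fit r n y a" "n > 0" "Determinant.det (gram_mat r n) \<noteq> 0" "\<kappa> \<noteq> 0"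
  shows "residual \<kappa> r n y a k = fit_resid r (cofactor_inverse (gram_mat r n)) n y k"
proof -
  have "trend r a (real k / n) = (\<Sum>i\<le>r. \<Sum>j\<le>r. (real k / n) ^ i * cofactor_inverse (gram_mat r n) i j *
      ((\<Sum>l=1..n. (real l / n) ^ j * y l) / n))"
    unfolding trend_def
  proof (intro sum.cong refl)
    fix i assume "i \<in> {..r}"
    then have "a i = (\<Sum>j\<le>r. cofactor_inverse (gram_mat r n) i j * ((\<Sum>l=1..n. (real l / n) ^ j * y l) / n))"
      using assms by (intro ols_coefficients) auto
    then show "a i * (real k / n) ^ i = (\<Sum>j\<le>r. (real k / n) ^ i * cofactor_inverse (gram_mat r n) i j *
        ((\<Sum>l=1..n. (real l / n) ^ j * y l) / n))"
      by (simp only: sum_distrib_left mult_ac)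
  qed
  then show ?thesis using assms(4) by (simp add: residual_def fit_resid_def)
qed

text \<open>A polynomial trend fits itself without error and so is a minimizer, to which
  \<open>residual_eq_fit_resid\<close> applies.\<close>

lemma fit_resid_trend:
  assumes "n > 0" "Determinant.det (gram_mat r n) \<noteq> 0"
  shows "fit_resid r (cofactor_inverse (gram_mat r n)) n (\<lambda>k. trend r a (real k / n)) k = 0"
proof -
  have "ols_trend_fit r n (\<lambda>k. trend r a (real k / n)) a"
    unfolding ols_trend_fit_def is_arg_min_def by (simp add: not_less sum_nonneg)
  \<comment> \<open>The value 1 merely switches the trend on.\<close>
  from residual_eq_fit_resid[OF this assms, of 1 k] show ?thesis by (simp add: residual_def)
qed

text \<open>The zero matrix for \<open>\<kappa> = 0\<close> makes the model without trend an
  instance of the same formulas.\<close>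

definition gram_inverse :: "real \<Rightarrow> nat \<Rightarrow> nat \<Rightarrow> nat \<Rightarrow> nat \<Rightarrow> real" where
  "gram_inverse \<kappa> r n = (if \<kappa> \<noteq> 0 then cofactor_inverse (gram_mat r n) else (\<lambda>_ _. 0))"

definition gram_inverse_limit :: "real \<Rightarrow> nat \<Rightarrow> nat \<Rightarrow> nat \<Rightarrow> real" where
  "gram_inverse_limit \<kappa> r = (if \<kappa> \<noteq> 0 then cofactor_inverse (hilbert_mat r) else (\<lambda>_ _. 0))"

lemma gram_inverse_tendsto:
  "i \<le> r \<Longrightarrow> j \<le> r \<Longrightarrow> (\<lambda>n. gram_inverse \<kappa> r n i j) \<longlonglongrightarrow> gram_inverse_limit \<kappa> r i j"
  by (auto simp: gram_inverse_def gram_inverse_limit_def intro: cofactor_inverse_gram_mat_tendsto)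

lemma gram_inverse_eventually_bounded:
  obtains \<beta> where "\<beta> \<ge> 0"
    "\<forall>\<^sub>F n in sequentially. \<forall>i\<le>r. \<forall>j\<le>r. \<bar>gram_inverse \<kappa> r n i j\<bar> \<le> \<beta>"
proof -
  define \<beta> where "\<beta> = (\<Sum>i\<le>r. \<Sum>j\<le>r. \<bar>gram_inverse_limit \<kappa> r i j\<bar> + 1)"
  have le: "\<bar>gram_inverse_limit \<kappa> r i j\<bar> + 1 \<le> \<beta>" if "i \<le> r" "j \<le> r" for i j
  proof -
    have "\<bar>gram_inverse_limit \<kappa> r i j\<bar> + 1 \<le> (\<Sum>j\<le>r. \<bar>gram_inverse_limit \<kappa> r i j\<bar> + 1)"
      using that by (intro member_le_sum[of j]) auto
    also have "\<dots> \<le> \<beta>" unfolding \<beta>_def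
      using that by (intro member_le_sum[of i] sum_nonneg) auto
    finally show ?thesis .
  qed
  have "\<forall>\<^sub>F n in sequentially. \<forall>i\<in>{..r}. \<forall>j\<in>{..r}. \<bar>gram_inverse \<kappa> r n i j\<bar> \<le> \<beta>"
  proof (intro eventually_ball_finite ballI finite_atMost)
    fix i j assume ij: "i \<in> {..r}" "j \<in> {..r}"
    have "(\<lambda>n. \<bar>gram_inverse \<kappa> r n i j\<bar>) \<longlonglongrightarrow> \<bar>gram_inverse_limit \<kappa> r i j\<bar>"
      using ij by (intro tendsto_rabs gram_inverse_tendsto) auto
    from order_tendstoD(2)[OF this, of "\<bar>gram_inverse_limit \<kappa> r i j\<bar> + 1"]
    have "\<forall>\<^sub>F n in sequentially. \<bar>gram_inverse \<kappa> r n i j\<bar> < \<bar>gram_inverse_limit \<kappa> r i j\<bar> + 1" by simp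
    then show "\<forall>\<^sub>F n in sequentially. \<bar>gram_inverse \<kappa> r n i j\<bar> \<le> \<beta>"
      by eventually_elim (use le[of i j] ij in auto)
  qed
  then have "\<forall>\<^sub>F n in sequentially. \<forall>i\<le>r. \<forall>j\<le>r. \<bar>gram_inverse \<kappa> r n i j\<bar> \<le> \<beta>"
    by (rule eventually_mono) simp
  moreover have "\<beta> \<ge> 0" using le[of 0 0] by simp
  ultimately show ?thesis using that by blast
qed

text \<open>Here \<open>d\<close> is the trend, \<open>e\<close> the noise and \<open>\<theta>c\<close> the estimate of \<open>\<theta>\<close>.\<close>
context
  fixes x :: "int \<Rightarrow> real" and e d \<theta> \<theta>c :: "nat \<Rightarrow> real" and B :: "nat \<Rightarrow> nat \<Rightarrow> real"
    and n p r :: nat and A \<beta> \<sigma> :: real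
  assumes causal: "zeros_outside_unit_circle (ar_poly p \<theta>)"
    and init: "\<And>s. s \<in> {- int p + 1..0} \<Longrightarrow> x s = 0"
    and eq: "\<And>t. t \<in> {1..n} \<Longrightarrow> x (int t) - (\<Sum>i=1..p. \<theta> i * x (int t - int i)) = d t + e t"
    and n: "n > 0" and \<sigma>: "\<sigma> > 0"
    and B: "\<And>i j. i \<le> r \<Longrightarrow> j \<le> r \<Longrightarrow> \<bar>B i j\<bar> \<le> \<beta>"
    and d: "\<And>t. t \<in> {1..n} \<Longrightarrow> \<bar>d t\<bar> \<le> A" and A: "A \<ge> 0"
    and fit_d: "\<And>k. fit_resid r B n d k = 0"
begin

lemma innovation_bound: "t \<in> {1..n} \<Longrightarrow> \<bar>d t + e t\<bar> \<le> A + L2_set e {1..n}"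
proof -
  assume t: "t \<in> {1..n}"
  have "\<bar>e t\<bar> \<le> L2_set (\<lambda>k. \<bar>e k\<bar>) {1..n}" using t by (intro member_le_L2_set) auto
  also have "\<dots> = L2_set e {1..n}" by (simp add: L2_set_def)
  finally show ?thesis using d[OF t] by linarith
qed

text \<open>The partial sums of the residuals are \<open>(1 + \<delta>) * a t + R t\<close>: the fit
  annihilates the trend, and \<open>R\<close> stems from the Beveridge-Nelson boundary term. Norms
  divided by \<open>\<sigma> * n\<close> leave a relative error \<delta> and a term proportional to
  the estimation error.\<close>

lemma residual_partial_sums_perturbation:
  "\<bar>sqrt ((\<Sum>t=1..n. (\<Sum>k=1..t. fit_resid r B n (ar_filter p \<theta>c x) k)\<^sup>2) / (\<sigma>\<^sup>2 * (real n)\<^sup>2))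
     - sqrt (mean_square_form (detrend_coeff r B n) n (\<lambda>k. e k / (\<sigma> * sqrt n)))\<bar>
   \<le> \<bar>(\<Sum>i=1..p. \<theta> i - \<theta>c i) / (1 - (\<Sum>i=1..p. \<theta> i))\<bar>
       * sqrt (mean_square_form (detrend_coeff r B n) n (\<lambda>k. e k / (\<sigma> * sqrt n)))
     + (1 + (real r + 1)\<^sup>2 * (2 * \<beta>)) * (p + p * (\<Sum>i=1..p. \<bar>\<theta> i\<bar>) / \<bar>1 - (\<Sum>i=1..p. \<theta> i)\<bar>)
       * suminf (impulse_response p \<theta>) / \<sigma> * (\<Sum>i=1..p. \<bar>\<theta> i - \<theta>c i\<bar>) * (A + L2_set e {1..n} / sqrt n)"
proof -
  define y where "y = ar_filter p \<theta>c x"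
  define \<delta> where "\<delta> = (\<Sum>i=1..p. \<theta> i - \<theta>c i) / (1 - (\<Sum>i=1..p. \<theta> i))"
  define \<Delta> where "\<Delta> = (\<Sum>i=1..p. \<bar>\<theta> i - \<theta>c i\<bar>)"
  define K where "K = p + p * (\<Sum>i=1..p. \<bar>\<theta> i\<bar>) / \<bar>1 - (\<Sum>i=1..p. \<theta> i)\<bar>"
  define \<Psi> where "\<Psi> = suminf (impulse_response p \<theta>)"
  define L where "L = 1 + (real r + 1)\<^sup>2 * (2 * \<beta>)"
  \<comment> \<open>A bound for the path: each innovation is at most the trend bound plus the
    Euclidean norm of the noise, crude but of order sqrt n.\<close>
  define b where "b = \<Psi> * (A + L2_set e {1..n})"
  define z where "z k = y k - (1 + \<delta>) * (d k + e k)" for k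
  define a where "a t = (\<Sum>k=1..n. detrend_coeff r B n t k * e k)" for t
  define R where "R t = (\<Sum>k=1..n. detrend_coeff r B n t k * z k)" for t
  define S where "S t = (\<Sum>k=1..t. fit_resid r B n y k)" for t
  have pos: "\<Psi> \<ge> 0" "\<Delta> \<ge> 0" "K \<ge> 0" "\<beta> \<ge> 0" "L \<ge> 0"
  proof -
    show \<beta>: "\<beta> \<ge> 0" using B[of 0 0] by linarith
    then show "L \<ge> 0" by (simp add: L_def)
    show "\<Psi> \<ge> 0" unfolding \<Psi>_def by (rule impulse_response_partial_sums[OF causal])
    show "\<Delta> \<ge> 0" "K \<ge> 0"
      unfolding \<Delta>_def K_def
      by (auto intro!: add_nonneg_nonneg divide_nonneg_nonneg mult_nonneg_nonneg sum_nonneg)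
  qed
  have L2e: "L2_set e {1..n} \<ge> 0" by (rule L2_set_nonneg)
  have b0: "b \<ge> 0" unfolding b_def using pos A L2e by simp
  have xb: "\<bar>x (int t)\<bar> \<le> b" if "t \<in> {1..n}" for t
    unfolding b_def \<Psi>_def
    by (rule ar_solution_bound[where g="\<lambda>t. d t + e t" and n=n, OF causal init eq that innovation_bound])
  have zP: "\<bar>\<Sum>k=1..t. z k\<bar> \<le> \<Delta> * (K * b)" if "t \<le> n" for t
  proof -
    have "(\<Sum>k=1..t. z k) = (\<Sum>k=1..t. ar_filter p \<theta>c x k) - (1 + \<delta>) * (\<Sum>k=1..t. d k + e k)"
      by (simp only: z_def y_def sum_subtractf sum_distrib_left)
    then show ?thesis
      using ar_filter_partial_sums[where g="\<lambda>t. d t + e t" and \<theta>c=\<theta>c, OF ar_poly_at_1_nonzero[OF causal] init eq xb b0 that]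
      by (simp only: \<Delta>_def K_def \<delta>_def)
  qed
  have Rb: "\<bar>R t\<bar> \<le> L * (\<Delta> * (K * b))" if "t \<in> {1..n}" for t
    unfolding R_def L_def
    by (rule detrended_partial_sums_bound[where y=z and n=n and t=t, OF zP _ B]) (use that in auto)
  have S: "S t = (1 + \<delta>) * a t + R t" if t: "t \<in> {1..n}" for t
  proof -
    have "y = (\<lambda>k. (1 + \<delta>) * (d k + e k) + z k)" by (simp add: z_def fun_eq_iff)
    then have "fit_resid r B n y k = (1 + \<delta>) * fit_resid r B n e k + fit_resid r B n z k" for k
      by (simp only: fit_resid_add fit_resid_cmult fit_d add_0_left)
    then have "S t = (1 + \<delta>) * (\<Sum>k=1..t. fit_resid r B n e k) + (\<Sum>k=1..t. fit_resid r B n z k)"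
      by (simp only: S_def sum.distrib sum_distrib_left)
    then show ?thesis using t fit_resid_partial_sums[of t n] by (simp add: a_def R_def)
  qed
  have U: "sqrt ((\<Sum>t=1..n. (S t)\<^sup>2) / (\<sigma>\<^sup>2 * (real n)\<^sup>2)) = L2_set S {1..n} / (\<sigma> * n)"
    using \<sigma> by (simp add: L2_set_def real_sqrt_divide real_sqrt_mult)
  have F: "sqrt (mean_square_form (detrend_coeff r B n) n (\<lambda>k. e k / (\<sigma> * sqrt n))) = L2_set a {1..n} / (\<sigma> * n)"
  proof -
    have "(\<Sum>k=1..n. detrend_coeff r B n t k * (e k / (\<sigma> * sqrt n))) = a t / (\<sigma> * sqrt n)" for t
      by (simp add: a_def sum_divide_distrib)
    then have "mean_square_form (detrend_coeff r B n) n (\<lambda>k. e k / (\<sigma> * sqrt n))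
        = (\<Sum>t=1..n. (a t)\<^sup>2) / (\<sigma> * n)\<^sup>2"
    proof -
      have "(\<sigma> * sqrt n)\<^sup>2 * n = (\<sigma> * n)\<^sup>2" by (simp add: power_mult_distrib power2_eq_square)
      then show ?thesis
        unfolding mean_square_form_def \<open>\<And>t. _ = a t / _\<close> power_divide sum_divide_distrib[symmetric]
          divide_divide_eq_left by simp
    qed
    then show ?thesis using \<sigma> n by (simp add: L2_set_def real_sqrt_divide)
  qed
  have "\<bar>L2_set S {1..n} - L2_set a {1..n}\<bar> \<le> L2_set (\<lambda>t. S t - a t) {1..n}" by (rule L2_set_diff_le)
  also have "\<dots> = L2_set (\<lambda>t. \<delta> * a t + R t) {1..n}"
    by (intro L2_set_cong refl) (simp add: S algebra_simps)
  also have "\<dots> \<le> L2_set (\<lambda>t. \<delta> * a t) {1..n} + L2_set R {1..n}" by (rule L2_set_triangle_ineq)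
  also have "\<dots> \<le> \<bar>\<delta>\<bar> * L2_set a {1..n} + sqrt n * (L * (\<Delta> * (K * b)))"
    unfolding L2_set_cmult using pos b0
    by (intro add_left_mono L2_set_bounded[OF Rb]) auto
  finally have "\<bar>L2_set S {1..n} - L2_set a {1..n}\<bar> / (\<sigma> * n)
      \<le> (\<bar>\<delta>\<bar> * L2_set a {1..n} + sqrt n * (L * (\<Delta> * (K * b)))) / (\<sigma> * n)"
    using \<sigma> by (intro divide_right_mono) auto
  also have "\<bar>L2_set S {1..n} - L2_set a {1..n}\<bar> / (\<sigma> * n)
      = \<bar>L2_set S {1..n} / (\<sigma> * n) - L2_set a {1..n} / (\<sigma> * n)\<bar>"
    using \<sigma> by (simp add: diff_divide_distrib[symmetric])
  also have "(\<bar>\<delta>\<bar> * L2_set a {1..n} + sqrt n * (L * (\<Delta> * (K * b)))) / (\<sigma> * n)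
      = \<bar>\<delta>\<bar> * (L2_set a {1..n} / (\<sigma> * n)) + L * K * \<Psi> / \<sigma> * \<Delta> * ((A + L2_set e {1..n}) / sqrt n)"
  proof -
    have cancel: "w * (L * (\<Delta> * (K * (\<Psi> * E)))) / (\<sigma> * (w * w)) = L * K * \<Psi> / \<sigma> * \<Delta> * (E / w)"
      if "w \<noteq> 0" for w E
      using that \<sigma> by (simp add: field_simps)
    have "sqrt n * (L * (\<Delta> * (K * b))) / (\<sigma> * (sqrt n * sqrt n)) = L * K * \<Psi> / \<sigma> * \<Delta> * ((A + L2_set e {1..n}) / sqrt n)"
      unfolding b_def by (rule cancel) (use n in simp)
    then show ?thesis by (simp add: add_divide_distrib)
  qed
  also have "\<dots> \<le> \<bar>\<delta>\<bar> * (L2_set a {1..n} / (\<sigma> * n)) + L * K * \<Psi> / \<sigma> * \<Delta> * (A + L2_set e {1..n} / sqrt n)"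
  proof (intro add_left_mono mult_left_mono)
    \<comment> \<open>Weakened so that both perturbation bounds share the factor
      \<open>A + L2_set e {1..n} / sqrt n\<close>.\<close>
    have "A / sqrt n \<le> A / 1" using n A by (intro divide_left_mono) auto
    then show "(A + L2_set e {1..n}) / sqrt n \<le> A + L2_set e {1..n} / sqrt n"
      by (simp add: add_divide_distrib)
    show "0 \<le> L * K * \<Psi> / \<sigma> * \<Delta>" using pos \<sigma> by simp
  qed
  finally show ?thesis
    unfolding F U[unfolded S_def y_def] by (simp only: \<delta>_def \<Delta>_def K_def \<Psi>_def L_def S_def[abs_def] y_def)
qed

text \<open>No cancellation as in the partial sums is used: the Euclidean norm of the filter error
  is at most the estimation error times a quantity of order sqrt n.\<close>

lemma residual_mean_square_perturbation:
  assumes V: "\<And>j. j \<le> r \<Longrightarrow> \<bar>(\<Sum>l=1..n. (real l / n) ^ j * e l) / n\<bar> \<le> V"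
  shows "\<bar>sqrt ((\<Sum>k=1..n. (fit_resid r B n (ar_filter p \<theta>c x) k)\<^sup>2) / n) - L2_set e {1..n} / sqrt n\<bar>
    \<le> (real r + 1)\<^sup>2 * \<beta> * V
      + (1 + (real r + 1)\<^sup>2 * \<beta>) * suminf (impulse_response p \<theta>) * (\<Sum>i=1..p. \<bar>\<theta> i - \<theta>c i\<bar>) * (A + L2_set e {1..n} / sqrt n)"
proof -
  define y where "y = ar_filter p \<theta>c x"
  define \<Delta> where "\<Delta> = (\<Sum>i=1..p. \<bar>\<theta> i - \<theta>c i\<bar>)"
  define \<Psi> where "\<Psi> = suminf (impulse_response p \<theta>)"
  define L where "L = 1 + (real r + 1)\<^sup>2 * \<beta>"
  define z where "z k = y k - (d k + e k)" for k
  have pos: "\<Psi> \<ge> 0" "\<Delta> \<ge> 0" "L \<ge> 0"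
    using B[of 0 0] impulse_response_partial_sums(2)[OF causal]
    by (auto simp: \<Psi>_def \<Delta>_def L_def intro!: sum_nonneg)
  have "y = (\<lambda>k. (d k + e k) + z k)" by (simp add: z_def fun_eq_iff)
  then have fit: "fit_resid r B n y k = fit_resid r B n e k + fit_resid r B n z k" for k
    by (simp only: fit_resid_add fit_d add_0_left)
  have "L2_set z {1..n} \<le> \<Delta> * L2_set (\<lambda>t. x (int t)) {1..n}"
    unfolding z_def y_def \<Delta>_def
    by (rule ar_filter_L2_diff[where g="\<lambda>t. d t + e t", OF init eq])
  also have "\<dots> \<le> \<Delta> * (\<Psi> * L2_set (\<lambda>t. d t + e t) {1..n})"
    unfolding \<Psi>_def
    by (intro mult_left_mono pos ar_solution_L2_bound[where g="\<lambda>t. d t + e t", OF causal init eq])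
  also have "L2_set (\<lambda>t. d t + e t) {1..n} \<le> L2_set d {1..n} + L2_set e {1..n}"
    by (rule L2_set_triangle_ineq)
  also have "L2_set d {1..n} \<le> sqrt n * A" by (rule L2_set_bounded[OF d A])
  finally have z: "L2_set z {1..n} \<le> \<Delta> * (\<Psi> * (sqrt n * A + L2_set e {1..n}))"
    using pos by (simp add: mult_left_mono)
  have "\<bar>L2_set (fit_resid r B n y) {1..n} - L2_set e {1..n}\<bar>
      \<le> L2_set (\<lambda>k. fit_resid r B n y k - e k) {1..n}" by (rule L2_set_diff_le)
  also have "\<dots> = L2_set (\<lambda>k. (fit_resid r B n e k - e k) + fit_resid r B n z k) {1..n}"
    by (intro L2_set_cong refl) (simp add: fit)
  also have "\<dots> \<le> L2_set (\<lambda>k. fit_resid r B n e k - e k) {1..n} + L2_set (fit_resid r B n z) {1..n}"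
    by (rule L2_set_triangle_ineq)
  also have "L2_set (\<lambda>k. fit_resid r B n e k - e k) {1..n} \<le> sqrt n * ((real r + 1)\<^sup>2 * (\<beta> * V))"
    by (rule fit_resid_diff_L2[OF V B])
  also have "L2_set (fit_resid r B n z) {1..n} \<le> L * L2_set z {1..n}"
    unfolding L_def by (rule fit_resid_L2[OF B n])
  also have "L * L2_set z {1..n} \<le> L * (\<Delta> * (\<Psi> * (sqrt n * A + L2_set e {1..n})))"
    using z pos by (intro mult_left_mono)
  finally have "\<bar>L2_set (fit_resid r B n y) {1..n} - L2_set e {1..n}\<bar> / sqrt n
      \<le> (sqrt n * ((real r + 1)\<^sup>2 * (\<beta> * V)) + L * (\<Delta> * (\<Psi> * (sqrt n * A + L2_set e {1..n})))) / sqrt n"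
    by (intro divide_right_mono) auto
  also have "\<dots> = (real r + 1)\<^sup>2 * \<beta> * V + L * \<Psi> * \<Delta> * (A + L2_set e {1..n} / sqrt n)"
    using n by (simp add: add_divide_distrib distrib_left mult_ac)
  also have "\<bar>L2_set (fit_resid r B n y) {1..n} - L2_set e {1..n}\<bar> / sqrt n
      = \<bar>sqrt ((\<Sum>k=1..n. (fit_resid r B n y k)\<^sup>2) / n) - L2_set e {1..n} / sqrt n\<bar>"
    by (simp add: L2_set_def[of "fit_resid r B n y"] real_sqrt_divide diff_divide_distrib[symmetric])
  finally show ?thesis by (simp only: y_def \<Delta>_def \<Psi>_def L_def)
qed

end

text \<open>The ratio of norms to which the perturbation bounds apply. If all residuals vanish, both
  sides are 0 by the convention for division.\<close>

lemma kpss_stat_eq: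
  assumes "\<sigma> > 0" "n > 0"
  shows "kpss_stat n E = (sqrt ((\<Sum>t=1..n. (\<Sum>k=1..t. E k)\<^sup>2) / (\<sigma>\<^sup>2 * (real n)\<^sup>2))
      * \<sigma> / sqrt ((\<Sum>k=1..n. (E k)\<^sup>2) / n))\<^sup>2"
proof -
  have nn: "(\<Sum>t=1..n. (\<Sum>k=1..t. E k)\<^sup>2) \<ge> 0" "(\<Sum>k=1..n. (E k)\<^sup>2) \<ge> 0"
    by (auto intro!: sum_nonneg)
  have "(sqrt ((\<Sum>t=1..n. (\<Sum>k=1..t. E k)\<^sup>2) / (\<sigma>\<^sup>2 * (real n)\<^sup>2)) * \<sigma> / sqrt ((\<Sum>k=1..n. (E k)\<^sup>2) / n))\<^sup>2
      = (\<Sum>t=1..n. (\<Sum>k=1..t. E k)\<^sup>2) / (\<sigma>\<^sup>2 * (real n)\<^sup>2) * \<sigma>\<^sup>2 / ((\<Sum>k=1..n. (E k)\<^sup>2) / n)"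
    using nn by (simp only: power_divide power_mult_distrib real_sqrt_pow2 divide_nonneg_nonneg
        mult_nonneg_nonneg zero_le_power2 of_nat_0_le_iff)
  also have "\<dots> = kpss_stat n E"
    using assms by (simp add: kpss_stat_def Let_def power2_eq_square)
  finally show ?thesis by simp
qed

section \<open>Moments and the law of large numbers\<close>

lemma (in prob_space) second_moment_sum:
  fixes Z :: "'i \<Rightarrow> 'a \<Rightarrow> real"
  assumes fin: "finite A" and ind: "indep_vars (\<lambda>_. borel) Z A"
    and int: "\<And>k. k \<in> A \<Longrightarrow> integrable M (\<lambda>\<omega>. (Z k \<omega>)\<^sup>2)"
    and mean: "\<And>k. k \<in> A \<Longrightarrow> expectation (Z k) = 0"
  shows "integrable M (\<lambda>\<omega>. (\<Sum>k\<in>A. Z k \<omega>)\<^sup>2)"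
    and "expectation (\<lambda>\<omega>. (\<Sum>k\<in>A. Z k \<omega>)\<^sup>2) = (\<Sum>k\<in>A. expectation (\<lambda>\<omega>. (Z k \<omega>)\<^sup>2))"
proof -
  have [measurable]: "Z k \<in> borel_measurable M" if "k \<in> A" for k
    using ind that unfolding indep_vars_def2 by simp
  have i1: "integrable M (Z k)" if "k \<in> A" for k
    by (rule square_integrable_imp_integrable) (use that int in auto)
  have prod: "integrable M (\<lambda>\<omega>. Z i \<omega> * Z j \<omega>) \<and>
      expectation (\<lambda>\<omega>. Z i \<omega> * Z j \<omega>) = (if i = j then expectation (\<lambda>\<omega>. (Z i \<omega>)\<^sup>2) else 0)"
    if ij: "i \<in> A" "j \<in> A" for i j
  proof (cases "i = j")
    case True
    then show ?thesis using int[OF ij(1)] by (simp add: power2_eq_square)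
  next
    case False
    have ind2: "indep_vars (\<lambda>_. borel) Z {i, j}"
      by (rule indep_vars_subset[OF ind]) (use ij in auto)
    have i2: "\<And>k. k \<in> {i, j} \<Longrightarrow> integrable M (Z k)" using i1 ij by auto
    from indep_vars_integrable[OF _ ind2 i2] indep_vars_lebesgue_integral[OF _ ind2 i2]
    show ?thesis using False mean[OF ij(1)] by simp
  qed
  have sq: "(\<Sum>k\<in>A. Z k \<omega>)\<^sup>2 = (\<Sum>i\<in>A. \<Sum>j\<in>A. Z i \<omega> * Z j \<omega>)" for \<omega>
    by (simp add: power2_eq_square sum_product)
  show "integrable M (\<lambda>\<omega>. (\<Sum>k\<in>A. Z k \<omega>)\<^sup>2)"
    unfolding sq using prod by (intro Bochner_Integration.integrable_sum) blast
  have "expectation (\<lambda>\<omega>. (\<Sum>k\<in>A. Z k \<omega>)\<^sup>2) = (\<Sum>i\<in>A. expectation (\<lambda>\<omega>. \<Sum>j\<in>A. Z i \<omega> * Z j \<omega>))"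
    unfolding sq using prod
    by (intro Bochner_Integration.integral_sum Bochner_Integration.integrable_sum) blast
  also have "\<dots> = (\<Sum>i\<in>A. \<Sum>j\<in>A. expectation (\<lambda>\<omega>. Z i \<omega> * Z j \<omega>))"
    using prod by (intro sum.cong refl Bochner_Integration.integral_sum) blast
  also have "\<dots> = (\<Sum>i\<in>A. \<Sum>j\<in>A. if i = j then expectation (\<lambda>\<omega>. (Z i \<omega>)\<^sup>2) else 0)"
    using prod by (intro sum.cong refl) blast
  also have "\<dots> = (\<Sum>k\<in>A. expectation (\<lambda>\<omega>. (Z k \<omega>)\<^sup>2))" using fin by simp
  finally show "expectation (\<lambda>\<omega>. (\<Sum>k\<in>A. Z k \<omega>)\<^sup>2) = (\<Sum>k\<in>A. expectation (\<lambda>\<omega>. (Z k \<omega>)\<^sup>2))" .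
qed

lemma (in prob_space) identically_distributed_expectation:
  fixes X Y :: "'a \<Rightarrow> real" and f :: "real \<Rightarrow> real"
  assumes [measurable]: "X \<in> borel_measurable M" "Y \<in> borel_measurable M" "f \<in> borel_measurable borel"
    and d: "distr M borel X = distr M borel Y"
  shows "expectation (\<lambda>\<omega>. f (X \<omega>)) = expectation (\<lambda>\<omega>. f (Y \<omega>))"
    and "integrable M (\<lambda>\<omega>. f (X \<omega>)) \<longleftrightarrow> integrable M (\<lambda>\<omega>. f (Y \<omega>))"
proof -
  have "expectation (\<lambda>\<omega>. f (X \<omega>)) = integral\<^sup>L (distr M borel X) f" by (simp add: integral_distr)
  also have "\<dots> = expectation (\<lambda>\<omega>. f (Y \<omega>))" unfolding d by (simp add: integral_distr)
  finally show "expectation (\<lambda>\<omega>. f (X \<omega>)) = expectation (\<lambda>\<omega>. f (Y \<omega>))" .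
  have "integrable M (\<lambda>\<omega>. f (X \<omega>)) \<longleftrightarrow> integrable (distr M borel X) f" by (simp add: integrable_distr_eq)
  also have "\<dots> \<longleftrightarrow> integrable M (\<lambda>\<omega>. f (Y \<omega>))" unfolding d by (simp add: integrable_distr_eq)
  finally show "integrable M (\<lambda>\<omega>. f (X \<omega>)) \<longleftrightarrow> integrable M (\<lambda>\<omega>. f (Y \<omega>))" .
qed

definition truncate_at :: "real \<Rightarrow> real \<Rightarrow> real" where
  "truncate_at c y = (if \<bar>y\<bar> \<le> c then y else 0)"

lemma truncate_at_measurable[measurable]: "truncate_at c \<in> borel_measurable borel"
  unfolding truncate_at_def[abs_def] by measurable

lemma (in prob_space) truncation_error_tendsto_0:
  fixes Y :: "'a \<Rightarrow> real"
  assumes Y: "integrable M Y"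
  shows "(\<lambda>n. expectation (\<lambda>\<omega>. \<bar>Y \<omega> - truncate_at (real n) (Y \<omega>)\<bar>)) \<longlonglongrightarrow> 0"
proof -
  note [measurable] = borel_measurable_integrable[OF Y]
  have "(\<lambda>n. expectation (\<lambda>\<omega>. \<bar>Y \<omega> - truncate_at (real n) (Y \<omega>)\<bar>)) \<longlonglongrightarrow> expectation (\<lambda>\<omega>. 0)"
  proof (rule integral_dominated_convergence[where w="\<lambda>\<omega>. \<bar>Y \<omega>\<bar>"])
    show "AE \<omega> in M. (\<lambda>n. \<bar>Y \<omega> - truncate_at (real n) (Y \<omega>)\<bar>) \<longlonglongrightarrow> 0"
    proof (intro AE_I2 tendsto_eventually)
      fix \<omega>
      obtain n0 where "\<bar>Y \<omega>\<bar> \<le> real n0" using real_arch_simple by blast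
      then show "\<forall>\<^sub>F n in sequentially. \<bar>Y \<omega> - truncate_at (real n) (Y \<omega>)\<bar> = 0"
        unfolding eventually_sequentially by (intro exI[of _ n0]) (auto simp: truncate_at_def)
    qed
  qed (use Y in \<open>auto simp: truncate_at_def\<close>)
  then show ?thesis by simp
qed

text \<open>Meant for the squares of the noise, of which only the first moment is known. Hence
  truncation: the centered truncated mean has variance of order 1/n, and the rest is small in mean
  uniformly in \<open>n\<close>.\<close>

lemma (in prob_space) weak_law_of_large_numbers:
  fixes Y :: "nat \<Rightarrow> 'a \<Rightarrow> real"
  assumes ind: "indep_vars (\<lambda>_. borel) Y {1..}"
    and id: "\<And>k. k \<ge> 1 \<Longrightarrow> distr M borel (Y k) = distr M borel (Y 1)"
    and int: "integrable M (Y 1)"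
  shows "((\<lambda>(n, \<omega>). (\<Sum>k=1..n. Y k \<omega>) / n) \<longlongrightarrow> expectation (Y 1)) (in_prob M)"
proof -
  let ?\<mu> = "expectation (Y 1)"
  have Ym[measurable]: "Y k \<in> borel_measurable M" if "k \<ge> 1" for k
    using ind that unfolding indep_vars_def2 by simp
  have Yi: "integrable M (Y k)" if "k \<ge> 1" for k
    using identically_distributed_expectation(2)[OF Ym[OF that] Ym[of 1] _ id[OF that], of "\<lambda>x. x"] int by simp
  define D where "D n \<omega> = (\<Sum>k=1..n. Y k \<omega>) / n - ?\<mu>" for n :: nat and \<omega>
  have Di: "integrable M (D n)" for n
    unfolding D_def[abs_def] using Yi
    by (intro Bochner_Integration.integrable_diff integrable_divide Bochner_Integration.integrable_sum) auto
  have "(\<lambda>n. expectation (\<lambda>\<omega>. \<bar>D n \<omega>\<bar>)) \<longlonglongrightarrow> 0"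
  proof (rule tendstoI)
    fix e :: real assume e: "e > 0"
    then have "e / 6 > 0" by simp
    with truncation_error_tendsto_0[OF int]
    have "\<forall>\<^sub>F n in sequentially. expectation (\<lambda>\<omega>. \<bar>Y 1 \<omega> - truncate_at (real n) (Y 1 \<omega>)\<bar>) < e / 6"
      by (rule order_tendstoD(2))
    then have "\<exists>c::nat. expectation (\<lambda>\<omega>. \<bar>Y 1 \<omega> - truncate_at (real c) (Y 1 \<omega>)\<bar>) < e / 6"
      by (rule eventually_happens'[OF sequentially_bot])
    \<comment> \<open>The level is fixed before \<open>n\<close> grows. Its error enters twice, for
      the summands and for their mean, hence \<open>e / 6\<close>.\<close>
    then obtain c :: nat where c: "expectation (\<lambda>\<omega>. \<bar>Y 1 \<omega> - truncate_at c (Y 1 \<omega>)\<bar>) < e / 6"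
      by (rule exE)
    define tau where "tau = expectation (\<lambda>\<omega>. \<bar>Y 1 \<omega> - truncate_at c (Y 1 \<omega>)\<bar>)"
    define m where "m = expectation (\<lambda>\<omega>. truncate_at c (Y 1 \<omega>))"
    define Z where "Z k \<omega> = truncate_at c (Y k \<omega>) - m" for k \<omega>
    have tb: "\<bar>truncate_at c y\<bar> \<le> c" for y by (simp add: truncate_at_def)
    have Ti: "integrable M (\<lambda>\<omega>. truncate_at c (Y k \<omega>))" if "k \<ge> 1" for k
      using that tb by (intro integrable_const_bound[where B="real c"]) auto
    have T2i: "integrable M (\<lambda>\<omega>. (truncate_at c (Y k \<omega>))\<^sup>2)" if "k \<ge> 1" for k
    proof -
      have "\<bar>truncate_at c y\<bar>\<^sup>2 \<le> (real c)\<^sup>2" for y using tb[of y] by (intro power_mono) auto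
      then show ?thesis using that by (intro integrable_const_bound[where B="(real c)\<^sup>2"]) auto
    qed
    have Tm: "expectation (\<lambda>\<omega>. truncate_at c (Y k \<omega>)) = m" if "k \<ge> 1" for k
      unfolding m_def
      using identically_distributed_expectation(1)[OF Ym[OF that] Ym[of 1] truncate_at_measurable id[OF that]]
      by simp
    have Zind: "indep_vars (\<lambda>_. borel) Z {1..n}" for n
    proof -
      have "indep_vars (\<lambda>_. borel) Y {1..n}" by (rule indep_vars_subset[OF ind]) auto
      from indep_vars_compose2[OF this, of "\<lambda>_ y. truncate_at c y - m" "\<lambda>_. borel"]
      show ?thesis by (simp add: Z_def[abs_def])
    qed
    have Z2: "integrable M (\<lambda>\<omega>. (Z k \<omega>)\<^sup>2)" "expectation (\<lambda>\<omega>. (Z k \<omega>)\<^sup>2) \<le> (real c)\<^sup>2" "expectation (Z k) = 0"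
      if "k \<ge> 1" for k
    proof -
      have eq: "(Z k \<omega>)\<^sup>2 = (truncate_at c (Y k \<omega>))\<^sup>2 - 2 * m * truncate_at c (Y k \<omega>) + m\<^sup>2" for \<omega>
        by (simp add: Z_def power2_eq_square algebra_simps)
      show "integrable M (\<lambda>\<omega>. (Z k \<omega>)\<^sup>2)" unfolding eq using Ti T2i that by simp
      have "expectation (\<lambda>\<omega>. (Z k \<omega>)\<^sup>2) = expectation (\<lambda>\<omega>. (truncate_at c (Y k \<omega>))\<^sup>2) - m\<^sup>2"
        unfolding eq using Ti[OF that] T2i[OF that] Tm[OF that]
        by (simp add: prob_space power2_eq_square)
      also have "\<dots> \<le> expectation (\<lambda>\<omega>. (truncate_at c (Y k \<omega>))\<^sup>2)" by simp
      also have "\<dots> \<le> expectation (\<lambda>\<omega>. (real c)\<^sup>2)"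
      proof (rule integral_mono)
        fix \<omega>
        show "(truncate_at c (Y k \<omega>))\<^sup>2 \<le> (real c)\<^sup>2"
          using tb[of "Y k \<omega>"] by (simp add: abs_le_square_iff[symmetric])
      qed (use T2i that in auto)
      finally show "expectation (\<lambda>\<omega>. (Z k \<omega>)\<^sup>2) \<le> (real c)\<^sup>2" by (simp add: prob_space)
      show "expectation (Z k) = 0"
        unfolding Z_def[abs_def] using Ti[OF that] Tm[OF that] by (simp add: prob_space)
    qed
    define S where "S n \<omega> = (\<Sum>k=1..n. Z k \<omega>)" for n :: nat and \<omega>
    have S: "integrable M (\<lambda>\<omega>. (S n \<omega>)\<^sup>2)" "expectation (\<lambda>\<omega>. (S n \<omega>)\<^sup>2) \<le> n * (real c)\<^sup>2" for n
    proof -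
      show "integrable M (\<lambda>\<omega>. (S n \<omega>)\<^sup>2)"
        unfolding S_def using Z2 by (intro second_moment_sum(1) Zind) auto
      have "expectation (\<lambda>\<omega>. (S n \<omega>)\<^sup>2) = (\<Sum>k=1..n. expectation (\<lambda>\<omega>. (Z k \<omega>)\<^sup>2))"
        unfolding S_def using Z2 by (intro second_moment_sum(2) Zind) auto
      also have "\<dots> \<le> (\<Sum>k=1..n. (real c)\<^sup>2)" using Z2 by (intro sum_mono) auto
      finally show "expectation (\<lambda>\<omega>. (S n \<omega>)\<^sup>2) \<le> n * (real c)\<^sup>2" by simp
    qed
    have Rk: "expectation (\<lambda>\<omega>. \<bar>Y k \<omega> - truncate_at c (Y k \<omega>)\<bar>) = tau" if "k \<ge> 1" for k
      unfolding tau_def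
      using identically_distributed_expectation(1)[OF Ym[OF that] Ym[of 1] _ id[OF that], of "\<lambda>y. \<bar>y - truncate_at c y\<bar>"]
      by simp
    have Rki: "integrable M (\<lambda>\<omega>. \<bar>Y k \<omega> - truncate_at c (Y k \<omega>)\<bar>)" if "k \<ge> 1" for k
      using Yi[OF that] Ti[OF that] by simp
    have mmu: "\<bar>m - ?\<mu>\<bar> \<le> tau"
    proof -
      have "?\<mu> - m = expectation (\<lambda>\<omega>. Y 1 \<omega> - truncate_at c (Y 1 \<omega>))"
        unfolding m_def using int Ti[of 1] by simp
      then have "\<bar>m - ?\<mu>\<bar> = \<bar>expectation (\<lambda>\<omega>. Y 1 \<omega> - truncate_at c (Y 1 \<omega>))\<bar>" by simp
      then show ?thesis unfolding tau_def using integral_abs_bound[of M "\<lambda>\<omega>. Y 1 \<omega> - truncate_at c (Y 1 \<omega>)"]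
        by simp
    qed
    define a where "a = e / 3"
    have a: "a > 0" using e by (simp add: a_def)
    have bound: "expectation (\<lambda>\<omega>. \<bar>D n \<omega>\<bar>) \<le> 2 * tau + a + (real c)\<^sup>2 / (a * n)" if n: "n \<ge> 1" for n
    proof -
      let ?R = "\<lambda>\<omega>. (\<Sum>k=1..n. \<bar>Y k \<omega> - truncate_at c (Y k \<omega>)\<bar>) / n"
      have Ri: "integrable M ?R" using Rki by (intro integrable_divide Bochner_Integration.integrable_sum) auto
      have pt: "\<bar>D n \<omega>\<bar> \<le> ?R \<omega> + (a + (S n \<omega>)\<^sup>2 / (a * (real n)\<^sup>2)) + tau" for \<omega>
      proof -
        have "D n \<omega> = (\<Sum>k=1..n. Y k \<omega> - truncate_at c (Y k \<omega>)) / n + S n \<omega> / n + (m - ?\<mu>)"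
          using n by (simp add: D_def S_def Z_def sum_subtractf diff_divide_distrib)
        moreover have "\<bar>(\<Sum>k=1..n. Y k \<omega> - truncate_at c (Y k \<omega>)) / n\<bar> \<le> ?R \<omega>"
          using n by (simp add: divide_right_mono sum_abs)
        moreover have "\<bar>S n \<omega> / n\<bar> \<le> a + (S n \<omega>)\<^sup>2 / (a * (real n)\<^sup>2)"
        proof -
          define z where "z = \<bar>S n \<omega> / n\<bar>"
          \<comment> \<open>A pointwise form of Chebyshev's argument: z <= a + z^2 / a, so a second
            moment bounds a first absolute moment up to \<open>a\<close>, a third of the
            tolerance.\<close>
          have "0 \<le> (a - z)\<^sup>2 + a * z" using a by (simp add: z_def)
          also have "\<dots> \<le> a\<^sup>2 + z\<^sup>2 - a * z" by (simp add: power2_eq_square algebra_simps)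
          finally have "a * z \<le> a * (a + z\<^sup>2 / a)" using a by (simp add: power2_eq_square algebra_simps)
          then have "z \<le> a + z\<^sup>2 / a" using a by simp
          then show ?thesis by (simp add: z_def power_divide mult.commute)
        qed
        ultimately show ?thesis using mmu by linarith
      qed
      have "expectation (\<lambda>\<omega>. \<bar>D n \<omega>\<bar>) \<le> expectation (\<lambda>\<omega>. ?R \<omega> + (a + (S n \<omega>)\<^sup>2 / (a * (real n)\<^sup>2)) + tau)"
        using pt Di Ri S(1) by (intro integral_mono) auto
      also have "\<dots> = expectation ?R + (a + expectation (\<lambda>\<omega>. (S n \<omega>)\<^sup>2) / (a * (real n)\<^sup>2)) + tau"
        using Ri S(1) by (simp add: prob_space)
      also have "expectation ?R = tau"
        using n Rki Rk by (simp add: Bochner_Integration.integral_sum)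
      also have "expectation (\<lambda>\<omega>. (S n \<omega>)\<^sup>2) / (a * (real n)\<^sup>2) \<le> (n * (real c)\<^sup>2) / (a * (real n)\<^sup>2)"
        using S(2) a by (intro divide_right_mono) auto
      also have "(n * (real c)\<^sup>2) / (a * (real n)\<^sup>2) = (real c)\<^sup>2 / (a * n)"
        using n by (simp add: power2_eq_square)
      finally show ?thesis by simp
    qed
    have "(\<lambda>n::nat. (real c)\<^sup>2 / a / n) \<longlonglongrightarrow> 0" by (rule lim_const_over_n)
    from order_tendstoD(2)[OF this, of "e / 3"] e
    have "\<forall>\<^sub>F n::nat in sequentially. (real c)\<^sup>2 / a / n < e / 3" by simp
    moreover have "\<forall>\<^sub>F n::nat in sequentially. n \<ge> 1" by (rule eventually_ge_at_top)
    ultimately show "\<forall>\<^sub>F n in sequentially. dist (expectation (\<lambda>\<omega>. \<bar>D n \<omega>\<bar>)) 0 < e"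
    proof eventually_elim
      case (elim n)
      have "expectation (\<lambda>\<omega>. \<bar>D n \<omega>\<bar>) \<le> 2 * tau + a + (real c)\<^sup>2 / (a * n)" using bound elim by simp
      also have "\<dots> < 2 * (e / 6) + e / 3 + e / 3" using elim c by (simp add: tau_def a_def)
      finally show ?case by (simp add: integral_nonneg_AE)
    qed
  qed
  from tendsto_in_prob_expectation[OF _ this] Di
  have "((\<lambda>(n, \<omega>). D n \<omega>) \<longlongrightarrow> 0) (in_prob M)" by simp
  from tendsto_add[OF this tendsto_const[of ?\<mu>]]
  show ?thesis by (simp add: D_def case_prod_beta')
qed

section \<open>The limit of the quadratic form\<close>

context prob_space
begin

text \<open>Serves a shift of indices: Wiener increments are numbered from 0, the innovations from
  1.\<close>

lemma indep_vars_reindex: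
  assumes inj: "inj_on f I" and ind: "indep_vars M' X (f ` I)"
  shows "indep_vars (\<lambda>i. M' (f i)) (\<lambda>i. X (f i)) I"
  unfolding indep_vars_def2
proof
  show "\<forall>i\<in>I. random_variable (M' (f i)) (X (f i))"
    using ind unfolding indep_vars_def2 by blast
  define F where "F i = {X i -` A \<inter> space M | A. A \<in> sets (M' i)}" for i
  have F: "indep_sets F (f ` I)" using ind unfolding indep_vars_def2 F_def[abs_def] by blast
  have "indep_sets (\<lambda>i. F (f i)) I"
  proof (rule indep_setsI)
    show "F (f i) \<subseteq> events" if "i \<in> I" for i using F that unfolding indep_sets_def by blast
    fix A J assume J: "J \<noteq> {}" "J \<subseteq> I" "finite J" and A: "\<forall>j\<in>J. A j \<in> F (f j)"
    define A' where "A' k = A (the_inv_into I f k)" for k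
    have A': "A' (f j) = A j" if "j \<in> J" for j
      using the_inv_into_f_f[OF inj] J that by (auto simp: A'_def)
    have "prob (\<Inter>k\<in>f ` J. A' k) = (\<Prod>k\<in>f ` J. prob (A' k))"
      using J A A' by (intro indep_setsD[OF F]) auto
    also have "(\<Inter>k\<in>f ` J. A' k) = (\<Inter>j\<in>J. A j)" using A' by auto
    also have "(\<Prod>k\<in>f ` J. prob (A' k)) = (\<Prod>j\<in>J. prob (A j))"
      using A' inj_on_subset[OF inj J(2)] by (simp add: prod.reindex)
    finally show "prob (\<Inter>j\<in>J. A j) = (\<Prod>j\<in>J. prob (A j))" .
  qed
  then show "indep_sets (\<lambda>i. {X (f i) -` A \<inter> space M | A. A \<in> sets (M' (f i))}) I"
    by (simp only: F_def)
qed

lemma strong_white_noise_facts: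
  assumes wn: "strong_white_noise e v" and t: "t \<ge> 1"
  shows "e t \<in> borel_measurable M" "distr M borel (e t) = distr M borel (e 1)"
    "integrable M (\<lambda>\<omega>. (e t \<omega>)\<^sup>2)" "expectation (e t) = 0" "expectation (\<lambda>\<omega>. (e t \<omega>)\<^sup>2) = v"
proof -
  show m: "e t \<in> borel_measurable M"
    using wn t unfolding strong_white_noise_def indep_vars_def2 by simp
  show "distr M borel (e t) = distr M borel (e 1)" "integrable M (\<lambda>\<omega>. (e t \<omega>)\<^sup>2)"
    and mean: "expectation (e t) = 0"
    using wn t unfolding strong_white_noise_def by blast+
  have "variance (e t) = v" using wn t unfolding strong_white_noise_def by blast
  then show "expectation (\<lambda>\<omega>. (e t \<omega>)\<^sup>2) = v" by (simp only: mean diff_0_right)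
qed

lemma white_noise_weighted_sum:
  assumes wn: "strong_white_noise e v"
  shows "integrable M (\<lambda>\<omega>. (\<Sum>k=1..n. c k * e k \<omega>)\<^sup>2)"
    and "expectation (\<lambda>\<omega>. (\<Sum>k=1..n. c k * e k \<omega>)\<^sup>2) = (\<Sum>k=1..n. (c k)\<^sup>2) * v"
proof -
  have "indep_vars (\<lambda>_. borel) e {1..n}"
    using wn unfolding strong_white_noise_def by (auto intro: indep_vars_subset)
  from indep_vars_compose2[OF this, of "\<lambda>k y. c k * y" "\<lambda>_. borel"]
  have ind: "indep_vars (\<lambda>_. borel) (\<lambda>k \<omega>. c k * e k \<omega>) {1..n}" by simp
  have int: "integrable M (\<lambda>\<omega>. (c k * e k \<omega>)\<^sup>2)" if "k \<in> {1..n}" for k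
    using strong_white_noise_facts(3)[OF wn] that by (simp add: power_mult_distrib)
  have mean: "expectation (\<lambda>\<omega>. c k * e k \<omega>) = 0" if "k \<in> {1..n}" for k
    using strong_white_noise_facts(4)[OF wn, of k] that by simp
  show "integrable M (\<lambda>\<omega>. (\<Sum>k=1..n. c k * e k \<omega>)\<^sup>2)"
    by (rule second_moment_sum(1)[OF _ ind int mean]) auto
  have "expectation (\<lambda>\<omega>. (\<Sum>k=1..n. c k * e k \<omega>)\<^sup>2) = (\<Sum>k=1..n. expectation (\<lambda>\<omega>. (c k * e k \<omega>)\<^sup>2))"
    by (rule second_moment_sum(2)[OF _ ind int mean]) auto
  also have "\<dots> = (\<Sum>k=1..n. (c k)\<^sup>2 * v)"
    using strong_white_noise_facts(5)[OF wn] by (intro sum.cong) (auto simp: power_mult_distrib)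
  finally show "expectation (\<lambda>\<omega>. (\<Sum>k=1..n. c k * e k \<omega>)\<^sup>2) = (\<Sum>k=1..n. (c k)\<^sup>2) * v"
    by (simp add: sum_distrib_right)
qed

lemma white_noise_mean_square_tendsto:
  assumes wn: "strong_white_noise e v"
  shows "((\<lambda>(n, \<omega>). L2_set (\<lambda>k. e k \<omega>) {1..n} / sqrt n) \<longlongrightarrow> sqrt v) (in_prob M)"
proof -
  note facts = strong_white_noise_facts[OF wn]
  have "indep_vars (\<lambda>_. borel) e {1..}" using wn unfolding strong_white_noise_def by blast
  from indep_vars_compose2[OF this, of "\<lambda>k y. y\<^sup>2" "\<lambda>_. borel"]
  have ind: "indep_vars (\<lambda>_. borel) (\<lambda>k \<omega>. (e k \<omega>)\<^sup>2) {1..}" by simp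
  have sq: "distr M borel (\<lambda>\<omega>. (e k \<omega>)\<^sup>2) = distr (distr M borel (e k)) borel (\<lambda>y. y\<^sup>2)" if "k \<ge> 1" for k
    using facts(1)[OF that] by (subst distr_distr) (auto simp: comp_def)
  have "((\<lambda>(n, \<omega>). (\<Sum>k=1..n. (e k \<omega>)\<^sup>2) / n) \<longlongrightarrow> expectation (\<lambda>\<omega>. (e 1 \<omega>)\<^sup>2)) (in_prob M)"
  proof (rule weak_law_of_large_numbers[OF ind])
    show "distr M borel (\<lambda>\<omega>. (e k \<omega>)\<^sup>2) = distr M borel (\<lambda>\<omega>. (e 1 \<omega>)\<^sup>2)" if "k \<ge> 1" for k
      using sq[OF that] sq[of 1] facts(2)[OF that] by simp
    show "integrable M (\<lambda>\<omega>. (e 1 \<omega>)\<^sup>2)" by (rule facts(3)) simp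
  qed
  then have "((\<lambda>(n, \<omega>). (\<Sum>k=1..n. (e k \<omega>)\<^sup>2) / n) \<longlongrightarrow> v) (in_prob M)"
    using facts(5)[of 1] by simp
  from tendsto_real_sqrt[OF this] show ?thesis
    by (simp add: L2_set_def real_sqrt_divide case_prod_beta')
qed

lemma tendsto_in_prob_second_moment:
  fixes Y :: "nat \<Rightarrow> 'a \<Rightarrow> real"
  assumes "\<And>n. integrable M (\<lambda>\<omega>. (Y n \<omega>)\<^sup>2)" and "(\<lambda>n. expectation (\<lambda>\<omega>. (Y n \<omega>)\<^sup>2)) \<longlonglongrightarrow> 0"
  shows "((\<lambda>(n, \<omega>). \<bar>Y n \<omega>\<bar>) \<longlongrightarrow> 0) (in_prob M)"
proof -
  have "((\<lambda>(n, \<omega>). (Y n \<omega>)\<^sup>2) \<longlongrightarrow> 0) (in_prob M)"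
    using assms by (intro tendsto_in_prob_expectation) simp_all
  from tendsto_real_sqrt[OF this] show ?thesis by (simp add: case_prod_beta')
qed

text \<open>Orthogonality and weights at most 1 bound the second moment by
  \<open>v / n\<close>.\<close>

lemma white_noise_weighted_mean_tendsto:
  assumes wn: "strong_white_noise e v"
  shows "((\<lambda>(n, \<omega>). \<bar>(\<Sum>l=1..n. (real l / n) ^ j * e l \<omega>) / n\<bar>) \<longlongrightarrow> 0) (in_prob M)"
proof (rule tendsto_in_prob_second_moment)
  fix n :: nat
  show "integrable M (\<lambda>\<omega>. ((\<Sum>l=1..n. (real l / n) ^ j * e l \<omega>) / n)\<^sup>2)"
    using white_noise_weighted_sum(1)[OF wn, of "\<lambda>l. (real l / n) ^ j" n] by (simp add: power_divide)
next
  have v: "v \<ge> 0"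
  proof -
    have v_eq: "v = expectation (\<lambda>\<omega>. (e 1 \<omega>)\<^sup>2)"
      by (rule strong_white_noise_facts(5)[OF wn, symmetric]) simp
    show ?thesis unfolding v_eq by (rule Bochner_Integration.integral_nonneg) simp
  qed
  have "expectation (\<lambda>\<omega>. ((\<Sum>l=1..n. (real l / n) ^ j * e l \<omega>) / n)\<^sup>2) \<le> v / n" for n :: nat
  proof (cases "n = 0")
    case False
    have "expectation (\<lambda>\<omega>. ((\<Sum>l=1..n. (real l / n) ^ j * e l \<omega>) / n)\<^sup>2)
        = (\<Sum>l=1..n. ((real l / n) ^ j)\<^sup>2) * v / (real n)\<^sup>2"
      using white_noise_weighted_sum(2)[OF wn, of "\<lambda>l. (real l / n) ^ j" n] by (simp add: power_divide)
    also have "\<dots> \<le> (\<Sum>l=1..n. 1) * v / (real n)\<^sup>2"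
      using v False by (intro divide_right_mono mult_right_mono sum_mono power_le_one) auto
    also have "\<dots> = v / n" using False by (simp add: power2_eq_square)
    finally show ?thesis .
  qed simp
  then have "\<forall>\<^sub>F n in sequentially. norm (expectation (\<lambda>\<omega>. ((\<Sum>l=1..n. (real l / n) ^ j * e l \<omega>) / n)\<^sup>2)) \<le> v / real n"
    by (intro always_eventually allI) simp
  from Lim_null_comparison[OF this lim_const_over_n]
  show "(\<lambda>n. expectation (\<lambda>\<omega>. ((\<Sum>l=1..n. (real l / n) ^ j * e l \<omega>) / n)\<^sup>2)) \<longlonglongrightarrow> 0" .
qed

text \<open>Boundedness in mean, the tightness that permits products with factors tending to 0 in
  probability.\<close>

lemma mean_square_form_expectation:
  assumes wn: "strong_white_noise e (\<sigma>\<^sup>2)" and \<sigma>: "\<sigma> > 0" and n: "n > 0"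
    and c: "\<And>t k. t \<in> {1..n} \<Longrightarrow> k \<in> {1..n} \<Longrightarrow> \<bar>c t k\<bar> \<le> C"
  shows "integrable M (\<lambda>\<omega>. mean_square_form c n (\<lambda>k. e k \<omega> / (\<sigma> * sqrt n)))"
    and "expectation (\<lambda>\<omega>. mean_square_form c n (\<lambda>k. e k \<omega> / (\<sigma> * sqrt n))) \<le> C\<^sup>2"
proof -
  let ?s = "\<lambda>t \<omega>. (\<Sum>k=1..n. c t k / (\<sigma> * sqrt n) * e k \<omega>)\<^sup>2"
  have eq: "mean_square_form c n (\<lambda>k. e k \<omega> / (\<sigma> * sqrt n)) = (\<Sum>t=1..n. ?s t \<omega>) / n" for \<omega>
    by (simp add: mean_square_form_def)
  note w = white_noise_weighted_sum[OF wn]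
  show "integrable M (\<lambda>\<omega>. mean_square_form c n (\<lambda>k. e k \<omega> / (\<sigma> * sqrt n)))"
    unfolding eq by (intro integrable_divide Bochner_Integration.integrable_sum w(1))
  have "expectation (?s t) \<le> C\<^sup>2" if t: "t \<in> {1..n}" for t
  proof -
    have "expectation (?s t) = (\<Sum>k=1..n. (c t k / (\<sigma> * sqrt n))\<^sup>2) * \<sigma>\<^sup>2" by (rule w(2))
    also have "(\<Sum>k=1..n. (c t k / (\<sigma> * sqrt n))\<^sup>2) \<le> (\<Sum>k=1..n. C\<^sup>2 / (\<sigma>\<^sup>2 * n))"
    proof (rule sum_mono)
      fix k assume "k \<in> {1..n}"
      from power_mono[OF c[OF t this] abs_ge_zero, of 2]
      show "(c t k / (\<sigma> * sqrt n))\<^sup>2 \<le> C\<^sup>2 / (\<sigma>\<^sup>2 * n)"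
        by (simp add: power_divide power_mult_distrib divide_right_mono)
    qed
    also have "(\<Sum>k=1..n. C\<^sup>2 / (\<sigma>\<^sup>2 * n)) * \<sigma>\<^sup>2 = C\<^sup>2" using n \<sigma> by simp
    finally show ?thesis using \<sigma> by (simp add: mult_right_mono)
  qed
  then have "(\<Sum>t=1..n. expectation (?s t)) \<le> (\<Sum>t=1..n. C\<^sup>2)" by (rule sum_mono)
  moreover have "expectation (\<lambda>\<omega>. (\<Sum>t=1..n. ?s t \<omega>) / n) = (\<Sum>t=1..n. expectation (?s t)) / n"
    unfolding integral_divide_zero
    by (subst Bochner_Integration.integral_sum[OF w(1)]) (rule refl)
  ultimately show "expectation (\<lambda>\<omega>. mean_square_form c n (\<lambda>k. e k \<omega> / (\<sigma> * sqrt n))) \<le> C\<^sup>2"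
    unfolding eq using n by (simp add: divide_simps mult.commute)
qed

end

text \<open>Two comparisons: for fixed \<open>n\<close> the noise is exchanged for Wiener
  increments, and along each Wiener path the form converges to \<open>G\<close>. Exponentials
  bounded by 1 carry the latter over to expectations.\<close>

lemma mean_square_form_laplace_limit:
  fixes b :: "nat \<Rightarrow> nat \<Rightarrow> real"
  assumes M: "prob_space M" and N: "prob_space N"
    and W: "prob_space.standard_Wiener N W"
    and wn: "prob_space.strong_white_noise M e (\<sigma>\<^sup>2)" and \<sigma>: "\<sigma> > 0" and s: "s \<ge> 0"
    and B: "\<And>i j. i \<le> r \<Longrightarrow> j \<le> r \<Longrightarrow> (\<lambda>n. B n i j) \<longlonglongrightarrow> b i j"
    and \<beta>: "\<forall>\<^sub>F n in sequentially. \<forall>i\<le>r. \<forall>j\<le>r. \<bar>B n i j\<bar> \<le> \<beta>"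
  defines "G \<equiv> \<lambda>\<omega>. integral {0..1} (\<lambda>t. (W t \<omega> - (\<Sum>i\<le>r. \<Sum>j\<le>r. t ^ Suc i / Suc i * b i j *
          (W 1 \<omega> - integral {0..1} (\<lambda>u. W u \<omega> * (real j * u ^ (j - 1))))))\<^sup>2)"
  shows "G \<in> borel_measurable N"
    and "(\<lambda>n. \<integral>\<omega>. exp (- s * mean_square_form (detrend_coeff r (B n) n) n (\<lambda>k. e k \<omega> / (\<sigma> * sqrt n))) \<partial>M)
      \<longlonglongrightarrow> (\<integral>\<omega>. exp (- s * G \<omega>) \<partial>N)"
    and "\<And>\<omega>. \<omega> \<in> space N \<Longrightarrow> G \<omega> \<ge> 0"
proof -
  interpret M: prob_space M by fact
  interpret N: prob_space N by fact
  note wnf = M.strong_white_noise_facts[OF wn]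
  have Wm: "W t \<in> borel_measurable N" if "t \<in> {0..1}" for t
    using W that unfolding N.standard_Wiener_def by blast
  have Wc: "W 0 \<omega> = 0" "continuous_on {0..1} (\<lambda>t. W t \<omega>)" if "\<omega> \<in> space N" for \<omega>
    using W that unfolding N.standard_Wiener_def by blast+
  have Wn: "distributed N lborel (\<lambda>\<omega>. W t \<omega> - W u \<omega>) (normal_density 0 (sqrt (t - u)))"
    if "0 \<le> u" "u < t" "t \<le> 1" for u t
    using W that unfolding N.standard_Wiener_def by blast
  have Wi: "N.indep_vars (\<lambda>_. borel) (\<lambda>i \<omega>. W (\<tau> (Suc i)) \<omega> - W (\<tau> i) \<omega>) {..<n}"
    if "0 \<le> \<tau> 0" "\<forall>i<n. \<tau> i < \<tau> (Suc i)" "\<tau> n \<le> 1" for n and \<tau> :: "nat \<Rightarrow> real"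
    using W that unfolding N.standard_Wiener_def by blast
  define D where "D n k \<omega> = W (real k / n) \<omega> - W ((real k - 1) / n) \<omega>" for n k :: nat and \<omega>
  define H where "H n \<omega> = mean_square_form (detrend_coeff r (B n) n) n (\<lambda>k. D n k \<omega>)" for n \<omega>
  have [measurable]: "D n k \<in> borel_measurable N" if "k \<in> {1..n}" for n k
    unfolding D_def using that
    by (intro borel_measurable_diff Wm) (auto simp: divide_simps)
  have Hm[measurable]: "H n \<in> borel_measurable N" for n
    unfolding H_def mean_square_form_def by measurable
  have HG: "(\<lambda>n. H n \<omega>) \<longlonglongrightarrow> G \<omega>" if "\<omega> \<in> space N" for \<omega>
    unfolding H_def G_def D_def
    by (rule mean_square_form_increments_tendsto[where f="\<lambda>t. W t \<omega>", OF Wc(2)[OF that] Wc(1)[OF that] B])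
  \<comment> \<open>Measurability of the path integral comes from its approximation by functions of
    finitely many values of \<open>W\<close>.\<close>
  show Gm: "G \<in> borel_measurable N" by (rule borel_measurable_LIMSEQ_metric[OF Hm HG])
  have H0: "H n \<omega> \<ge> 0" for n \<omega> unfolding H_def by (rule mean_square_form_nonneg)
  show "G \<omega> \<ge> 0" if "\<omega> \<in> space N" for \<omega>
    by (rule LIMSEQ_le_const[OF HG[OF that]]) (use H0 in auto)
  have "(\<lambda>n. \<integral>\<omega>. exp (- s * H n \<omega>) \<partial>N) \<longlonglongrightarrow> (\<integral>\<omega>. exp (- s * G \<omega>) \<partial>N)"
  proof (rule integral_dominated_convergence[where w="\<lambda>_. 1"])
    show "AE \<omega> in N. (\<lambda>n. exp (- s * H n \<omega>)) \<longlonglongrightarrow> exp (- s * G \<omega>)"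
      by (intro AE_I2 tendsto_intros HG)
    show "AE \<omega> in N. norm (exp (- s * H n \<omega>)) \<le> 1" for n
      using H0 s by (intro AE_I2) simp
  qed (use Gm in auto)
  note lim_H = this
  have "(\<lambda>n. (\<integral>\<omega>. exp (- s * mean_square_form (detrend_coeff r (B n) n) n (\<lambda>k. e k \<omega> / (\<sigma> * sqrt n))) \<partial>M)
      - (\<integral>\<omega>. exp (- s * H n \<omega>) \<partial>N)) \<longlonglongrightarrow> 0"
  proof -
    define C where "C = 1 + (real r + 1)\<^sup>2 * \<beta>"
    define K where "K = 8 + 18 * (s * C\<^sup>2) + 28 * (s * C\<^sup>2)\<^sup>2"
    define Y where "Y \<omega> = e 1 \<omega> / \<sigma>" for \<omega>
    \<comment> \<open>Standard normal; an increment over a mesh of \<open>1 / n\<close> has the law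
      of \<open>Y' / sqrt n\<close>.\<close>
    define Y' where "Y' \<omega> = W 1 \<omega> - W 0 \<omega>" for \<omega>
    have Y: "Y \<in> borel_measurable M" "integrable M (\<lambda>\<omega>. (Y \<omega>)\<^sup>2)" "integral\<^sup>L M Y = 0"
      "integral\<^sup>L M (\<lambda>\<omega>. (Y \<omega>)\<^sup>2) = 1"
      using wnf[of 1] \<sigma> by (auto simp: Y_def[abs_def] power_divide)
    have normal: "distributed N lborel Y' (normal_density 0 1)"
      using Wn[of 0 1] by (simp add: Y'_def[abs_def])
    have Y'm: "Y' \<in> borel_measurable N"
      unfolding Y'_def by (intro borel_measurable_diff Wm) auto
    have Y': "Y' \<in> borel_measurable N" "integrable N (\<lambda>\<omega>. (Y' \<omega>)\<^sup>2)" "integral\<^sup>L N Y' = 0"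
      "integral\<^sup>L N (\<lambda>\<omega>. (Y' \<omega>)\<^sup>2) = 1"
    proof -
      show "Y' \<in> borel_measurable N" by (rule Y'm)
      show 0: "integral\<^sup>L N Y' = 0" using N.normal_distributed_expectation[OF _ normal] by simp
      show 1: "integral\<^sup>L N (\<lambda>\<omega>. (Y' \<omega>)\<^sup>2) = 1" using N.normal_distributed_variance[OF _ normal] 0 by simp
      \<comment> \<open>A nonzero integral certifies integrability, because a function that is not
        integrable has integral 0.\<close>
      show "integrable N (\<lambda>\<omega>. (Y' \<omega>)\<^sup>2)"
        using 1 not_integrable_integral_eq[of N "\<lambda>\<omega>. (Y' \<omega>)\<^sup>2"] by (auto simp del: integral_0)
    qed
    define err where "err n = (\<integral>\<omega>. min ((Y \<omega>)\<^sup>2) (\<bar>Y \<omega>\<bar> ^ 3 / sqrt (real n)) \<partial>M)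
        + (\<integral>\<omega>. min ((Y' \<omega>)\<^sup>2) (\<bar>Y' \<omega>\<bar> ^ 3 / sqrt (real n)) \<partial>N)" for n :: nat
    have "err \<longlonglongrightarrow> 0 + 0"
      unfolding err_def
      by (intro tendsto_add M.truncated_moment_tendsto_0 N.truncated_moment_tendsto_0 Y Y')
    then have "(\<lambda>n. K * err n) \<longlonglongrightarrow> K * (0 + 0)" by (intro tendsto_mult tendsto_const)
    then have lim: "(\<lambda>n. K * err n) \<longlonglongrightarrow> 0" by simp
    have "\<forall>\<^sub>F n in sequentially. n > 0" by (rule eventually_gt_at_top)
    with \<beta> have "\<forall>\<^sub>F n in sequentially. norm ((\<integral>\<omega>. exp (- s * mean_square_form (detrend_coeff r (B n) n) n (\<lambda>k. e k \<omega> / (\<sigma> * sqrt n))) \<partial>M)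
        - (\<integral>\<omega>. exp (- s * H n \<omega>) \<partial>N)) \<le> K * err n"
    proof eventually_elim
      case (elim n)
      then have n: "n > 0" by simp
      have c: "\<bar>detrend_coeff r (B n) n t k\<bar> \<le> C" if "t \<in> {1..n}" "k \<in> {1..n}" for t k
        unfolding C_def using elim by (intro detrend_coeff_bound[OF that]) auto
      have indX: "M.indep_vars (\<lambda>_. borel) (\<lambda>k \<omega>. e k \<omega> / (\<sigma> * sqrt n)) {1..n}"
      proof -
        have "M.indep_vars (\<lambda>_. borel) e {1..n}"
          using wn unfolding M.strong_white_noise_def by (auto intro: M.indep_vars_subset)
        from M.indep_vars_compose2[OF this, of "\<lambda>k y. y / (\<sigma> * sqrt n)" "\<lambda>_. borel"]
        show ?thesis by simp
      qed
      have dX: "distr M borel (\<lambda>\<omega>. e k \<omega> / (\<sigma> * sqrt n)) = distr M borel (\<lambda>\<omega>. Y \<omega> / sqrt n)"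
        if "k \<in> {1..n}" for k
      proof -
        have sc: "distr M borel (\<lambda>\<omega>. e k \<omega> / (\<sigma> * sqrt n)) = distr (distr M borel (e k)) borel (\<lambda>y. y / (\<sigma> * sqrt n))"
          if "k \<ge> 1" for k
          using wnf(1)[OF that] by (subst distr_distr) (auto simp: comp_def)
        show ?thesis using sc[of k] sc[of 1] wnf(2)[of k] that by (simp add: Y_def)
      qed
      have indX': "N.indep_vars (\<lambda>_. borel) (D n) {1..n}"
      proof -
        have "N.indep_vars (\<lambda>_. borel) (\<lambda>i \<omega>. W (real (Suc i) / n) \<omega> - W (real i / n) \<omega>) {..<n}"
          using n by (intro Wi[of "\<lambda>i. real i / n" n]) (auto simp: divide_strict_right_mono)
        moreover have "{..<n} = (\<lambda>k. k - 1) ` {1..n}"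
        proof -
          have "{..<n} \<subseteq> (\<lambda>k. k - 1) ` {1..n}"
            by (auto intro!: image_eqI[where x="Suc _"])
          then show ?thesis by auto
        qed
        ultimately have "N.indep_vars (\<lambda>_. borel) (\<lambda>i \<omega>. W (real (Suc i) / n) \<omega> - W (real i / n) \<omega>) ((\<lambda>k. k - 1) ` {1..n})"
          by simp
        moreover have "inj_on (\<lambda>k. k - 1) {1..n}" by (auto simp: inj_on_def)
        ultimately have "N.indep_vars (\<lambda>_. borel) (\<lambda>k \<omega>. W (real (Suc (k - 1)) / n) \<omega> - W (real (k - 1) / n) \<omega>) {1..n}"
          by (rule N.indep_vars_reindex[rotated])
        also have "?this \<longleftrightarrow> ?thesis"
          by (intro N.indep_vars_cong refl) (auto simp: D_def[abs_def] of_nat_diff)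
        finally show ?thesis .
      qed
      have dX': "distr N borel (D n k) = distr N borel (\<lambda>\<omega>. Y' \<omega> / sqrt n)" if k: "k \<in> {1..n}" for k
      proof -
        have len: "real k / n - (real k - 1) / n = 1 / n" by (simp add: diff_divide_distrib[symmetric])
        have "distributed N lborel (D n k) (normal_density 0 (sqrt (1 / n)))"
          using Wn[of "(real k - 1) / n" "real k / n"] k n len by (simp add: D_def[abs_def] divide_simps)
        moreover have "distributed N lborel (\<lambda>\<omega>. Y' \<omega> / sqrt n) (normal_density 0 (sqrt (1 / n)))"
          using N.normal_density_affine[OF normal, of "1 / sqrt n" 0] n by (simp add: real_sqrt_divide)
        ultimately have "distr N lborel (D n k) = distr N lborel (\<lambda>\<omega>. Y' \<omega> / sqrt n)"
          by (simp add: distributed_def)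
        \<comment> \<open>The sigma-algebras agree; \<open>standard_Wiener\<close> speaks of
          \<open>lborel\<close>, the exchange of \<open>borel\<close>.\<close>
        moreover have "distr N borel f = distr N lborel f" for f :: "_ \<Rightarrow> real"
          by (rule distr_cong) auto
        ultimately show ?thesis by simp
      qed
      show ?case
        unfolding real_norm_def H_def err_def K_def
        by (rule mean_square_form_swap[OF M N n s c indX dX Y indX' dX' Y'])
    qed
    then show ?thesis using lim by (rule Lim_null_comparison)
  qed
  from tendsto_add[OF this lim_H]
  show "(\<lambda>n. \<integral>\<omega>. exp (- s * mean_square_form (detrend_coeff r (B n) n) n (\<lambda>k. e k \<omega> / (\<sigma> * sqrt n))) \<partial>M)
      \<longlonglongrightarrow> (\<integral>\<omega>. exp (- s * G \<omega>) \<partial>N)"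
    by (simp only: diff_add_cancel add_0_left)
qed

section \<open>The limit of the statistic\<close>

text \<open>A square with zero expectation vanishes almost surely, and countably many times share
  one null set.\<close>

lemma (in prob_space) white_noise_variance_0:
  assumes wn: "strong_white_noise h 0"
  shows "AE \<omega> in M. \<forall>t\<ge>1. h t \<omega> = 0"
proof -
  have "AE \<omega> in M. t \<ge> 1 \<longrightarrow> h t \<omega> = 0" for t
  proof (cases "t \<ge> 1")
    case True
    note facts = strong_white_noise_facts[OF wn True]
    from integral_nonneg_eq_0_iff_AE[OF facts(3)] facts(5)
    have "AE \<omega> in M. (h t \<omega>)\<^sup>2 = 0" by simp
    then show ?thesis by eventually_elim simp
  qed simp
  then show ?thesis by (simp add: AE_all_countable)
qed

lemma integrated_noise_eq_0: "(\<And>t. t \<ge> 1 \<Longrightarrow> h t \<omega> = 0) \<Longrightarrow> integrated_noise \<rho> h t \<omega> = 0"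
  by (induction t) simp_all

text \<open>Square roots turn the mean squares into norms, for which the perturbation bounds are linear.\<close>
lemma (in prob_space) studentized_diff_tendsto_0:
  fixes u q m F V \<Delta> \<delta> K :: "nat \<Rightarrow> 'a \<Rightarrow> real"
  assumes \<sigma>: "\<sigma> > 0"
    and \<Delta>: "((\<lambda>(n, \<omega>). \<Delta> n \<omega>) \<longlongrightarrow> 0) (in_prob M)"
    and \<delta>: "((\<lambda>(n, \<omega>). \<delta> n \<omega>) \<longlongrightarrow> 0) (in_prob M)"
    and m: "((\<lambda>(n, \<omega>). m n \<omega>) \<longlongrightarrow> \<sigma>) (in_prob M)"
    and V: "((\<lambda>(n, \<omega>). V n \<omega>) \<longlongrightarrow> 0) (in_prob M)"
    and F: "\<And>n \<omega>. F n \<omega> \<ge> 0" "\<forall>\<^sub>F n in sequentially. integrable M (F n) \<and> expectation (F n) \<le> C"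
    and u: "eventually (\<lambda>(n, \<omega>). \<bar>u n \<omega> - sqrt (F n \<omega>)\<bar>
              \<le> \<bar>\<delta> n \<omega>\<bar> * sqrt (F n \<omega>) + C1 * \<Delta> n \<omega> * (A + m n \<omega>)) (in_prob M)"
    and q: "eventually (\<lambda>(n, \<omega>). \<bar>q n \<omega> - m n \<omega>\<bar>
              \<le> C3 * V n \<omega> + C2 * \<Delta> n \<omega> * (A + m n \<omega>)) (in_prob M)"
    and K: "eventually (\<lambda>(n, \<omega>). K n \<omega> = (u n \<omega> * \<sigma> / q n \<omega>)\<^sup>2) (in_prob M)"
  shows "((\<lambda>(n, \<omega>). K n \<omega> - F n \<omega>) \<longlongrightarrow> 0) (in_prob M)"
proof -
  let ?f = "\<lambda>n \<omega>. sqrt (F n \<omega>)"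
  have f_bdd: "\<forall>\<^sub>F n in sequentially. integrable M (?f n) \<and> expectation (\<lambda>\<omega>. \<bar>?f n \<omega>\<bar>) \<le> 1 + C"
    using F(2)
  proof eventually_elim
    case (elim n)
    note [measurable] = borel_measurable_integrable[OF conjunct1[OF elim]]
    \<comment> \<open>A linear majorant carries the bound in mean over from \<open>F n\<close> to
      its square root.\<close>
    have le: "sqrt y \<le> 1 + y" if "y \<ge> 0" for y :: real
    proof (rule real_le_lsqrt)
      show "y \<le> (1 + y)\<^sup>2" using that by (simp add: power2_eq_square algebra_simps)
    qed (use that in auto)
    have i: "integrable M (\<lambda>\<omega>. 1 + F n \<omega>)" using elim by simp
    have fi: "integrable M (?f n)"
      using le F(1) by (intro Bochner_Integration.integrable_bound[OF i]) (auto intro!: AE_I2)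
    have "expectation (\<lambda>\<omega>. \<bar>?f n \<omega>\<bar>) \<le> expectation (\<lambda>\<omega>. 1 + F n \<omega>)"
      using le F(1) i fi by (intro integral_mono) auto
    also have "\<dots> \<le> 1 + C" using elim by (simp add: prob_space)
    finally show ?case using fi by blast
  qed
  note prod = tendsto_in_prob_mult_bounded_expectation[OF _ f_bdd]
  have t1: "((\<lambda>(n, \<omega>). \<bar>\<delta> n \<omega>\<bar> * ?f n \<omega>) \<longlongrightarrow> 0) (in_prob M)"
    by (rule prod) (use tendsto_rabs[OF \<delta>] in \<open>simp add: case_prod_beta'\<close>)
  have t2: "((\<lambda>(n, \<omega>). c * \<Delta> n \<omega> * (A + m n \<omega>)) \<longlongrightarrow> c * 0 * (A + \<sigma>)) (in_prob M)" for c
    using \<Delta> m unfolding case_prod_beta' by (intro tendsto_intros)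
  have uf: "((\<lambda>(n, \<omega>). u n \<omega> - ?f n \<omega>) \<longlongrightarrow> 0) (in_prob M)"
  proof (rule Lim_null_comparison)
    show "((\<lambda>(n, \<omega>). \<bar>\<delta> n \<omega>\<bar> * ?f n \<omega> + C1 * \<Delta> n \<omega> * (A + m n \<omega>)) \<longlongrightarrow> 0) (in_prob M)"
      using tendsto_add[OF t1 t2[of C1]] by (simp add: case_prod_beta')
    show "\<forall>\<^sub>F x in in_prob M. norm (case x of (n, \<omega>) \<Rightarrow> u n \<omega> - ?f n \<omega>)
        \<le> (case x of (n, \<omega>) \<Rightarrow> \<bar>\<delta> n \<omega>\<bar> * ?f n \<omega> + C1 * \<Delta> n \<omega> * (A + m n \<omega>))"
      using u by (simp add: case_prod_beta')
  qed
  have qm: "((\<lambda>(n, \<omega>). q n \<omega> - m n \<omega>) \<longlongrightarrow> 0) (in_prob M)"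
  proof (rule Lim_null_comparison)
    show "((\<lambda>(n, \<omega>). C3 * V n \<omega> + C2 * \<Delta> n \<omega> * (A + m n \<omega>)) \<longlongrightarrow> 0) (in_prob M)"
      using tendsto_add[OF tendsto_mult[OF tendsto_const[of C3] V] t2[of C2]] by (simp add: case_prod_beta')
    show "\<forall>\<^sub>F x in in_prob M. norm (case x of (n, \<omega>) \<Rightarrow> q n \<omega> - m n \<omega>)
        \<le> (case x of (n, \<omega>) \<Rightarrow> C3 * V n \<omega> + C2 * \<Delta> n \<omega> * (A + m n \<omega>))"
      using q by (simp add: case_prod_beta')
  qed
  have q_lim: "((\<lambda>(n, \<omega>). q n \<omega>) \<longlongrightarrow> \<sigma>) (in_prob M)"
    using tendsto_add[OF qm m] by (simp add: case_prod_beta')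
  have sq: "((\<lambda>(n, \<omega>). \<sigma> / q n \<omega>) \<longlongrightarrow> 1) (in_prob M)"
    using tendsto_divide[OF tendsto_const[of \<sigma>] q_lim] \<sigma> by (simp add: case_prod_beta')
  have t3: "((\<lambda>(n, \<omega>). (\<sigma> / q n \<omega> - 1) * ?f n \<omega>) \<longlongrightarrow> 0) (in_prob M)"
    by (rule prod) (use tendsto_diff[OF sq tendsto_const[of 1]] in \<open>simp add: case_prod_beta'\<close>)
  \<comment> \<open>With f the root of \<open>F\<close>, the difference is (u - f) \<sigma> / q plus
    (\<sigma> / q - 1) f; the second factor f is bounded in mean.\<close>
  have t4: "((\<lambda>(n, \<omega>). u n \<omega> * \<sigma> / q n \<omega> - ?f n \<omega>) \<longlongrightarrow> 0) (in_prob M)"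
    using tendsto_add[OF tendsto_mult[OF uf sq] t3]
    by (simp add: case_prod_beta' left_diff_distrib diff_divide_distrib)
  have t5: "((\<lambda>(n, \<omega>). (u n \<omega> * \<sigma> / q n \<omega> - ?f n \<omega>) * ?f n \<omega>) \<longlongrightarrow> 0) (in_prob M)"
    by (rule prod[OF t4])
  \<comment> \<open>Expanding around f leaves the square of a small difference and its product with
    f, both of which tend to 0.\<close>
  have alg: "a\<^sup>2 - F n \<omega> = (a - ?f n \<omega>)\<^sup>2 + 2 * ((a - ?f n \<omega>) * ?f n \<omega>)" for a n \<omega>
  proof -
    have "?f n \<omega> * ?f n \<omega> = F n \<omega>" using F(1) by simp
    then show ?thesis by (simp add: power2_eq_square algebra_simps)
  qed
  have "((\<lambda>(n, \<omega>). (u n \<omega> * \<sigma> / q n \<omega>)\<^sup>2 - F n \<omega>) \<longlongrightarrow> 0) (in_prob M)"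
    using tendsto_add[OF tendsto_power[OF t4, of 2] tendsto_mult[OF tendsto_const[of 2] t5]]
    unfolding alg by (simp add: case_prod_beta')
  moreover have "\<forall>\<^sub>F x in in_prob M. (case x of (n, \<omega>) \<Rightarrow> (u n \<omega> * \<sigma> / q n \<omega>)\<^sup>2 - F n \<omega>)
      = (case x of (n, \<omega>) \<Rightarrow> K n \<omega> - F n \<omega>)"
    using K by eventually_elim auto
  ultimately show ?thesis by (rule Lim_transform_eventually)
qed

theorem theorem1p1:
  fixes M :: "'a measure" and N :: "'b measure"
    and p r :: nat
    and \<theta> \<alpha> :: "nat \<Rightarrow> real"
    and \<kappa> \<rho> \<sigma>2\<^sub>\<epsilon> \<sigma>2\<^sub>\<eta> :: real
    and \<epsilon> \<eta> :: "nat \<Rightarrow> 'a \<Rightarrow> real"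
    and X :: "nat \<Rightarrow> int \<Rightarrow> 'a \<Rightarrow> real"
    and \<theta>c \<alpha>h :: "nat \<Rightarrow> nat \<Rightarrow> 'a \<Rightarrow> real"
    and Xc \<epsilon>h :: "nat \<Rightarrow> nat \<Rightarrow> 'a \<Rightarrow> real"
    and K :: "nat \<Rightarrow> 'a \<Rightarrow> real"
    and W :: "real \<Rightarrow> 'b \<Rightarrow> real"
  assumes M: "prob_space M"
    and eps: "prob_space.strong_white_noise M \<epsilon> \<sigma>2\<^sub>\<epsilon>" and eps_var: "\<sigma>2\<^sub>\<epsilon> > 0"
    and eta: "prob_space.strong_white_noise M \<eta> \<sigma>2\<^sub>\<eta>" and eta_var: "\<sigma>2\<^sub>\<eta> \<ge> 0"
    and uncorr: "prob_space.uncorrelated_noises M \<epsilon> \<eta>"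
    and rho: "\<rho> \<in> {-1, 1}"
    and causal: "zeros_outside_unit_circle (ar_poly p \<theta>)"
    and init: "\<And>T s \<omega>. \<omega> \<in> space M \<Longrightarrow> s \<in> {- int p + 1..0} \<Longrightarrow> X T s \<omega> = 0"
    and model: "\<And>T t \<omega>. \<omega> \<in> space M \<Longrightarrow> t \<in> {1..T} \<Longrightarrow>
        lag_poly (ar_poly p \<theta>) (\<lambda>s. X T s \<omega>) (int t) =
          trend r \<alpha> (real t / real T) * indicator {k. k \<noteq> 0} \<kappa>
            + integrated_noise \<rho> \<eta> t \<omega> + \<epsilon> t \<omega>"
    and consistent: "prob_space.consistent_estimator M p \<theta>c \<theta>"
    and Xc: "\<And>T t \<omega>. Xc T t \<omega> = ar_filter p (\<lambda>i. \<theta>c T i \<omega>) (\<lambda>s. X T s \<omega>) t"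
    and ols: "\<And>T \<omega>. \<kappa> \<noteq> 0 \<Longrightarrow> \<omega> \<in> space M \<Longrightarrow>
        ols_trend_fit r T (\<lambda>t. Xc T t \<omega>) (\<lambda>i. \<alpha>h T i \<omega>)"
    and resid: "\<And>T t \<omega>. \<epsilon>h T t \<omega> = residual \<kappa> r T (\<lambda>t. Xc T t \<omega>) (\<lambda>i. \<alpha>h T i \<omega>) t"
    and K: "\<And>T \<omega>. K T \<omega> = kpss_stat T (\<lambda>t. \<epsilon>h T t \<omega>)"
    and N: "prob_space N" and W: "prob_space.standard_Wiener N W"
    and null: "\<sigma>2\<^sub>\<eta> = 0"
  shows "(\<kappa> \<noteq> 0 \<longrightarrow>
            weak_conv_m (\<lambda>T. distr M borel (K T))
              (distr N borel (\<lambda>\<omega>. integral {0..1} (\<lambda>s. (bridge r (\<lambda>t. W t \<omega>) s)\<^sup>2)))) \<and>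
         (\<kappa> = 0 \<longrightarrow>
            weak_conv_m (\<lambda>T. distr M borel (K T))
              (distr N borel (\<lambda>\<omega>. integral {0..1} (\<lambda>s. (W s \<omega>)\<^sup>2))))"
proof -

  \<comment> \<open>Explicit form of the residuals for large samples\<close>
  interpret M: prob_space M by fact
  interpret N: prob_space N by fact
  define \<sigma> where "\<sigma> = sqrt \<sigma>2\<^sub>\<epsilon>"
  have \<sigma>: "\<sigma> > 0" "\<sigma>\<^sup>2 = \<sigma>2\<^sub>\<epsilon>" using eps_var by (auto simp: \<sigma>_def)
  have wn: "M.strong_white_noise \<epsilon> (\<sigma>\<^sup>2)" using eps \<sigma> by simp
  define B where "B = gram_inverse \<kappa> r"
  obtain \<beta> where \<beta>: "\<beta> \<ge> 0" "\<forall>\<^sub>F n in sequentially. \<forall>i\<le>r. \<forall>j\<le>r. \<bar>B n i j\<bar> \<le> \<beta>"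
    unfolding B_def by (rule gram_inverse_eventually_bounded)
  define d where "d n t = trend r \<alpha> (real t / real n) * indicator {k. k \<noteq> 0} \<kappa>" for n t :: nat
  define A where "A = (\<Sum>i\<le>r. \<bar>\<alpha> i\<bar>)"
  have A: "A \<ge> 0" by (auto simp: A_def intro: sum_nonneg)
  have d_bound: "\<bar>d n t\<bar> \<le> A" if "t \<in> {1..n}" for n t
  proof -
    have "\<bar>trend r \<alpha> (real t / real n)\<bar> \<le> A"
      unfolding trend_def A_def
    proof (intro order_trans[OF sum_abs] sum_mono)
      fix i
      have "(real t / real n) ^ i \<le> 1" using that by (intro power_le_one) auto
      then show "\<bar>\<alpha> i * (real t / real n) ^ i\<bar> \<le> \<bar>\<alpha> i\<bar>"
        by (simp add: abs_mult mult_left_le)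
    qed
    then show ?thesis using A by (simp add: d_def indicator_def)
  qed
  \<comment> \<open>These conditions hold from some \<open>n\<close> on; smaller samples, where the
    least squares coefficients need not be unique, are discarded.\<close>
  have good: "\<forall>\<^sub>F n in sequentially. n > 0 \<and> Determinant.det (gram_mat r n) \<noteq> 0 \<and>
      (\<forall>i\<le>r. \<forall>j\<le>r. \<bar>B n i j\<bar> \<le> \<beta>)"
    by (intro eventually_conj eventually_gt_at_top eventually_gram_mat_det \<beta>)
  have fit_d: "fit_resid r (B n) n (d n) k = 0"
    if "n > 0" "Determinant.det (gram_mat r n) \<noteq> 0" for n k
  proof (cases "\<kappa> = 0")
    case True
    then show ?thesis by (simp add: d_def fit_resid_def)
  next
    case False
    then show ?thesis using fit_resid_trend[OF that] by (simp add: d_def[abs_def] B_def gram_inverse_def)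
  qed
  define y where "y n \<omega> = ar_filter p (\<lambda>i. \<theta>c n i \<omega>) (\<lambda>s. X n s \<omega>)" for n \<omega>
  have K_eq: "K n \<omega> = kpss_stat n (fit_resid r (B n) n (y n \<omega>))"
    if "n > 0" "Determinant.det (gram_mat r n) \<noteq> 0" "\<omega> \<in> space M" for n \<omega>
  proof -
    have "\<epsilon>h n t \<omega> = fit_resid r (B n) n (y n \<omega>) t" for t
    proof (cases "\<kappa> = 0")
      case True
      then show ?thesis
        by (simp add: resid residual_def Xc y_def fit_resid_def B_def gram_inverse_def)
    next
      case False
      from residual_eq_fit_resid[OF ols[OF False that(3)] that(1,2) False]
      show ?thesis using False by (simp add: resid Xc y_def[abs_def] B_def gram_inverse_def)
    qed
    then have "(\<lambda>t. \<epsilon>h n t \<omega>) = fit_resid r (B n) n (y n \<omega>)" by (rule ext)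
    then show ?thesis by (simp add: K)
  qed
  define F where "F n \<omega> = mean_square_form (detrend_coeff r (B n) n) n (\<lambda>k. \<epsilon> k \<omega> / (\<sigma> * sqrt n))" for n \<omega>

  \<comment> \<open>Measurability of the statistic\<close>
  have \<theta>c: "\<theta>c n i \<in> borel_measurable M" "M.tendsto_in_prob (\<lambda>n. \<theta>c n i) (\<theta> i)" if "i \<in> {1..p}" for n i
    using consistent that unfolding M.consistent_estimator_def by blast+
  \<comment> \<open>Nothing is known about measurability of \<open>\<alpha>h\<close>. For large
    \<open>n\<close>, however, the residuals are explicit functions of \<open>X\<close> and
    \<open>\<theta>c\<close>, and the path is measurable by induction along the recursion.\<close>
  have K_meas: "\<forall>\<^sub>F n in sequentially. K n \<in> borel_measurable M"
    using good
  proof eventually_elim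
    case (elim n)
    have \<epsilon>m: "\<epsilon> t \<in> borel_measurable M" "\<eta> t \<in> borel_measurable M" if "t \<ge> 1" for t
      using M.strong_white_noise_facts(1)[OF wn that] M.strong_white_noise_facts(1)[OF eta that] by auto
    have im: "integrated_noise \<rho> \<eta> t \<in> borel_measurable M" for t
      by (induction t) (use \<epsilon>m in \<open>simp_all add: integrated_noise.simps[abs_def]\<close>)
    have Xm: "\<forall>s\<in>{- int p + 1..int t}. X n s \<in> borel_measurable M" if "t \<le> n" for t
      using that
    proof (induction t)
      case 0
      have "X n s \<in> borel_measurable M" if "s \<in> {- int p + 1..0}" for s
        using init[OF _ that] by (subst measurable_cong[where g="\<lambda>_. 0"]) auto
      then show ?case by simp
    next
      case (Suc t)
      then have IH: "\<And>s. s \<in> {- int p + 1..int t} \<Longrightarrow> X n s \<in> borel_measurable M" by simp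
      have "X n (int (Suc t)) \<in> borel_measurable M"
      proof (subst measurable_cong)
        fix \<omega> assume "\<omega> \<in> space M"
        from model[OF this, of "Suc t" n] Suc.prems
        show "X n (int (Suc t)) \<omega> = (\<Sum>i=1..p. \<theta> i * X n (int (Suc t) - int i) \<omega>)
            + d n (Suc t) + integrated_noise \<rho> \<eta> (Suc t) \<omega> + \<epsilon> (Suc t) \<omega>"
          unfolding lag_poly_ar_poly d_def by simp
      next
        show "(\<lambda>\<omega>. (\<Sum>i=1..p. \<theta> i * X n (int (Suc t) - int i) \<omega>)
            + d n (Suc t) + integrated_noise \<rho> \<eta> (Suc t) \<omega> + \<epsilon> (Suc t) \<omega>) \<in> borel_measurable M"
          by (intro borel_measurable_add borel_measurable_sum borel_measurable_times
              borel_measurable_const IH im \<epsilon>m) auto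
      qed
      show ?case
      proof
        fix s assume s: "s \<in> {- int p + 1..int (Suc t)}"
        show "X n s \<in> borel_measurable M"
        proof (cases "s = int (Suc t)")
          case True
          then show ?thesis using \<open>X n (int (Suc t)) \<in> borel_measurable M\<close> by simp
        next
          case False
          then show ?thesis using s by (intro IH) auto
        qed
      qed
    qed
    have ym: "(\<lambda>\<omega>. y n \<omega> t) \<in> borel_measurable M" if "t \<in> {1..n}" for t
    proof -
      have Xs: "X n s \<in> borel_measurable M" if "s \<in> {- int p + 1..int n}" for s
        using Xm[of n] that by blast
      show ?thesis unfolding y_def ar_filter_def using that
        by (intro borel_measurable_diff borel_measurable_sum borel_measurable_times \<theta>c(1) Xs) auto
    qed
    have fm: "(\<lambda>\<omega>. fit_resid r (B n) n (y n \<omega>) t) \<in> borel_measurable M" if "t \<in> {1..n}" for t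
      unfolding fit_resid_def using that
      by (intro borel_measurable_diff borel_measurable_sum borel_measurable_times
          borel_measurable_divide borel_measurable_const ym) auto
    have "(\<lambda>\<omega>. kpss_stat n (fit_resid r (B n) n (y n \<omega>))) \<in> borel_measurable M"
      unfolding kpss_stat_def Let_def
      by (intro borel_measurable_times borel_measurable_divide borel_measurable_const
          borel_measurable_sum borel_measurable_power fm) auto
    then show ?case using K_eq[of n] elim by (subst measurable_cong[where g="\<lambda>\<omega>. kpss_stat n (fit_resid r (B n) n (y n \<omega>))"]) auto
  qed

  \<comment> \<open>Asymptotic equivalence of the statistic and the quadratic form\<close>
  define C where "C = 1 + (real r + 1)\<^sup>2 * \<beta>"
  have F_bdd: "\<forall>\<^sub>F n in sequentially. integrable M (F n) \<and> M.expectation (F n) \<le> C\<^sup>2"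
    using good
  proof eventually_elim
    case (elim n)
    have c: "\<bar>detrend_coeff r (B n) n t k\<bar> \<le> C" if "t \<in> {1..n}" "k \<in> {1..n}" for t k
      unfolding C_def using elim by (intro detrend_coeff_bound[OF that]) auto
    have n: "n > 0" using elim by simp
    show ?case unfolding F_def[abs_def]
      by (intro conjI M.mean_square_form_expectation[where c="detrend_coeff r (B n) n" and C=C, OF wn \<sigma>(1) n c])
  qed
  define c where "c = 1 - (\<Sum>i=1..p. \<theta> i)"
  have c: "c \<noteq> 0" unfolding c_def by (rule ar_poly_at_1_nonzero[OF causal])
  define \<Delta> where "\<Delta> n \<omega> = (\<Sum>i=1..p. \<bar>\<theta> i - \<theta>c n i \<omega>\<bar>)" for n \<omega>
  define \<delta> where "\<delta> n \<omega> = (\<Sum>i=1..p. \<theta> i - \<theta>c n i \<omega>) / c" for n \<omega>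
  define m where "m n \<omega> = L2_set (\<lambda>k. \<epsilon> k \<omega>) {1..n} / sqrt n" for n \<omega>
  define V where "V n \<omega> = (\<Sum>j\<le>r. \<bar>(\<Sum>l=1..n. (real l / n) ^ j * \<epsilon> l \<omega>) / n\<bar>)" for n :: nat and \<omega>
  define u where "u n \<omega> = sqrt ((\<Sum>t=1..n. (\<Sum>k=1..t. fit_resid r (B n) n (y n \<omega>) k)\<^sup>2) / (\<sigma>\<^sup>2 * (real n)\<^sup>2))" for n \<omega>
  define q where "q n \<omega> = sqrt ((\<Sum>k=1..n. (fit_resid r (B n) n (y n \<omega>) k)\<^sup>2) / n)" for n :: nat and \<omega>
  define C1 where "C1 = (1 + (real r + 1)\<^sup>2 * (2 * \<beta>)) * (p + p * (\<Sum>i=1..p. \<bar>\<theta> i\<bar>) / \<bar>c\<bar>)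
       * suminf (impulse_response p \<theta>) / \<sigma>"
  define C2 where "C2 = (1 + (real r + 1)\<^sup>2 * \<beta>) * suminf (impulse_response p \<theta>)"
  have AE_eta: "AE \<omega> in M. \<forall>t\<ge>1. \<eta> t \<omega> = 0"
    using eta unfolding null by (rule M.white_noise_variance_0)
  \<comment> \<open>The integrated noise vanishes only almost surely, so the pathwise bounds hold
    off a null set.\<close>
  have perturb: "\<forall>\<^sub>F n in sequentially. AE \<omega> in M.
     \<bar>u n \<omega> - sqrt (F n \<omega>)\<bar> \<le> \<bar>\<delta> n \<omega>\<bar> * sqrt (F n \<omega>) + C1 * \<Delta> n \<omega> * (A + m n \<omega>) \<and>
     \<bar>q n \<omega> - m n \<omega>\<bar> \<le> (real r + 1)\<^sup>2 * \<beta> * V n \<omega> + C2 * \<Delta> n \<omega> * (A + m n \<omega>)"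
    using good
  proof eventually_elim
    case (elim n)
    then have n: "n > 0" and det: "Determinant.det (gram_mat r n) \<noteq> 0"
      and Bb: "\<And>i j. i \<le> r \<Longrightarrow> j \<le> r \<Longrightarrow> \<bar>B n i j\<bar> \<le> \<beta>" by auto
    from AE_eta AE_space show ?case
    proof eventually_elim
      case (elim \<omega>)
      have ini: "X n s \<omega> = 0" if "s \<in> {- int p + 1..0}" for s using init[OF elim(2) that] .
      have eq: "X n (int t) \<omega> - (\<Sum>i=1..p. \<theta> i * X n (int t - int i) \<omega>) = d n t + \<epsilon> t \<omega>"
        if "t \<in> {1..n}" for t
        using model[OF elim(2) that] integrated_noise_eq_0[of \<eta> \<omega> \<rho> t] elim(1)
        unfolding lag_poly_ar_poly d_def by simp
      have Vb: "\<bar>(\<Sum>l=1..n. (real l / n) ^ j * \<epsilon> l \<omega>) / n\<bar> \<le> V n \<omega>" if "j \<le> r" for j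
        unfolding V_def using that
        by (intro member_le_sum[of j _ "\<lambda>j. \<bar>(\<Sum>l=1..n. (real l / n) ^ j * \<epsilon> l \<omega>) / n\<bar>"]) auto
      have "\<bar>u n \<omega> - sqrt (F n \<omega>)\<bar> \<le> \<bar>\<delta> n \<omega>\<bar> * sqrt (F n \<omega>) + C1 * \<Delta> n \<omega> * (A + m n \<omega>)"
        unfolding u_def F_def \<delta>_def \<Delta>_def m_def C1_def c_def y_def
        by (rule residual_partial_sums_perturbation[where x="\<lambda>s. X n s \<omega>" and e="\<lambda>k. \<epsilon> k \<omega>" and d="d n"
              and \<theta>c="\<lambda>i. \<theta>c n i \<omega>" and \<theta>=\<theta>, OF causal ini eq n \<sigma>(1) Bb d_bound A fit_d[OF n det]])
      moreover have "\<bar>q n \<omega> - m n \<omega>\<bar> \<le> (real r + 1)\<^sup>2 * \<beta> * V n \<omega> + C2 * \<Delta> n \<omega> * (A + m n \<omega>)"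
        unfolding q_def \<Delta>_def m_def C2_def y_def
        by (rule residual_mean_square_perturbation[where x="\<lambda>s. X n s \<omega>" and e="\<lambda>k. \<epsilon> k \<omega>" and d="d n"
              and \<theta>c="\<lambda>i. \<theta>c n i \<omega>" and \<theta>=\<theta>, OF causal ini eq n \<sigma>(1) Bb d_bound A fit_d[OF n det] Vb])
      ultimately show ?case ..
    qed
  qed
  have \<theta>_lim: "((\<lambda>(n, \<omega>). \<theta> i - \<theta>c n i \<omega>) \<longlongrightarrow> 0) (in_prob M)" if "i \<in> {1..p}" for i
    using tendsto_diff[OF tendsto_const[of "\<theta> i"] M.tendsto_in_probI[OF \<theta>c[OF that]]]
    by (simp add: case_prod_beta')
  have KF: "((\<lambda>(n, \<omega>). K n \<omega> - F n \<omega>) \<longlongrightarrow> 0) (in_prob M)"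
  proof (rule M.studentized_diff_tendsto_0[OF \<sigma>(1) _ _ _ _ _ F_bdd])
    have "((\<lambda>x. \<Sum>i=1..p. \<bar>\<theta> i - \<theta>c (fst x) i (snd x)\<bar>) \<longlongrightarrow> (\<Sum>i=1..p. \<bar>0\<bar>)) (in_prob M)"
      using \<theta>_lim unfolding case_prod_beta' by (intro tendsto_sum tendsto_rabs)
    then show "((\<lambda>(n, \<omega>). \<Delta> n \<omega>) \<longlongrightarrow> 0) (in_prob M)" by (simp add: \<Delta>_def case_prod_beta')
    have "((\<lambda>x. (\<Sum>i=1..p. \<theta> i - \<theta>c (fst x) i (snd x)) / c) \<longlongrightarrow> (\<Sum>i=1..p. 0) / c) (in_prob M)"
      using \<theta>_lim c unfolding case_prod_beta' by (intro tendsto_divide tendsto_sum tendsto_const)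
    then show "((\<lambda>(n, \<omega>). \<delta> n \<omega>) \<longlongrightarrow> 0) (in_prob M)" by (simp add: \<delta>_def case_prod_beta')
    show "((\<lambda>(n, \<omega>). m n \<omega>) \<longlongrightarrow> \<sigma>) (in_prob M)"
      using M.white_noise_mean_square_tendsto[OF wn] \<sigma>(1) by (simp add: m_def)
    have "((\<lambda>x. \<Sum>j\<le>r. \<bar>(\<Sum>l=1..fst x. (real l / fst x) ^ j * \<epsilon> l (snd x)) / fst x\<bar>)
        \<longlongrightarrow> (\<Sum>j\<le>r. 0)) (in_prob M)"
      using M.white_noise_weighted_mean_tendsto[OF wn] unfolding case_prod_beta' by (intro tendsto_sum)
    then show "((\<lambda>(n, \<omega>). V n \<omega>) \<longlongrightarrow> 0) (in_prob M)" by (simp add: V_def case_prod_beta')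
    show "F n \<omega> \<ge> 0" for n \<omega> unfolding F_def by (rule mean_square_form_nonneg)
    show "\<forall>\<^sub>F (n, \<omega>) in in_prob M. \<bar>u n \<omega> - sqrt (F n \<omega>)\<bar>
        \<le> \<bar>\<delta> n \<omega>\<bar> * sqrt (F n \<omega>) + C1 * \<Delta> n \<omega> * (A + m n \<omega>)"
      by (rule M.eventually_in_prob_AE, rule eventually_mono[OF perturb]) auto
    show "\<forall>\<^sub>F (n, \<omega>) in in_prob M. \<bar>q n \<omega> - m n \<omega>\<bar>
        \<le> (real r + 1)\<^sup>2 * \<beta> * V n \<omega> + C2 * \<Delta> n \<omega> * (A + m n \<omega>)"
      by (rule M.eventually_in_prob_AE, rule eventually_mono[OF perturb]) auto
    show "\<forall>\<^sub>F (n, \<omega>) in in_prob M. K n \<omega> = (u n \<omega> * \<sigma> / q n \<omega>)\<^sup>2"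
    proof (rule M.eventually_in_prob_space, rule eventually_mono[OF good])
      fix n assume "n > 0 \<and> Determinant.det (gram_mat r n) \<noteq> 0 \<and> (\<forall>i\<le>r. \<forall>j\<le>r. \<bar>B n i j\<bar> \<le> \<beta>)"
      then show "\<forall>\<omega>\<in>space M. case (n, \<omega>) of (n, \<omega>) \<Rightarrow> K n \<omega> = (u n \<omega> * \<sigma> / q n \<omega>)\<^sup>2"
        using K_eq[of n] kpss_stat_eq[OF \<sigma>(1), of n] unfolding u_def q_def by simp
    qed
  qed

  \<comment> \<open>Passage to the limit law\<close>
  define G where "G \<omega> = integral {0..1} (\<lambda>t. (W t \<omega> - (\<Sum>i\<le>r. \<Sum>j\<le>r. t ^ Suc i / Suc i * gram_inverse_limit \<kappa> r i j *
          (W 1 \<omega> - integral {0..1} (\<lambda>u. W u \<omega> * (real j * u ^ (j - 1))))))\<^sup>2)" for \<omega>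
  note limit = mean_square_form_laplace_limit[where B=B and b="gram_inverse_limit \<kappa> r" and e=\<epsilon>,
      OF M N W wn \<sigma>(1) _ _ \<beta>(2), folded G_def F_def]
  have B_lim: "(\<lambda>n. B n i j) \<longlonglongrightarrow> gram_inverse_limit \<kappa> r i j" if "i \<le> r" "j \<le> r" for i j
    unfolding B_def using that by (rule gram_inverse_tendsto)
  have G: "G \<in> borel_measurable N" "\<And>\<omega>. \<omega> \<in> space N \<Longrightarrow> G \<omega> \<ge> 0"
    using limit(1)[OF order_refl B_lim] limit(3)[OF order_refl B_lim] by blast+
  have laplace: "(\<lambda>n. \<integral>\<omega>. exp (- real s * F n \<omega>) \<partial>M) \<longlonglongrightarrow> (\<integral>\<omega>. exp (- real s * G \<omega>) \<partial>N)" for s :: nat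
    by (rule limit(2)[OF of_nat_0_le_iff B_lim])
  have Fm: "\<forall>\<^sub>F n in sequentially. F n \<in> borel_measurable M"
    using F_bdd by eventually_elim auto
  have "weak_conv_m (\<lambda>T. distr M borel (K T)) (distr N borel G)"
  proof (rule weak_conv_m_distrI[OF M N K_meas G(1)])
    fix a b :: real assume ab: "a < b"
    \<comment> \<open>Continuous steps are bounded, uniformly continuous and 0 beyond
      \<open>b\<close>, as required by \<open>expectation_diff_tendsto_0\<close> and
      \<open>laplace_conv_imp_expectation_conv\<close>.\<close>
    have uc: "uniformly_continuous_on UNIV (cts_step a b)" by (rule cts_step_uniformly_continuous[OF ab])
    have F_conv: "(\<lambda>n. \<integral>\<omega>. cts_step a b (F n \<omega>) \<partial>M) \<longlonglongrightarrow> (\<integral>\<omega>. cts_step a b (G \<omega>) \<partial>N)"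
    proof (rule laplace_conv_imp_expectation_conv[OF M N Fm _ G laplace uniformly_continuous_imp_continuous[OF uc]])
      show "F n \<omega> \<ge> 0" for n \<omega> unfolding F_def by (rule mean_square_form_nonneg)
      show "cts_step a b z = 0" if "z > b" for z using that ab by (simp add: cts_step_def)
    qed
    have "(\<lambda>n. (\<integral>\<omega>. cts_step a b (K n \<omega>) \<partial>M) - (\<integral>\<omega>. cts_step a b (F n \<omega>) \<partial>M)) \<longlonglongrightarrow> 0"
    proof (rule M.expectation_diff_tendsto_0[OF uc _ KF])
      show "\<bar>cts_step a b z\<bar> \<le> 1" for z using ab by (simp add: cts_step_def)
      show "\<forall>\<^sub>F n in sequentially. K n \<in> borel_measurable M \<and> F n \<in> borel_measurable M"
        using K_meas Fm by (rule eventually_conj)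
    qed
    from tendsto_add[OF this F_conv]
    show "(\<lambda>n. \<integral>\<omega>. cts_step a b (K n \<omega>) \<partial>M) \<longlonglongrightarrow> (\<integral>\<omega>. cts_step a b (G \<omega>) \<partial>N)"
      by (simp only: diff_add_cancel add_0_left)
  qed
  moreover have "G = (\<lambda>\<omega>. integral {0..1} (\<lambda>s. (bridge r (\<lambda>t. W t \<omega>) s)\<^sup>2))" if "\<kappa> \<noteq> 0"
    unfolding G_def[abs_def] using that
    by (intro ext integral_cong) (simp add: bridge_eq gram_inverse_limit_def)
  moreover have "G = (\<lambda>\<omega>. integral {0..1} (\<lambda>s. (W s \<omega>)\<^sup>2))" if "\<kappa> = 0"
    using that by (simp add: G_def[abs_def] gram_inverse_limit_def)
  ultimately show ?thesis by metis
qed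

end
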